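(* Let $q\in\mathbb{C}^*$ be not a root of unity, let $\mathcal{L}U_q\mathfrak{sl}_2$ be the quantum loop algebra with universal R-matrix $\mathfrak{R}$, let $B$ be a right comodule algebra over $\mathcal{L}U_q\mathfrak{sl}_2$, and assume that a universal K-matrix $\mathfrak{K}$ for $B$ and the twist pair $(\eta,1\otimes1)$ exists. Then for every $j\in\frac12\mathbb{N}$ the K-operators $\mathbf{K}^{(j)}(u)=(\mathrm{id}\otimes\pi^{j}_{u^{-1}})(\mathfrak{K})\in B((u^{-1}))\otimes\mathrm{End}(\mathbb{C}^{2j+1})$ satisfy $$\mathbf{K}^{(j+\frac12)}(u)=\mathcal{F}^{(j+\frac12)}_{\langle12\rangle}\,\mathbf{K}_2^{(j)}(uq^{-\frac12})\,\mathcal{R}^{(\frac12,j)}(u^2q^{j-\frac12})\,\mathbf{K}_1^{(\frac12)}(uq^{j})\,\mathcal{E}^{(j+\frac12)}_{\langle12\rangle}.$$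
   Context: $q\in\mathbb{C}^*$ is not a root of unity, $q^{1/2}$ fixed; $[n]_q=\frac{q^n-q^{-n}}{q-q^{-1}}$; $[X,Y]_q=qXY-q^{-1}YX$. **Algebras.** $U_q\mathfrak{sl}_2$: generators $E,F,K^{\pm1/2}$, $K^{1/2}E=qEK^{1/2}$, $K^{1/2}F=q^{-1}FK^{1/2}$, $[E,F]=\frac{K-K^{-1}}{q-q^{-1}}$. $\mathcal{L}U_q\mathfrak{sl}_2$: generators $E_i,F_i,K_i^{\pm1/2}$, $i=0,1$, with $a_{ii}=2,a_{01}=a_{10}=-2$, $K_i^{1/2}E_j=q^{a_{ij}/2}E_jK_i^{1/2}$, $K_i^{1/2}F_j=q^{-a_{ij}/2}F_jK_i^{1/2}$, $[E_i,F_j]=\delta_{ij}\frac{K_i-K_i^{-1}}{q-q^{-1}}$, $K_0^{1/2}K_1^{1/2}=1$, and $[E_i,[E_i,[E_i,E_j]_q]_{q^{-1}}]=0=[F_i,[F_i,[F_i,F_j]_q]_{q^{-1}}]$ for $i\ne j$; coproduct $\Delta(E_i)=E_i\otimes K_i^{1/2}+K_i^{-1/2}\otimes E_i$, $\Delta(F_i)=F_i\otimes K_i^{1/2}+K_i^{-1/2}\otimes F_i$, $\Delta(K_i^{\pm1/2})=K_i^{\pm1/2}\otimes K_i^{\pm1/2}$. $U_q\mathfrak{sl}_2$ acts by $\pi^j$ on $\mathbb{C}^{2j+1}$ with basis $|j,m\rangle$, $m=j,\dots,-j$: $E|j,m\rangle=\sqrt{[j-m]_q[j+m+1]_q}\,|j,m+1\rangle$,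 $F|j,m\rangle=B_{j,m}|j,m-1\rangle$ with $B_{j,m}=\sqrt{[j+m]_q[j-m+1]_q}$, $K^{\pm1/2}|j,m\rangle=q^{\pm m}|j,m\rangle$. For a formal variable $u$, $\mathsf{ev}_u:\mathcal{L}U_q\mathfrak{sl}_2\to U_q\mathfrak{sl}_2[u^{\pm1}]$ is $E_0\mapsto u^{-1}F$, $F_0\mapsto uE$, $K_0^{1/2}\mapsto K^{-1/2}$, $E_1\mapsto u^{-1}E$, $F_1\mapsto uF$, $K_1^{1/2}\mapsto K^{1/2}$, and $\pi^j_u=\pi^j\circ\mathsf{ev}_u$. **Universal R-matrix.** Put $e_\alpha=E_1K_1^{-1/2}$, $e_{\delta-\alpha}=E_0K_0^{-1/2}$, $f_\alpha=K_1^{1/2}F_1$, $f_{\delta-\alpha}=K_0^{1/2}F_0$ and for $k\ge1$: $e'_{k\delta}=q^{-1}[e_{\alpha+(k-1)\delta},e_{\delta-\alpha}]_q$, $f'_{k\delta}=q[f_{\delta-\alpha},f_{\alpha+(k-1)\delta}]_{q^{-1}}$, $e_{\alpha+k\delta}=[2]_q^{-1}[e_{\alpha+(k-1)\delta},e'_\delta]$, $f_{\alpha+k\delta}=[2]_q^{-1}[f'_\delta,f_{\alpha+(k-1)\delta}]$, $e_{\delta-\alpha+k\delta}=[2]_q^{-1}[e'_\delta,e_{\delta-\alpha+(k-1)\delta}]$, $f_{\delta-\alpha+k\delta}=[2]_q^{-1}[f_{\delta-\alpha+(k-1)\delta},f'_\delta]$; and $(q-q^{-1})\sum_{k\ge1}e_{k\delta}z^{-k}=\log(1+(q-q^{-1})\sum_{k\ge1}e'_{k\delta}z^{-k})$,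 $-(q-q^{-1})\sum_{k\ge1}f_{k\delta}z^{-k}=\log(1-(q-q^{-1})\sum_{k\ge1}f'_{k\delta}z^{-k})$. Then $\mathfrak{R}=\mathfrak{R}^+\mathfrak{R}^0\mathfrak{R}^-q^{\frac12h_1\otimes h_1}$ ($q^{h_1}=K_1$), with $\mathfrak{R}^+=\prod_{k=0,1,2,\dots}\exp_{q^{-2}}((q-q^{-1})e_{\alpha+k\delta}\otimes f_{\alpha+k\delta})$ (index increasing left to right), $\mathfrak{R}^0=\exp((q-q^{-1})\sum_{k\ge1}\frac{k}{[2k]_q}e_{k\delta}\otimes f_{k\delta})$, $\mathfrak{R}^-=\prod_{\dots,2,1,0}\exp_{q^{-2}}((q-q^{-1})e_{\delta-\alpha+k\delta}\otimes f_{\delta-\alpha+k\delta})$ (index decreasing left to right), $\exp_p(x)=\sum_{k\ge0}x^k/(k)_p!$, $(k)_p=\frac{p^k-1}{p-1}$. Maps of the form $f\otimes g$ are applied to $\mathfrak{R}$ term by term in the grading by the degrees of $E_0,E_1$. $\mathfrak{R}$ satisfies $\mathfrak{R}\Delta=\Delta^{\mathrm{op}}\mathfrak{R}$, $(\Delta\otimes\mathrm{id})(\mathfrak{R})=\mathfrak{R}_{13}\mathfrak{R}_{23}$, $(\mathrm{id}\otimes\Delta)(\mathfrak{R})=\mathfrak{R}_{13}\mathfrak{R}_{12}$. The R-matrices are $\mathcal{R}^{(j_1,j_2)}(u_1/u_2)=(\pi^{j_1}_{u_1}\otimes\pi^{j_2}_{u_2})(\mathfrak{R})$, a matrix of formal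 power series in $u_2/u_1$. **Universal K-matrix.** $\eta$ is the automorphism of $\mathcal{L}U_q\mathfrak{sl}_2$ with $\eta(E_0)=F_1$, $\eta(E_1)=F_0$, $\eta(F_1)=E_0$, $\eta(F_0)=E_1$, $\eta(K_0^{1/2})=K_1^{-1/2}$, $\eta(K_1^{1/2})=K_0^{-1/2}$. $B$ is an algebra with a right coaction, i.e. an algebra map $\delta:B\to B\otimes\mathcal{L}U_q\mathfrak{sl}_2$, coassociative and counital. A universal K-matrix for $B$ and the twist pair $(\eta,1\otimes 1)$ is $\mathfrak{K}\in B\otimes\mathcal{L}U_q\mathfrak{sl}_2$ (understood, like $\mathfrak{R}$, as a possibly infinite formal sum of elements of this tensor product whose evaluations below make sense) such that, with $\mathfrak{R}^\eta=(\eta\otimes\mathrm{id})(\mathfrak{R})$: (K1) $\mathfrak{K}\,\delta(b)=((\mathrm{id}\otimes\eta)\delta(b))\,\mathfrak{K}$ for all $b\in B$; (K2) $(\delta\otimes\mathrm{id})(\mathfrak{K})=(\mathfrak{R}^\eta)_{32}\mathfrak{K}_{13}\mathfrak{R}_{23}$; (K3) $(\mathrm{id}\otimes\Delta)(\mathfrak{K})=\mathfrak{K}_{13}\mathfrak{R}^\eta_{23}\mathfrak{K}_{12}$. It is assumed that $(\mathrm{id}\otimes\pi^j_{u^{-1}})(\mathfrak{K})$ is a well-defined element of $B((u^{-1}))\otimes\mathrm{End}(\mathbb{C}^{2j+1})$. In the claim $\mathbf{K}_1^{(\frac12)},\mathbf{K}_2^{(j)}$ act on the first, resp. second, factor of $\mathbb{C}^2\otimes\mathbb{C}^{2j+1}$,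 with entries multiplied in $B$. **Matrices $\mathcal{E},\mathcal{F}$.** For $j\in\frac12\mathbb{N}_+$, $\mathcal{E}^{(j+\frac12)}:\mathbb{C}^{2j+2}\to\mathbb{C}^2\otimes\mathbb{C}^{2j+1}$ is the $(4j+2)\times(2j+2)$ matrix, in the bases $|j+\frac12,m\rangle$ ($m$ decreasing) and $|\uparrow\rangle\otimes|j,j\rangle,\dots,|\uparrow\rangle\otimes|j,-j\rangle,|\downarrow\rangle\otimes|j,j\rangle,\dots,|\downarrow\rangle\otimes|j,-j\rangle$ ($|\uparrow\rangle=|\frac12,\frac12\rangle$, $|\downarrow\rangle=|\frac12,-\frac12\rangle$), whose non-zero entries are $\mathcal{E}_{1,1}=1$, $\mathcal{E}_{1+n,1+n}=\prod_{p=0}^{n-1}\frac{B_{j,j-p}}{B_{j+\frac12,j+\frac12-p}}$ ($1\le n\le2j$), $\mathcal{E}_{2j+1+m,1+m}=[m]_q\frac{\mathcal{E}_{m,m}}{B_{j+\frac12,j+\frac32-m}}$ ($1\le m\le2j+1$). $\mathcal{F}^{(j+\frac12)}$ has non-zero entries $\mathcal{F}_{1,1}=1$, $\mathcal{F}_{2j+2,4j+2}=(\mathcal{E}_{4j+2,2j+2})^{-1}$ and, for $2\le n\le2j+1$, $\mathcal{F}_{n,n+2j}=\frac{\mathcal{E}_{n+2j,n}}{\mathcal{E}_{n,n}^2+\mathcal{E}_{n+2j,n}^2}$, $\mathcal{F}_{n,n}=\frac{1-\mathcal{F}_{n,n+2j}\mathcal{E}_{n+2j,n}}{\mathcal{E}_{n,n}}$;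 $\mathcal{F}\mathcal{E}=\mathbb{I}$. For $j=0$, $\mathcal{E}^{(\frac12)}=\mathcal{F}^{(\frac12)}=\mathbb{I}_2$. The subscript $\langle12\rangle$ indicates that the factors $1,2$ are fused. *)

theory Defs
  imports
    "HOL-Computational_Algebra.Formal_Laurent_Series"
    "HOL-Library.Poly_Mapping"
    "HOL-Library.Multiset"
    "Jordan_Normal_Form.Matrix"
begin

section \<open>Complex algebras\<close>

class complex_algebra = ring_1 +
  fixes scaleC :: "complex \<Rightarrow> 'a \<Rightarrow> 'a" (infixr "*\<^sub>C" 75)
  assumes scaleC_add_right: "c *\<^sub>C (x + y) = c *\<^sub>C x + c *\<^sub>C y"
    and scaleC_add_left: "(c + d) *\<^sub>C x = c *\<^sub>C x + d *\<^sub>C x"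
    and scaleC_scaleC: "c *\<^sub>C (d *\<^sub>C x) = (c * d) *\<^sub>C x"
    and scaleC_one: "1 *\<^sub>C x = x"
    and mult_scaleC_left: "(c *\<^sub>C x) * y = c *\<^sub>C (x * y)"
    and mult_scaleC_right: "x * (c *\<^sub>C y) = c *\<^sub>C (x * y)"

lemma scaleC_zero_right: "c *\<^sub>C 0 = (0 :: 'a::complex_algebra)"
  using scaleC_add_right[of c 0 "0 :: 'a"] by simp

lemma scaleC_zero_left: "0 *\<^sub>C x = (0 :: 'a::complex_algebra)"
  using scaleC_add_left[of 0 0 x] by simp

lemma scaleC_minus_right: "c *\<^sub>C (- x) = - (c *\<^sub>C x :: 'a::complex_algebra)"
  using scaleC_add_right[of c "- x" x] by (simp add: scaleC_zero_right eq_neg_iff_add_eq_0)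

instantiation complex :: complex_algebra
begin
definition scaleC_complex :: "complex \<Rightarrow> complex \<Rightarrow> complex"
  where "scaleC_complex c x = c * x"
instance by standard (simp_all add: scaleC_complex_def algebra_simps)
end

definition algebra_hom :: "('a::complex_algebra \<Rightarrow> 'b::complex_algebra) \<Rightarrow> bool"
  where "algebra_hom f \<longleftrightarrow>
    f 1 = 1 \<and> (\<forall>x y. f (x + y) = f x + f y) \<and> (\<forall>x y. f (x * y) = f x * f y) \<and>
    (\<forall>c x. f (c *\<^sub>C x) = c *\<^sub>C f x)"

lemma vector_space_scaleC: "vector_space (scaleC :: complex \<Rightarrow> 'a \<Rightarrow> 'a::complex_algebra)"
  by unfold_locales (simp_all add: scaleC_add_right scaleC_add_left scaleC_scaleC scaleC_one)

lemma ex_linear_functional_one: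
  "\<exists>f :: 'a::complex_algebra \<Rightarrow> complex. (\<forall>x y. f (x + y) = f x + f y) \<and>
     (\<forall>c x. f (c *\<^sub>C x) = c * f x) \<and> f 1 = 1"
proof -
  interpret V: vector_space "scaleC :: complex \<Rightarrow> 'a \<Rightarrow> 'a" by (rule vector_space_scaleC)
  interpret P: vector_space_pair "scaleC :: complex \<Rightarrow> 'a \<Rightarrow> 'a" "(*) :: complex \<Rightarrow> complex \<Rightarrow> complex"
    by unfold_locales (simp_all add: algebra_simps)
  have "V.independent {1 :: 'a}"
    by simp
  from P.linear_independent_extend[OF this, of "\<lambda>_. 1"]
  obtain g :: "'a \<Rightarrow> complex" where g: "Vector_Spaces.linear scaleC (*) g" "g 1 = 1" by auto
  interpret g: Vector_Spaces.linear "scaleC :: complex \<Rightarrow> 'a \<Rightarrow> 'a" "(*)" g by (rule g(1))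
  show ?thesis
    using g(2) g.add g.scale by blast
qed


section \<open>Tensor products of algebras\<close>

text \<open>
  A list of pairs stands for the sum of the corresponding pure tensors; equality of tensors is
  the congruence generated by commutativity of the sum and bilinearity.
\<close>

inductive tensor_eq :: "('a::complex_algebra \<times> 'b::complex_algebra) list \<Rightarrow> ('a \<times> 'b) list \<Rightarrow> bool"
where
  refl: "tensor_eq xs xs"
| sym: "tensor_eq xs ys \<Longrightarrow> tensor_eq ys xs"
| trans: "tensor_eq xs ys \<Longrightarrow> tensor_eq ys zs \<Longrightarrow> tensor_eq xs zs"
| embed: "tensor_eq xs ys \<Longrightarrow> tensor_eq (us @ xs @ vs) (us @ ys @ vs)"
| swap: "tensor_eq [x, y] [y, x]"
| zero: "tensor_eq [(0, b)] []"
| add_left: "tensor_eq [(a + a', b)] [(a, b), (a', b)]"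
| add_right: "tensor_eq [(a, b + b')] [(a, b), (a, b')]"
| scale: "tensor_eq [(c *\<^sub>C a, b)] [(a, c *\<^sub>C b)]"

quotient_type (overloaded) ('a, 'b) tensor = "('a::complex_algebra \<times> 'b::complex_algebra) list" / tensor_eq
proof (intro equivpI reflpI sympI transpI)
  fix xs ys zs :: "('a \<times> 'b) list"
  show "tensor_eq xs xs" by (rule tensor_eq.refl)
  show "tensor_eq xs ys \<Longrightarrow> tensor_eq ys xs" by (rule tensor_eq.sym)
  show "tensor_eq xs ys \<Longrightarrow> tensor_eq ys zs \<Longrightarrow> tensor_eq xs zs" by (rule tensor_eq.trans)
qed

lemma tensor_eq_append:
  assumes "tensor_eq xs xs'" "tensor_eq ys ys'"
  shows "tensor_eq (xs @ ys) (xs' @ ys')"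
proof -
  have "tensor_eq ([] @ xs @ ys) ([] @ xs' @ ys)"
    using assms(1) by (rule tensor_eq.embed)
  moreover have "tensor_eq (xs' @ ys @ []) (xs' @ ys' @ [])"
    using assms(2) by (rule tensor_eq.embed)
  ultimately show ?thesis
    using tensor_eq.trans by auto
qed

lemma tensor_eq_Cons: "tensor_eq xs ys \<Longrightarrow> tensor_eq (x # xs) (x # ys)"
  using tensor_eq_append[OF tensor_eq.refl[of "[x]"]] by auto

lemma tensor_eq_move: "tensor_eq (x # us @ vs) (us @ x # vs)"
proof (induction us)
  case Nil
  show ?case by (simp add: tensor_eq.refl)
next
  case (Cons u us)
  have "tensor_eq ([x, u] @ us @ vs) ([u, x] @ us @ vs)"
    by (intro tensor_eq_append tensor_eq.swap tensor_eq.refl)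
  moreover have "tensor_eq (u # x # us @ vs) (u # us @ x # vs)"
    by (intro tensor_eq_Cons Cons.IH)
  ultimately show ?case using tensor_eq.trans by auto
qed

lemma tensor_eq_mset: "mset xs = mset ys \<Longrightarrow> tensor_eq xs ys"
proof (induction xs arbitrary: ys)
  case Nil
  thus ?case by (simp add: tensor_eq.refl)
next
  case (Cons x xs)
  have "x \<in> set ys" using Cons.prems by (metis list.set_intros(1) set_mset_mset)
  then obtain us vs where ys: "ys = us @ x # vs" by (meson split_list)
  have "tensor_eq xs (us @ vs)" using Cons.prems ys by (intro Cons.IH) simp
  hence "tensor_eq (x # xs) (x # us @ vs)" by (rule tensor_eq_Cons)
  thus ?case using tensor_eq_move[of x us vs] ys tensor_eq.trans by auto
qed

lemma tensor_eq_map: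
  assumes "tensor_eq xs ys"
    and "\<And>a a'. f (a + a') = f a + f a'" "\<And>c a. f (c *\<^sub>C a) = c *\<^sub>C f a"
    and "\<And>b b'. g (b + b') = g b + g b'" "\<And>c b. g (c *\<^sub>C b) = c *\<^sub>C g b"
  shows "tensor_eq (map (\<lambda>(a, b). (f a, g b)) xs) (map (\<lambda>(a, b). (f a, g b)) ys)"
  using assms(1)
proof induction
  case (sym xs ys)
  thus ?case by (rule_tac tensor_eq.sym)
next
  case (trans xs ys zs)
  thus ?case using tensor_eq.trans by blast
next
  case (embed xs ys us vs)
  thus ?case by (simp add: tensor_eq.embed)
next
  case (zero b)
  have "f 0 = 0" using assms(2)[of 0 0] by simp
  thus ?case by (simp add: tensor_eq.zero)
next
  case (swap x y)
  show ?case by (cases x; cases y) (simp add: tensor_eq.swap)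
qed (simp_all add: assms(2-5) tensor_eq.intros)

fun pair_mult :: "'a::times \<times> 'b::times \<Rightarrow> 'a \<times> 'b \<Rightarrow> 'a \<times> 'b"
  where "pair_mult (a, b) (c, d) = (a * c, b * d)"

definition list_mult :: "('a::times \<times> 'b::times) list \<Rightarrow> ('a \<times> 'b) list \<Rightarrow> ('a \<times> 'b) list"
  where "list_mult xs ys = concat (map (\<lambda>x. map (pair_mult x) ys) xs)"

lemma list_mult_simps [simp]:
  "list_mult [] ys = []"
  "list_mult (x # xs) ys = map (pair_mult x) ys @ list_mult xs ys"
  "list_mult xs [] = []"
  "list_mult (xs @ xs') ys = list_mult xs ys @ list_mult xs' ys"
  by (induction xs) (auto simp: list_mult_def)

lemma list_mult_Cons_right:
  "mset (list_mult xs (y # ys)) = mset (map (\<lambda>x. pair_mult x y) xs @ list_mult xs ys)"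
  by (induction xs) auto

lemma list_mult_append_right:
  "mset (list_mult xs (ys @ ys')) = mset (list_mult xs ys @ list_mult xs ys')"
  by (induction xs) auto

lemma pair_mult_eq:
  "pair_mult (a, b) = (\<lambda>(c, d). (a * c, b * d))"
  "(\<lambda>x. pair_mult x (a, b)) = (\<lambda>(c, d). (c * a, d * b))"
  by auto

lemma list_mult_cong_right:
  fixes xs :: "('a::complex_algebra \<times> 'b::complex_algebra) list"
  shows "tensor_eq ys ys' \<Longrightarrow> tensor_eq (list_mult xs ys) (list_mult xs ys')"
proof (induction xs)
  case (Cons x xs)
  obtain a b where x: "x = (a, b)" by force
  have "tensor_eq (map (pair_mult x) ys) (map (pair_mult x) ys')"
    unfolding x pair_mult_eq using Cons.prems
    by (rule tensor_eq_map) (simp_all add: distrib_left mult_scaleC_right)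
  thus ?case using Cons by (simp add: tensor_eq_append)
qed (simp add: tensor_eq.refl)

lemma list_mult_cong_left:
  fixes xs :: "('a::complex_algebra \<times> 'b::complex_algebra) list"
  shows "tensor_eq xs xs' \<Longrightarrow> tensor_eq (list_mult xs ys) (list_mult xs' ys)"
proof (induction ys)
  case (Cons y ys)
  obtain a b where y: "y = (a, b)" by force
  have "tensor_eq (map (\<lambda>x. pair_mult x y) xs) (map (\<lambda>x. pair_mult x y) xs')"
    unfolding y pair_mult_eq using Cons.prems
    by (rule tensor_eq_map) (simp_all add: distrib_right mult_scaleC_left)
  hence "tensor_eq (map (\<lambda>x. pair_mult x y) xs @ list_mult xs ys)
      (map (\<lambda>x. pair_mult x y) xs' @ list_mult xs' ys)"
    using Cons by (simp add: tensor_eq_append)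
  thus ?case
    using tensor_eq_mset[OF list_mult_Cons_right] tensor_eq.trans tensor_eq.sym by blast
qed (simp add: tensor_eq.refl)

lemma tensor_eq_sum_list:
  assumes "tensor_eq xs ys"
    and "\<And>a a' b. f (a + a', b) = f (a, b) + f (a', b)"
    and "\<And>a b b'. f (a, b + b') = f (a, b) + f (a, b')"
    and "\<And>c a b. f (c *\<^sub>C a, b) = f (a, c *\<^sub>C b)"
  shows "sum_list (map f xs) = (sum_list (map f ys) :: 'c::ab_group_add)"
  using assms(1)
proof induction
  case (zero b)
  show ?case using assms(2)[of 0 0 b] by simp
qed (simp_all add: assms(2-4) add.commute)

lemma pair_mult_assoc:
  "pair_mult (pair_mult x y) z = pair_mult x (pair_mult y (z :: 'a::semigroup_mult \<times> 'b::semigroup_mult))"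
  by (cases x; cases y; cases z) (simp add: mult.assoc)

lemma list_mult_map: "list_mult (map (pair_mult x) ys) zs =
    map (pair_mult (x :: 'a::semigroup_mult \<times> 'b::semigroup_mult)) (list_mult ys zs)"
  by (induction ys) (auto simp: pair_mult_assoc)

lemma list_mult_assoc: "list_mult (list_mult xs ys) zs =
    list_mult xs (list_mult ys (zs :: ('a::semigroup_mult \<times> 'b::semigroup_mult) list))"
  by (induction xs) (auto simp: list_mult_map)

lemma tensor_eq_neg: "tensor_eq (map (\<lambda>(a, b). (- a, b)) xs @ xs) []"
proof (induction xs)
  case (Cons x xs)
  obtain a b where x: "x = (a, b)" by force
  let ?n = "map (\<lambda>(a, b). (- a, b)) xs"
  have "tensor_eq ([(- a, b)] @ ?n @ (a, b) # xs) ([(- a, b)] @ (a, b) # ?n @ xs)"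
    by (intro tensor_eq_append tensor_eq.refl tensor_eq.sym[OF tensor_eq_move])
  moreover have "tensor_eq [(- a, b), (a, b)] []"
    using tensor_eq.trans[OF tensor_eq.sym[OF tensor_eq.add_left[of "- a" a b]]] tensor_eq.zero[of b]
    by simp
  hence "tensor_eq ([(- a, b), (a, b)] @ ?n @ xs) ([] @ [])"
    using Cons.IH by (rule tensor_eq_append)
  ultimately show ?case using tensor_eq.trans x by auto
qed (simp add: tensor_eq.refl)

instantiation tensor :: (complex_algebra, complex_algebra) complex_algebra
begin

lift_definition zero_tensor :: "('a, 'b) tensor" is "[]" .

lift_definition one_tensor :: "('a, 'b) tensor" is "[(1, 1)]" .

lift_definition plus_tensor :: "('a, 'b) tensor \<Rightarrow> ('a, 'b) tensor \<Rightarrow> ('a, 'b) tensor"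
  is "(@)" by (rule tensor_eq_append)

lift_definition uminus_tensor :: "('a, 'b) tensor \<Rightarrow> ('a, 'b) tensor"
  is "map (\<lambda>(a, b). (- a, b))"
  by (erule tensor_eq_map[where g = "\<lambda>b. b"])
    (simp_all add: scaleC_minus_right)

definition minus_tensor :: "('a, 'b) tensor \<Rightarrow> ('a, 'b) tensor \<Rightarrow> ('a, 'b) tensor"
  where "minus_tensor x y = x + (- y)"

lift_definition times_tensor :: "('a, 'b) tensor \<Rightarrow> ('a, 'b) tensor \<Rightarrow> ('a, 'b) tensor"
  is list_mult
  by (meson list_mult_cong_left list_mult_cong_right tensor_eq.trans)

lift_definition scaleC_tensor :: "complex \<Rightarrow> ('a, 'b) tensor \<Rightarrow> ('a, 'b) tensor"
  is "\<lambda>c. map (\<lambda>(a, b). (c *\<^sub>C a, b))"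
  by (erule tensor_eq_map[where g = "\<lambda>b. b"]) (simp_all add: scaleC_scaleC mult.commute scaleC_add_right)

instance
proof
  fix x y z :: "('a, 'b) tensor" and c d :: complex
  show "x + y + z = x + (y + z)"
    by transfer (simp add: tensor_eq.refl)
  show "x + y = y + x"
    by transfer (simp add: tensor_eq_mset)
  show "0 + x = x"
    by transfer (simp add: tensor_eq.refl)
  show "- x + x = 0"
    by transfer (rule tensor_eq_neg)
  show "x - y = x + - y"
    by (rule minus_tensor_def)
  show "x * y * z = x * (y * z)"
    by transfer (simp add: list_mult_assoc tensor_eq.refl)
  have id: "pair_mult (1, 1) p = p" "pair_mult p (1, 1) = p" for p :: "'a \<times> 'b"
    by (cases p; simp)+
  have one: "list_mult [(1, 1)] xs = xs" "list_mult xs [(1, 1)] = xs" for xs :: "('a \<times> 'b) list"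
    by (induction xs) (auto simp: id)
  show "1 * x = x"
    by transfer (simp only: one tensor_eq.refl)
  show "x * 1 = x"
    by transfer (simp only: one tensor_eq.refl)
  show "(x + y) * z = x * z + y * z"
    by transfer (simp add: tensor_eq.refl)
  show "x * (y + z) = x * y + x * z"
    by transfer (rule tensor_eq_mset, rule list_mult_append_right)
  show "c *\<^sub>C (x + y) = c *\<^sub>C x + c *\<^sub>C y"
    by transfer (simp add: tensor_eq.refl)
  show "c *\<^sub>C d *\<^sub>C x = (c * d) *\<^sub>C x"
    by transfer (simp add: tensor_eq.refl comp_def case_prod_unfold scaleC_scaleC)
  show "1 *\<^sub>C x = x"
    by transfer (simp add: tensor_eq.refl scaleC_one case_prod_unfold)
  show "(c + d) *\<^sub>C x = c *\<^sub>C x + d *\<^sub>C x"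
  proof transfer
    fix c d and xs :: "('a \<times> 'b) list"
    let ?m = "\<lambda>c. map (\<lambda>(a :: 'a, b :: 'b). (c *\<^sub>C a, b))"
    show "tensor_eq (?m (c + d) xs) (?m c xs @ ?m d xs)"
    proof (induction xs)
      case (Cons x xs)
      obtain a b where x: "x = (a, b)" by force
      have "tensor_eq ([((c + d) *\<^sub>C a, b)] @ ?m (c + d) xs)
          ([(c *\<^sub>C a, b), (d *\<^sub>C a, b)] @ ?m c xs @ ?m d xs)"
        unfolding scaleC_add_left[of c d a] by (intro tensor_eq_append tensor_eq.add_left Cons.IH)
      moreover have "tensor_eq ([(c *\<^sub>C a, b), (d *\<^sub>C a, b)] @ ?m c xs @ ?m d xs)
          ((c *\<^sub>C a, b) # ?m c xs @ (d *\<^sub>C a, b) # ?m d xs)"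
        by (intro tensor_eq_mset) simp
      ultimately show ?case using tensor_eq.trans x by auto
    qed (simp add: tensor_eq.refl)
  qed
  show "(c *\<^sub>C x) * y = c *\<^sub>C (x * y)"
  proof transfer
    fix c and xs ys :: "('a \<times> 'b) list"
    let ?m = "map (\<lambda>(a :: 'a, b :: 'b). (c *\<^sub>C a, b))"
    have "list_mult (?m xs) ys = ?m (list_mult xs ys)"
    proof (induction xs)
      case (Cons x xs)
      have "map (pair_mult ((\<lambda>(a, b). (c *\<^sub>C a, b)) x)) ys = ?m (map (pair_mult x) ys)"
        by (cases x) (auto simp: mult_scaleC_left)
      thus ?case using Cons.IH by simp
    qed simp
    thus "tensor_eq (list_mult (?m xs) ys) (?m (list_mult xs ys))"
      by (simp add: tensor_eq.refl)
  qed
  show "x * (c *\<^sub>C y) = c *\<^sub>C (x * y)"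
  proof transfer
    fix c and xs ys :: "('a \<times> 'b) list"
    let ?m = "map (\<lambda>(a :: 'a, b :: 'b). (c *\<^sub>C a, b))"
    have "list_mult xs (?m ys) = ?m (list_mult xs ys)"
    proof (induction xs)
      case (Cons x xs)
      have "map (pair_mult x) (?m ys) = ?m (map (pair_mult x) ys)"
        by (cases x) (auto simp: mult_scaleC_right)
      thus ?case using Cons.IH by simp
    qed simp
    thus "tensor_eq (list_mult xs (?m ys)) (?m (list_mult xs ys))"
      by (simp add: tensor_eq.refl)
  qed
  show "(0 :: ('a, 'b) tensor) \<noteq> 1"
  proof transfer
    obtain f :: "'a \<Rightarrow> complex" where f: "\<And>x y. f (x + y) = f x + f y"
      "\<And>c x. f (c *\<^sub>C x) = c * f x" "f 1 = 1"
      using ex_linear_functional_one by blast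
    obtain g :: "'b \<Rightarrow> complex" where g: "\<And>x y. g (x + y) = g x + g y"
      "\<And>c x. g (c *\<^sub>C x) = c * g x" "g 1 = 1"
      using ex_linear_functional_one by blast
    show "\<not> tensor_eq [] [(1 :: 'a, 1 :: 'b)]"
    proof
      assume "tensor_eq [] [(1 :: 'a, 1 :: 'b)]"
      from tensor_eq_sum_list[OF this, of "\<lambda>(a, b). f a * g b"] show False
        by (simp add: f g algebra_simps)
    qed
  qed
qed

end

lift_definition pure_tensor :: "'a::complex_algebra \<Rightarrow> 'b::complex_algebra \<Rightarrow> ('a, 'b) tensor"
  (infixr "\<otimes>\<^sub>t" 70) is "\<lambda>a b. [(a, b)]" .

text \<open>
  The linear map on a tensor product induced by a bilinear map; it does not depend on the chosen
  representative precisely because \<open>f\<close> is bilinear in all uses below.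
\<close>

definition tensor_lift ::
  "('a::complex_algebra \<Rightarrow> 'b::complex_algebra \<Rightarrow> 'c::ab_group_add) \<Rightarrow> ('a, 'b) tensor \<Rightarrow> 'c"
  where "tensor_lift f t = (\<Sum>(a, b)\<leftarrow>rep_tensor t. f a b)"

lemma tensor_lift_abs:
  assumes "\<And>a a' b. f (a + a') b = f a b + f a' b" "\<And>a b b'. f a (b + b') = f a b + f a b'"
    and "\<And>c a b. f (c *\<^sub>C a) b = f a (c *\<^sub>C b)"
  shows "tensor_lift f (abs_tensor xs) = (\<Sum>(a, b)\<leftarrow>xs. f a b)"
  unfolding tensor_lift_def
proof (rule tensor_eq_sum_list)
  show "tensor_eq (rep_tensor (abs_tensor xs)) xs"
    by (rule Quotient3_rep_abs[OF Quotient3_tensor tensor_eq.refl])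
qed (simp_all add: assms)


section \<open>Free algebras and presentations\<close>

text \<open>Concatenation of words is written additively to fit the convolution product of \<^typ>\<open>'a \<Rightarrow>\<^sub>0 'b\<close>.\<close>

datatype 'g word = Word (letters: "'g list")

instantiation word :: (type) monoid_add
begin
definition zero_word :: "'g word" where "zero_word = Word []"
definition plus_word :: "'g word \<Rightarrow> 'g word \<Rightarrow> 'g word"
  where "plus_word v w = Word (letters v @ letters w)"
instance by standard (simp_all add: zero_word_def plus_word_def)
end

type_synonym 'g free_algebra = "'g word \<Rightarrow>\<^sub>0 complex"

instantiation poly_mapping :: (monoid_add, complex_algebra) complex_algebra
begin

definition scaleC_poly_mapping :: "complex \<Rightarrow> ('a \<Rightarrow>\<^sub>0 'b) \<Rightarrow> ('a \<Rightarrow>\<^sub>0 'b)"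
  where "scaleC_poly_mapping c p = Poly_Mapping.single 0 (c *\<^sub>C 1) * p"

instance
proof
  fix p r :: "'a \<Rightarrow>\<^sub>0 'b" and c d :: complex
  let ?s = "\<lambda>c. Poly_Mapping.single (0 :: 'a) (c *\<^sub>C 1 :: 'b)"
  have central: "p * ?s c = ?s c * p" for p c
  proof (induction p rule: Poly_Mapping.update_induct)
    case const
    show ?case by simp
  next
    case (update f a b)
    have "Poly_Mapping.update a b f = f + Poly_Mapping.single a b"
      using update(1) by (intro poly_mapping_eqI)
        (auto simp: lookup_update lookup_add lookup_single when_def in_keys_iff)
    thus ?case using update(3)
      by (simp add: distrib_left distrib_right mult_single mult_scaleC_left mult_scaleC_right)
  qed
  show "c *\<^sub>C (p + r) = c *\<^sub>C p + c *\<^sub>C r"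
    by (simp add: scaleC_poly_mapping_def distrib_left)
  show "(c + d) *\<^sub>C p = c *\<^sub>C p + d *\<^sub>C p"
    by (simp add: scaleC_poly_mapping_def distrib_right scaleC_add_left single_add)
  show "c *\<^sub>C d *\<^sub>C p = (c * d) *\<^sub>C p"
    by (simp add: scaleC_poly_mapping_def mult_single mult_scaleC_left scaleC_scaleC flip: mult.assoc)
  show "1 *\<^sub>C p = p"
    by (simp add: scaleC_poly_mapping_def scaleC_one)
  show "(c *\<^sub>C p) * r = c *\<^sub>C (p * r)"
    by (simp add: scaleC_poly_mapping_def mult.assoc)
  show "p * (c *\<^sub>C r) = c *\<^sub>C (p * r)"
    by (simp add: scaleC_poly_mapping_def central flip: mult.assoc)
qed

end

definition free_gen :: "'g \<Rightarrow> 'g free_algebra"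
  where "free_gen x = Poly_Mapping.single (Word [x]) 1"

definition free_eval :: "('g \<Rightarrow> 'a::complex_algebra) \<Rightarrow> 'g free_algebra \<Rightarrow> 'a"
  where "free_eval h p =
    (\<Sum>w\<in>Poly_Mapping.keys p. Poly_Mapping.lookup p w *\<^sub>C prod_list (map h (letters w)))"

inductive_set two_sided_ideal :: "'a::ring_1 set \<Rightarrow> 'a set" for R
where
  zero: "0 \<in> two_sided_ideal R"
| add: "x \<in> two_sided_ideal R \<Longrightarrow> r \<in> R \<Longrightarrow> x + a * r * b \<in> two_sided_ideal R"

definition presented_by :: "('g \<Rightarrow> 'a::complex_algebra) \<Rightarrow> 'g free_algebra set \<Rightarrow> bool"
  where "presented_by g R \<longleftrightarrow>
    surj (free_eval g) \<and> (\<forall>p. free_eval g p = 0 \<longleftrightarrow> p \<in> two_sided_ideal R)"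

text \<open>
  The algebra homomorphism out of an algebra generated by \<open>g\<close> that sends \<open>g x\<close> to \<open>h x\<close>, provided
  that \<open>h\<close> respects the relations among the \<open>g x\<close> (otherwise the value is junk).
\<close>

definition word_poly :: "('g \<Rightarrow> 'a::complex_algebra) \<Rightarrow> 'a \<Rightarrow> 'g free_algebra"
  where "word_poly g x = (SOME p. free_eval g p = x)"

definition hom_ext :: "('g \<Rightarrow> 'a::complex_algebra) \<Rightarrow> ('g \<Rightarrow> 'c::complex_algebra) \<Rightarrow> 'a \<Rightarrow> 'c"
  where "hom_ext g h x = free_eval h (word_poly g x)"

text \<open>The same for \<open>d \<times> d\<close> matrices over \<open>\<complex>((u\<^sup>-\<^sup>1))\<close>, whose size is not fixed by a type.\<close>

definition mat_ext :: "('g \<Rightarrow> 'a::complex_algebra) \<Rightarrow> nat \<Rightarrow> ('g \<Rightarrow> complex fls mat) \<Rightarrow> 'a \<Rightarrow> complex fls mat"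
  where "mat_ext g d h x = mat d d (\<lambda>i.
    \<Sum>w\<in>Poly_Mapping.keys (word_poly g x). fls_const (Poly_Mapping.lookup (word_poly g x) w) *
      foldr (\<lambda>y M. h y * M) (letters w) (1\<^sub>m d) $$ i)"


section \<open>The quantum loop algebra\<close>

text \<open>
  The parameter \<open>s\<close> is the fixed square root of \<open>q\<close>; \<open>gK i\<close> and \<open>gK' i\<close> stand for
  \<open>K\<^sub>i\<^sup>1\<^sup>/\<^sup>2\<close> and \<open>K\<^sub>i\<^sup>-\<^sup>1\<^sup>/\<^sup>2\<close>.
\<close>

definition qint :: "complex \<Rightarrow> int \<Rightarrow> complex"
  where "qint q n = (q powi n - q powi (- n)) / (q - inverse q)"

definition comm :: "'a::complex_algebra \<Rightarrow> 'a \<Rightarrow> 'a"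
  where "comm x y = x * y - y * x"

definition qcomm :: "complex \<Rightarrow> 'a::complex_algebra \<Rightarrow> 'a \<Rightarrow> 'a"
  where "qcomm q x y = q *\<^sub>C (x * y) - inverse q *\<^sub>C (y * x)"

datatype node = N0 | N1

datatype gen = gE node | gF node | gK node | gK' node

definition cartan :: "node \<Rightarrow> node \<Rightarrow> int"
  where "cartan i j = (if i = j then 2 else -2)"

text \<open>The relations \<open>lhs = rhs\<close>, written \<open>lhs - rhs\<close>, for generators \<open>g\<close> in any algebra.\<close>

inductive_set loop_relators :: "complex \<Rightarrow> (gen \<Rightarrow> 'a::complex_algebra) \<Rightarrow> 'a set"
  for s :: complex and g :: "gen \<Rightarrow> 'a::complex_algebra"
where
  K_inv: "g (gK i) * g (gK' i) - 1 \<in> loop_relators s g"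
| inv_K: "g (gK' i) * g (gK i) - 1 \<in> loop_relators s g"
| K_E: "g (gK i) * g (gE j) - (s\<^sup>2) powi (cartan i j div 2) *\<^sub>C (g (gE j) * g (gK i)) \<in> loop_relators s g"
| K_F: "g (gK i) * g (gF j) - (s\<^sup>2) powi (- (cartan i j div 2)) *\<^sub>C (g (gF j) * g (gK i)) \<in> loop_relators s g"
| E_F: "comm (g (gE i)) (g (gF j)) -
    (if i = j then inverse (s\<^sup>2 - inverse (s\<^sup>2)) *\<^sub>C (g (gK i) ^ 2 - g (gK' i) ^ 2) else 0) \<in> loop_relators s g"
| level_zero: "g (gK N0) * g (gK N1) - 1 \<in> loop_relators s g"
| Serre_E: "i \<noteq> j \<Longrightarrow>
    comm (g (gE i)) (qcomm (inverse (s\<^sup>2)) (g (gE i)) (qcomm (s\<^sup>2) (g (gE i)) (g (gE j)))) \<in> loop_relators s g"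
| Serre_F: "i \<noteq> j \<Longrightarrow>
    comm (g (gF i)) (qcomm (inverse (s\<^sup>2)) (g (gF i)) (qcomm (s\<^sup>2) (g (gF i)) (g (gF j)))) \<in> loop_relators s g"

text \<open>
  As a type cannot depend on \<open>s\<close>, the quantum loop algebra is any algebra with a family \<open>g\<close> of
  generators for which the above relations are a presentation; this determines it up to unique
  isomorphism.
\<close>

definition quantum_loop_algebra :: "complex \<Rightarrow> (gen \<Rightarrow> 'l::complex_algebra) \<Rightarrow> bool"
  where "quantum_loop_algebra s g \<longleftrightarrow> presented_by g (loop_relators s free_gen)"

fun coproduct_gen :: "(gen \<Rightarrow> 'l::complex_algebra) \<Rightarrow> gen \<Rightarrow> ('l, 'l) tensor" where
  "coproduct_gen g (gE i) = g (gE i) \<otimes>\<^sub>t g (gK i) + g (gK' i) \<otimes>\<^sub>t g (gE i)"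
| "coproduct_gen g (gF i) = g (gF i) \<otimes>\<^sub>t g (gK i) + g (gK' i) \<otimes>\<^sub>t g (gF i)"
| "coproduct_gen g (gK i) = g (gK i) \<otimes>\<^sub>t g (gK i)"
| "coproduct_gen g (gK' i) = g (gK' i) \<otimes>\<^sub>t g (gK' i)"

definition coproduct :: "(gen \<Rightarrow> 'l::complex_algebra) \<Rightarrow> 'l \<Rightarrow> ('l, 'l) tensor"
  where "coproduct g = hom_ext g (coproduct_gen g)"

fun counit_gen :: "gen \<Rightarrow> complex" where
  "counit_gen (gE i) = 0"
| "counit_gen (gF i) = 0"
| "counit_gen (gK i) = 1"
| "counit_gen (gK' i) = 1"

definition counit :: "(gen \<Rightarrow> 'l::complex_algebra) \<Rightarrow> 'l \<Rightarrow> complex"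
  where "counit g = hom_ext g counit_gen"

fun twist_gen :: "gen \<Rightarrow> gen" where
  "twist_gen (gE N0) = gF N1"
| "twist_gen (gE N1) = gF N0"
| "twist_gen (gF N1) = gE N0"
| "twist_gen (gF N0) = gE N1"
| "twist_gen (gK N0) = gK' N1"
| "twist_gen (gK N1) = gK' N0"
| "twist_gen (gK' N0) = gK N1"
| "twist_gen (gK' N1) = gK N0"

definition twist :: "(gen \<Rightarrow> 'l::complex_algebra) \<Rightarrow> 'l \<Rightarrow> 'l"
  where "twist g = hom_ext g (\<lambda>x. g (twist_gen x))"


section \<open>Evaluation representations\<close>

text \<open>
  Spin \<open>j\<close> is encoded by \<open>J = 2j\<close>, and \<open>|j, j - i\<rangle>\<close> is the basis vector with index \<open>i = 0, \<dots>, J\<close>.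
  Square roots are principal. \<open>spin_B q J i\<close> is \<open>B\<^bsub>j, j-i\<^esub>\<close>; the coefficient of \<open>E\<close> on
  \<open>|j, j - i\<rangle>\<close> is the square root of \<open>[j - m] [j + m + 1] = [i] [J - i + 1]\<close>.
\<close>

definition spin_B :: "complex \<Rightarrow> nat \<Rightarrow> nat \<Rightarrow> complex"
  where "spin_B q J i = csqrt (qint q (int J - int i) * qint q (int i + 1))"

definition spin_E :: "complex \<Rightarrow> nat \<Rightarrow> complex mat"
  where "spin_E s J = mat (J + 1) (J + 1) (\<lambda>(r, c).
    if c = r + 1 then csqrt (qint (s\<^sup>2) (int c) * qint (s\<^sup>2) (int J - int c + 1)) else 0)"

definition spin_F :: "complex \<Rightarrow> nat \<Rightarrow> complex mat"
  where "spin_F s J = mat (J + 1) (J + 1) (\<lambda>(r, c). if r = c + 1 then spin_B (s\<^sup>2) J c else 0)"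

definition spin_K :: "complex \<Rightarrow> nat \<Rightarrow> complex mat"
  where "spin_K s J = mat (J + 1) (J + 1) (\<lambda>(r, c). if r = c then s powi (int J - 2 * int c) else 0)"

definition spin_K' :: "complex \<Rightarrow> nat \<Rightarrow> complex mat"
  where "spin_K' s J = mat (J + 1) (J + 1) (\<lambda>(r, c). if r = c then s powi (- (int J - 2 * int c)) else 0)"

text \<open>
  The variable \<^const>\<open>fls_X\<close> of Laurent series stands for \<open>u\<^sup>-\<^sup>1\<close>, so that \<^typ>\<open>'b fls\<close> is
  \<open>B((u\<^sup>-\<^sup>1))\<close>. Spectral parameters \<open>v\<close> range over \<open>\<complex>((u\<^sup>-\<^sup>1))\<close>; the matrices below are the images of
  the generators under \<open>\<pi>\<^sup>j \<circ> ev\<^sub>v\<close>.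
\<close>

abbreviation spec_u :: "complex fls" where "spec_u \<equiv> fls_X_inv"

fun eval_rep_gen :: "complex \<Rightarrow> nat \<Rightarrow> complex fls \<Rightarrow> gen \<Rightarrow> complex fls mat" where
  "eval_rep_gen s J v (gE N0) = inverse v \<cdot>\<^sub>m map_mat fls_const (spin_F s J)"
| "eval_rep_gen s J v (gF N0) = v \<cdot>\<^sub>m map_mat fls_const (spin_E s J)"
| "eval_rep_gen s J v (gK N0) = map_mat fls_const (spin_K' s J)"
| "eval_rep_gen s J v (gK' N0) = map_mat fls_const (spin_K s J)"
| "eval_rep_gen s J v (gE N1) = inverse v \<cdot>\<^sub>m map_mat fls_const (spin_E s J)"
| "eval_rep_gen s J v (gF N1) = v \<cdot>\<^sub>m map_mat fls_const (spin_F s J)"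
| "eval_rep_gen s J v (gK N1) = map_mat fls_const (spin_K s J)"
| "eval_rep_gen s J v (gK' N1) = map_mat fls_const (spin_K' s J)"

definition eval_rep :: "complex \<Rightarrow> (gen \<Rightarrow> 'l::complex_algebra) \<Rightarrow> nat \<Rightarrow> complex fls \<Rightarrow> 'l \<Rightarrow> complex fls mat"
  where "eval_rep s g J v = mat_ext g (J + 1) (eval_rep_gen s J v)"

definition kron :: "'a::times mat \<Rightarrow> 'a mat \<Rightarrow> 'a mat"
  where "kron A B = mat (dim_row A * dim_row B) (dim_col A * dim_col B)
    (\<lambda>(r, c). A $$ (r div dim_row B, c div dim_col B) * B $$ (r mod dim_row B, c mod dim_col B))"

definition fls_tensor :: "complex fls \<Rightarrow> 'b::complex_algebra \<Rightarrow> 'b fls"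
  where "fls_tensor a b = Abs_fls (\<lambda>n. fls_nth a n *\<^sub>C b)"


section \<open>The universal R-matrix\<close>

context
  fixes s :: complex and g :: "gen \<Rightarrow> 'l::complex_algebra"
begin

abbreviation (input) qq :: complex where "qq \<equiv> s\<^sup>2"

definition e_delta'_1 :: 'l
  where "e_delta'_1 = inverse qq *\<^sub>C qcomm qq (g (gE N1) * g (gK' N1)) (g (gE N0) * g (gK' N0))"

definition f_delta'_1 :: 'l
  where "f_delta'_1 = qq *\<^sub>C qcomm (inverse qq) (g (gK N0) * g (gF N0)) (g (gK N1) * g (gF N1))"

text \<open>
  \<open>e_alpha k\<close>, \<open>e_delta_alpha k\<close> are \<open>e\<^bsub>\<alpha>+k\<delta>\<^esub>\<close>, \<open>e\<^bsub>\<delta>-\<alpha>+k\<delta>\<^esub>\<close>; \<open>e_delta' k\<close>, \<open>e_delta k\<close> are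
  \<open>e'\<^bsub>k\<delta>\<^esub>\<close>, \<open>e\<^bsub>k\<delta>\<^esub>\<close>, relevant for \<open>k \<ge> 1\<close> only; similarly for \<open>f\<close>.
\<close>

primrec e_alpha :: "nat \<Rightarrow> 'l" where
  "e_alpha 0 = g (gE N1) * g (gK' N1)"
| "e_alpha (Suc k) = inverse (qint qq 2) *\<^sub>C comm (e_alpha k) e_delta'_1"

primrec f_alpha :: "nat \<Rightarrow> 'l" where
  "f_alpha 0 = g (gK N1) * g (gF N1)"
| "f_alpha (Suc k) = inverse (qint qq 2) *\<^sub>C comm f_delta'_1 (f_alpha k)"

primrec e_delta_alpha :: "nat \<Rightarrow> 'l" where
  "e_delta_alpha 0 = g (gE N0) * g (gK' N0)"
| "e_delta_alpha (Suc k) = inverse (qint qq 2) *\<^sub>C comm e_delta'_1 (e_delta_alpha k)"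

primrec f_delta_alpha :: "nat \<Rightarrow> 'l" where
  "f_delta_alpha 0 = g (gK N0) * g (gF N0)"
| "f_delta_alpha (Suc k) = inverse (qint qq 2) *\<^sub>C comm (f_delta_alpha k) f_delta'_1"

definition e_delta' :: "nat \<Rightarrow> 'l"
  where "e_delta' k = inverse qq *\<^sub>C qcomm qq (e_alpha (k - 1)) (e_delta_alpha 0)"

definition f_delta' :: "nat \<Rightarrow> 'l"
  where "f_delta' k = qq *\<^sub>C qcomm (inverse qq) (f_delta_alpha 0) (f_alpha (k - 1))"

end

text \<open>\<open>\<Sum>\<^sub>n c\<^sub>n x\<^sup>n\<close> for a power series \<open>x\<close> without constant term.\<close>

definition series_at :: "(nat \<Rightarrow> complex) \<Rightarrow> 'a::complex_algebra fps \<Rightarrow> 'a fps"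
  where "series_at c x = fps_compose (Abs_fps (\<lambda>n. c n *\<^sub>C 1)) x"

definition fps_log1p :: "'a::complex_algebra fps \<Rightarrow> 'a fps"
  where "fps_log1p = series_at (\<lambda>n. if n = 0 then 0 else (-1) ^ (n + 1) / of_nat n)"

definition fps_exponential :: "'a::complex_algebra fps \<Rightarrow> 'a fps"
  where "fps_exponential = series_at (\<lambda>n. 1 / fact n)"

definition fps_qexp :: "complex \<Rightarrow> 'a::complex_algebra fps \<Rightarrow> 'a fps"
  where "fps_qexp p = series_at (\<lambda>n. 1 / (\<Prod>k=1..n. (p ^ k - 1) / (p - 1)))"

context
  fixes s :: complex and g :: "gen \<Rightarrow> 'l::complex_algebra"
begin

abbreviation (input) kappa :: complex where "kappa \<equiv> s\<^sup>2 - inverse (s\<^sup>2)"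

definition e_delta :: "nat \<Rightarrow> 'l"
  where "e_delta k = inverse kappa *\<^sub>C
    fps_nth (fps_log1p (Abs_fps (\<lambda>n. if n = 0 then 0 else kappa *\<^sub>C e_delta' s g n))) k"

definition f_delta :: "nat \<Rightarrow> 'l"
  where "f_delta k = inverse (- kappa) *\<^sub>C
    fps_nth (fps_log1p (Abs_fps (\<lambda>n. if n = 0 then 0 else (- kappa) *\<^sub>C f_delta' s g n))) k"

text \<open>
  The product \<open>\<RR>\<^sup>+ \<RR>\<^sup>0 \<RR>\<^sup>-\<close> as a power series over \<open>L \<otimes> L\<close> whose coefficient of degree \<open>n\<close> is the
  component of total degree \<open>n\<close> in \<open>E\<^sub>0, E\<^sub>1\<close> of the first leg. The \<open>k\<close>-th factor of the infinite
  products is \<open>1\<close> up to degree \<open>2k\<close>, so that finitely many factors determine each component.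
\<close>

definition R_plus :: "('l, 'l) tensor fps"
  where "R_plus = Abs_fps (\<lambda>n. fps_nth (prod_list (map
    (\<lambda>k. fps_qexp (inverse (s\<^sup>2) ^ 2)
      (fps_const (kappa *\<^sub>C (e_alpha s g k \<otimes>\<^sub>t f_alpha s g k)) * fps_X ^ (2 * k + 1)))
    [0..<Suc n])) n)"

definition R_zero :: "('l, 'l) tensor fps"
  where "R_zero = fps_exponential (Abs_fps (\<lambda>n. if even n \<and> n > 0
    then (kappa * (of_nat (n div 2) / qint (s\<^sup>2) (int n))) *\<^sub>C (e_delta (n div 2) \<otimes>\<^sub>t f_delta (n div 2))
    else 0))"

definition R_minus :: "('l, 'l) tensor fps"
  where "R_minus = Abs_fps (\<lambda>n. fps_nth (prod_list (map
    (\<lambda>k. fps_qexp (inverse (s\<^sup>2) ^ 2)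
      (fps_const (kappa *\<^sub>C (e_delta_alpha s g k \<otimes>\<^sub>t f_delta_alpha s g k)) * fps_X ^ (2 * k + 1)))
    (rev [0..<Suc n]))) n)"

text \<open>
  The Cartan factor \<open>q\<^sup>(\<^sup>1\<^sup>/\<^sup>2\<^sup>) \<^sup>h \<^sup>\<otimes> \<^sup>h\<close> with \<open>h = h\<^sub>1\<close>, \<open>K\<^sub>1\<^sup>1\<^sup>/\<^sup>2 = s\<^sup>h\<close>, acts by \<open>s\<^sup>a\<^sup>b\<close> on vectors of weights
  \<open>(a, b)\<close>. It is the limit of its interpolations on the weights \<open>-N, \<dots>, N\<close>: the Lagrange polynomial
  \<open>weight_proj N a\<close> in \<open>K\<^sub>1\<^sup>1\<^sup>/\<^sup>2\<close> acts as the projection to weight \<open>a\<close> on modules with such weights.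
\<close>

definition weight_proj :: "nat \<Rightarrow> int \<Rightarrow> 'l"
  where "weight_proj N a = prod_list (map
    (\<lambda>c. inverse (s powi a - s powi c) *\<^sub>C (g (gK N1) - (s powi c) *\<^sub>C 1))
    (filter (\<lambda>c. c \<noteq> a) [- int N..int N]))"

definition cartan_factor :: "nat \<Rightarrow> ('l, 'l) tensor"
  where "cartan_factor N = (\<Sum>a\<in>{- int N..int N}. \<Sum>b\<in>{- int N..int N}.
    (s powi (a * b)) *\<^sub>C (weight_proj N a \<otimes>\<^sub>t weight_proj N b))"

text \<open>The partial sums converging to the universal R-matrix.\<close>

definition universal_R :: "nat \<Rightarrow> ('l, 'l) tensor"
  where "universal_R N = (\<Sum>n\<le>N. fps_nth (R_plus * R_zero * R_minus) n) * cartan_factor N"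

text \<open>
  The R-matrix with spectral parameter \<open>v = u\<^sub>1 / u\<^sub>2\<close>, a series in \<open>v\<^sup>-\<^sup>1\<close>: as it depends on the
  ratio only, \<open>u\<^sub>2 = 1\<close> is taken. The limit is the adic one, so \<open>v\<close> must have positive degree in \<open>u\<close>.
\<close>

definition R_matrix :: "nat \<Rightarrow> nat \<Rightarrow> complex fls \<Rightarrow> complex fls mat"
  where "R_matrix J1 J2 v = mat ((J1 + 1) * (J2 + 1)) ((J1 + 1) * (J2 + 1)) (\<lambda>i.
    lim (\<lambda>N. tensor_lift (\<lambda>x y. kron (eval_rep s g J1 v x) (eval_rep s g J2 1 y) $$ i) (universal_R N)))"

end


section \<open>Comodule algebras and universal K-matrices\<close>

definition coaction_id ::
  "('b::complex_algebra \<Rightarrow> ('b, 'l::complex_algebra) tensor) \<Rightarrow> ('b, 'l) tensor \<Rightarrow> ('b, ('l, 'l) tensor) tensor"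
  where "coaction_id \<delta> = tensor_lift (\<lambda>b x. tensor_lift (\<lambda>b' y. b' \<otimes>\<^sub>t (y \<otimes>\<^sub>t x)) (\<delta> b))"

definition id_coproduct ::
  "(gen \<Rightarrow> 'l::complex_algebra) \<Rightarrow> ('b::complex_algebra, 'l) tensor \<Rightarrow> ('b, ('l, 'l) tensor) tensor"
  where "id_coproduct g = tensor_lift (\<lambda>b x. b \<otimes>\<^sub>t coproduct g x)"

definition right_comodule_algebra ::
  "(gen \<Rightarrow> 'l::complex_algebra) \<Rightarrow> ('b::complex_algebra \<Rightarrow> ('b, 'l) tensor) \<Rightarrow> bool"
  where "right_comodule_algebra g \<delta> \<longleftrightarrow> algebra_hom \<delta> \<and>
    (\<forall>b. coaction_id \<delta> (\<delta> b) = id_coproduct g (\<delta> b)) \<and>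
    (\<forall>b. tensor_lift (\<lambda>b' x. counit g x *\<^sub>C b') (\<delta> b) = b)"

definition leg12 :: "('b::complex_algebra, 'l::complex_algebra) tensor \<Rightarrow> ('b, ('l, 'l) tensor) tensor"
  where "leg12 = tensor_lift (\<lambda>b x. b \<otimes>\<^sub>t (x \<otimes>\<^sub>t 1))"

definition leg13 :: "('b::complex_algebra, 'l::complex_algebra) tensor \<Rightarrow> ('b, ('l, 'l) tensor) tensor"
  where "leg13 = tensor_lift (\<lambda>b x. b \<otimes>\<^sub>t (1 \<otimes>\<^sub>t x))"

definition leg23 :: "('l::complex_algebra, 'l) tensor \<Rightarrow> ('b::complex_algebra, ('l, 'l) tensor) tensor"
  where "leg23 t = 1 \<otimes>\<^sub>t t"

definition leg32 :: "('l::complex_algebra, 'l) tensor \<Rightarrow> ('b::complex_algebra, ('l, 'l) tensor) tensor"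
  where "leg32 t = 1 \<otimes>\<^sub>t tensor_lift (\<lambda>x y. y \<otimes>\<^sub>t x) t"

definition universal_R_twisted :: "complex \<Rightarrow> (gen \<Rightarrow> 'l::complex_algebra) \<Rightarrow> nat \<Rightarrow> ('l, 'l) tensor"
  where "universal_R_twisted s g N = tensor_lift (\<lambda>x y. twist g x \<otimes>\<^sub>t y) (universal_R s g N)"

context
  fixes s :: complex and g :: "gen \<Rightarrow> 'l::complex_algebra"
begin

definition eval_entry :: "nat \<Rightarrow> complex fls \<Rightarrow> nat \<times> nat \<Rightarrow> ('b::complex_algebra, 'l) tensor \<Rightarrow> 'b fls"
  where "eval_entry J v i = tensor_lift (\<lambda>b x. fls_tensor (eval_rep s g J (inverse v) x $$ i) b)"

text \<open>
  The coefficient of \<open>u\<^sub>1\<^sup>-\<^sup>m u\<^sub>2\<^sup>-\<^sup>n\<close> in an entry of the image under \<open>id \<otimes> \<pi>\<^bsub>1/u\<^sub>1\<^esub> \<otimes> \<pi>\<^bsub>1/u\<^sub>2\<^esub>\<close>, of spins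
  \<open>J1 / 2\<close> and \<open>J2 / 2\<close>, where \<open>i1\<close>, \<open>i2\<close> are the positions in the two matrix factors.
\<close>

definition eval_coeff2 ::
  "nat \<Rightarrow> nat \<Rightarrow> nat \<times> nat \<Rightarrow> nat \<times> nat \<Rightarrow> int \<Rightarrow> int \<Rightarrow> ('b::complex_algebra, ('l, 'l) tensor) tensor \<Rightarrow> 'b"
  where "eval_coeff2 J1 J2 i1 i2 m n = tensor_lift (\<lambda>b t.
    tensor_lift (\<lambda>x y. fls_nth (eval_rep s g J1 (inverse spec_u) x $$ i1) m *
                       fls_nth (eval_rep s g J2 (inverse spec_u) y $$ i2) n) t *\<^sub>C b)"

text \<open>
  Formal infinite sums are sequences of partial sums in \<open>B \<otimes> L\<close> or \<open>B \<otimes> L \<otimes> L\<close>. Two of them are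
  identified if in every evaluation, for every bound \<open>N\<close>, their terms of degree at least \<open>-N\<close> in
  the spectral parameters eventually coincide. With two spectral parameters, \<open>deg m n\<close> is minus the
  degree given to \<open>u\<^sub>1\<^sup>-\<^sup>m u\<^sub>2\<^sup>-\<^sup>n\<close>.
\<close>

definition formal_eq1 :: "(nat \<Rightarrow> ('b::complex_algebra, 'l) tensor) \<Rightarrow> (nat \<Rightarrow> ('b, 'l) tensor) \<Rightarrow> bool"
  where "formal_eq1 X Y \<longleftrightarrow> (\<forall>J N. \<forall>i \<in> {..J} \<times> {..J}. \<forall>\<^sub>F k in sequentially. \<forall>n\<le>N.
    fls_nth (eval_entry J spec_u i (X k)) n = fls_nth (eval_entry J spec_u i (Y k)) n)"

definition formal_eq2 ::
  "(int \<Rightarrow> int \<Rightarrow> int) \<Rightarrow> (nat \<Rightarrow> ('b::complex_algebra, ('l, 'l) tensor) tensor) \<Rightarrow>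
   (nat \<Rightarrow> ('b, ('l, 'l) tensor) tensor) \<Rightarrow> bool"
  where "formal_eq2 deg X Y \<longleftrightarrow>
    (\<forall>J1 J2 N. \<forall>i1 \<in> {..J1} \<times> {..J1}. \<forall>i2 \<in> {..J2} \<times> {..J2}.
      \<forall>\<^sub>F k in sequentially. \<forall>m n. deg m n \<le> N \<longrightarrow>
        eval_coeff2 J1 J2 i1 i2 m n (X k) = eval_coeff2 J1 J2 i1 i2 m n (Y k))"

text \<open>
  \<open>KK\<close> is the sequence of summands of the universal K-matrix. In the identity for \<open>\<delta> \<otimes> id\<close> the
  factor \<open>\<RR>\<^sub>2\<^sub>3\<close> becomes a power series in \<open>u\<^sub>1 / u\<^sub>2\<close>, so both sides are series in \<open>u\<^sub>2\<^sup>-\<^sup>1\<close> with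
  coefficients that are Laurent polynomials in \<open>u\<^sub>1\<close>. In the identity for \<open>id \<otimes> \<Delta>\<close> both sides are
  graded by the total degree in \<open>u\<^sub>1\<close>, \<open>u\<^sub>2\<close>, which the coproduct preserves and which permits
  substituting multiples of one variable for \<open>u\<^sub>1\<close> and \<open>u\<^sub>2\<close>.
\<close>

definition universal_K ::
  "('b::complex_algebra \<Rightarrow> ('b, 'l) tensor) \<Rightarrow> (nat \<Rightarrow> ('b, 'l) tensor) \<Rightarrow> bool"
  where "universal_K \<delta> KK \<longleftrightarrow>
    (let S = (\<lambda>k. \<Sum>i<k. KK i); R = universal_R s g; R' = universal_R_twisted s g in
      (\<forall>J. \<forall>i \<in> {..J} \<times> {..J}. summable (\<lambda>k. eval_entry J spec_u i (KK k))) \<and>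
      (\<forall>b. formal_eq1 (\<lambda>k. S k * \<delta> b) (\<lambda>k. tensor_lift (\<lambda>b' x. b' \<otimes>\<^sub>t twist g x) (\<delta> b) * S k)) \<and>
      formal_eq2 (\<lambda>m n. n) (\<lambda>k. coaction_id \<delta> (S k)) (\<lambda>k. leg32 (R' k) * leg13 (S k) * leg23 (R k)) \<and>
      formal_eq2 (\<lambda>m n. m + n) (\<lambda>k. id_coproduct g (S k)) (\<lambda>k. leg13 (S k) * leg23 (R' k) * leg12 (S k)))"

definition K_operator :: "(nat \<Rightarrow> ('b::complex_algebra, 'l) tensor) \<Rightarrow> nat \<Rightarrow> complex fls \<Rightarrow> 'b fls mat"
  where "K_operator KK J v = mat (J + 1) (J + 1) (\<lambda>i. suminf (\<lambda>k. eval_entry J v i (KK k)))"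

end


section \<open>Fusion\<close>

text \<open>
  \<open>fusion_E s J\<close> and \<open>fusion_F s J\<close> are the matrices for the fusion of spins \<open>1/2\<close> and \<open>J/2\<close>, with
  positions counted from 0 instead of 1.
\<close>

definition fusion_E_diag :: "complex \<Rightarrow> nat \<Rightarrow> nat \<Rightarrow> complex"
  where "fusion_E_diag s J n = (\<Prod>p<n. spin_B (s\<^sup>2) J p / spin_B (s\<^sup>2) (J + 1) p)"

definition fusion_E_low :: "complex \<Rightarrow> nat \<Rightarrow> nat \<Rightarrow> complex"
  where "fusion_E_low s J m = qint (s\<^sup>2) (int m) * fusion_E_diag s J (m - 1) / spin_B (s\<^sup>2) (J + 1) (m - 1)"

definition fusion_E :: "complex \<Rightarrow> nat \<Rightarrow> complex mat"
  where "fusion_E s J = (if J = 0 then 1\<^sub>m 2 else mat (2 * J + 2) (J + 2) (\<lambda>(r, c).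
    if r = c \<and> c \<le> J then fusion_E_diag s J c
    else if r = J + c \<and> 1 \<le> c then fusion_E_low s J c
    else 0))"

definition fusion_F :: "complex \<Rightarrow> nat \<Rightarrow> complex mat"
  where "fusion_F s J = (if J = 0 then 1\<^sub>m 2 else
    (let e = (\<lambda>r c. fusion_E s J $$ (r, c));
         f = (\<lambda>r. e (r + J) r / ((e r r)\<^sup>2 + (e (r + J) r)\<^sup>2))
     in mat (J + 2) (2 * J + 2) (\<lambda>(r, c).
       if r = 0 \<and> c = 0 then 1
       else if r = J + 1 \<and> c = 2 * J + 1 then inverse (e (2 * J + 1) (J + 1))
       else if 1 \<le> r \<and> r \<le> J \<and> c = r + J then f r
       else if 1 \<le> r \<and> r \<le> J \<and> c = r then (1 - f r * e (r + J) r) / e r r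
       else 0)))"

definition scalar_mat :: "complex fls mat \<Rightarrow> 'b::complex_algebra fls mat"
  where "scalar_mat = map_mat (\<lambda>a. fls_tensor a 1)"

end

theory Submission
  imports Defs
begin

text \<open>
  By the third axiom, evaluating \<open>(id \<otimes> \<Delta>) \<KK>\<close> in \<open>\<pi>\<^bsup>1/2\<^esup> \<otimes> \<pi>\<^sup>j\<close> gives the product of the two K-operators with
  the R-matrix in between, where \<open>\<pi>\<^sub>v \<circ> \<eta> = \<pi>\<^bsub>1/v\<^esub>\<close> turns the twisted R-matrix into an ordinary one. At the
  spectral parameters of the theorem \<open>\<E>\<close> intertwines \<open>\<pi>\<^bsup>j+1/2\<^esup>\<close> with this tensor product, and \<open>\<F> \<E> = 1\<close>.
  The intertwining property is needed on generators only. As the infinite sums are limits of partial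
  sums, one also needs that the partial sums of the R-matrix converge in every evaluation; this holds
  because their term of degree \<open>n\<close> evaluates to a constant times the \<open>n\<close>-th power of the ratio of the
  spectral parameters.
\<close>

section \<open>Linear maps on complex algebras\<close>

text \<open>The axiom concerns two independent spectral parameters and equates partial sums only up
  to a bound on the total degree, whereas the claim has one parameter. So both are set to multiples
  of u: u q^j for spin 1/2 and u q^{-1/2} for spin j. With J = 2j and s = q^{1/2} their inverses are
  \<open>a\<close> = s^{-J}/u and \<open>b\<close> = s/u. This substitution mixes only coefficients
  of equal total degree, and at this ratio the tensor product contains a copy of spin j + 1/2.
  Because the twist inverts the first parameter, the R-matrix is a series in a b = u^{-2} q^{1/2-j},
  which has positive order in 1/u; powers of the constant b/a would not tend to 0 adically. A second
  obstacle is that \<open>eval_rep\<close> evaluates a chosen polynomial in the generators. Its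
  multiplicativity has to be earned by checking every relation of the loop algebra; the Serre
  relations follow from the eigenvalue of the Casimir element. Since matrices of variable size form
  no type of class \<open>complex_algebra\<close>, homomorphisms are built into operators on
  sequences and then used through their matrix coefficients.\<close>

definition clinear :: "('a::complex_algebra \<Rightarrow> 'b::complex_algebra) \<Rightarrow> bool"
  where "clinear f \<longleftrightarrow> (\<forall>x y. f (x + y) = f x + f y) \<and> (\<forall>c x. f (c *\<^sub>C x) = c *\<^sub>C f x)"

definition cbilinear :: "('a::complex_algebra \<Rightarrow> 'b::complex_algebra \<Rightarrow> 'c::complex_algebra) \<Rightarrow> bool"
  where "cbilinear f \<longleftrightarrow> (\<forall>y. clinear (\<lambda>x. f x y)) \<and> (\<forall>x. clinear (f x))"

lemma clinearI:
  "(\<And>x y. f (x + y) = f x + f y) \<Longrightarrow> (\<And>c x. f (c *\<^sub>C x) = c *\<^sub>C f x) \<Longrightarrow> clinear f"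
  by (simp add: clinear_def)

lemma clinear_add: "clinear f \<Longrightarrow> f (x + y) = f x + f y"
  and clinear_scaleC: "clinear f \<Longrightarrow> f (c *\<^sub>C x) = c *\<^sub>C f x"
  by (simp_all add: clinear_def)

lemma clinear_zero: "clinear f \<Longrightarrow> f 0 = 0"
  using clinear_add[of f 0 0] by simp

lemma clinear_minus: "clinear f \<Longrightarrow> f (- x) = - f x"
  using clinear_add[of f x "- x"] clinear_zero[of f] by (simp add: eq_neg_iff_add_eq_0 add.commute)

lemma clinear_diff: "clinear f \<Longrightarrow> f (x - y) = f x - f y"
  using clinear_add[of f x "- y"] clinear_minus[of f y] by simp

lemma clinear_sum: "clinear f \<Longrightarrow> f (sum h A) = (\<Sum>i\<in>A. f (h i))"
  by (induction A rule: infinite_finite_induct) (simp_all add: clinear_zero clinear_add)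

lemma cbilinearI:
  "(\<And>x x' y. f (x + x') y = f x y + f x' y) \<Longrightarrow> (\<And>x y y'. f x (y + y') = f x y + f x y') \<Longrightarrow>
   (\<And>c x y. f (c *\<^sub>C x) y = c *\<^sub>C f x y) \<Longrightarrow> (\<And>c x y. f x (c *\<^sub>C y) = c *\<^sub>C f x y) \<Longrightarrow> cbilinear f"
  by (simp add: cbilinear_def clinear_def)

lemma cbilinearD:
  assumes "cbilinear f"
  shows "f (x + x') y = f x y + f x' y" "f x (y + y') = f x y + f x y'"
    "f (c *\<^sub>C x) y = c *\<^sub>C f x y" "f x (c *\<^sub>C y) = c *\<^sub>C f x y"
  using assms by (simp_all add: cbilinear_def clinear_def)

lemma cbilinear_clinear: "cbilinear f \<Longrightarrow> clinear (\<lambda>x. f x y)" "cbilinear f \<Longrightarrow> clinear (f x)"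
  by (simp_all add: cbilinear_def)

lemma clinear_compose: "clinear f \<Longrightarrow> clinear h \<Longrightarrow> clinear (\<lambda>x. f (h x))"
  by (simp add: clinear_def)

lemma clinear_id: "clinear (\<lambda>x. x)"
  by (simp add: clinear_def)

lemma scaleC_sum_right: "c *\<^sub>C sum h A = (\<Sum>i\<in>A. c *\<^sub>C (h i :: 'a::complex_algebra))"
  by (induction A rule: infinite_finite_induct) (simp_all add: scaleC_zero_right scaleC_add_right)

lemma scaleC_sum_left: "sum h A *\<^sub>C x = (\<Sum>i\<in>A. h i *\<^sub>C (x :: 'a::complex_algebra))"
  by (induction A rule: infinite_finite_induct) (simp_all add: scaleC_zero_left scaleC_add_left)

lemma scaleC_commute: "a *\<^sub>C b *\<^sub>C x = b *\<^sub>C a *\<^sub>C (x :: 'a::complex_algebra)"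
  by (simp add: scaleC_scaleC mult.commute)

lemma clinear_sum_fun: "(\<And>i. i \<in> A \<Longrightarrow> clinear (f i)) \<Longrightarrow> clinear (\<lambda>x. \<Sum>i\<in>A. f i x)"
  by (simp add: clinear_def sum.distrib scaleC_sum_right)

lemma clinear_mult: "clinear f \<Longrightarrow> clinear (\<lambda>x. f x * b)" "clinear f \<Longrightarrow> clinear (\<lambda>x. b * f x)"
  by (simp_all add: clinear_def distrib_left distrib_right mult_scaleC_left mult_scaleC_right)

lemma clinear_scaleC_fun: "clinear f \<Longrightarrow> clinear (\<lambda>x. c *\<^sub>C f x)"
  by (simp add: clinear_def scaleC_add_right scaleC_commute[of c])

lemma clinear_mult_sides: "clinear (\<lambda>x. x * b)" "clinear (\<lambda>x. b * x)"
  by (intro clinear_mult clinear_id)+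

lemma algebra_hom_clinear: "algebra_hom f \<Longrightarrow> clinear f"
  by (simp add: algebra_hom_def clinear_def)


section \<open>Tensor products\<close>

lemma pure_tensor_add_left: "(a + a') \<otimes>\<^sub>t b = a \<otimes>\<^sub>t b + a' \<otimes>\<^sub>t b"
  by transfer (simp add: tensor_eq.add_left)

lemma pure_tensor_add_right: "a \<otimes>\<^sub>t (b + b') = a \<otimes>\<^sub>t b + a \<otimes>\<^sub>t b'"
  by transfer (simp add: tensor_eq.add_right)

lemma pure_tensor_scaleC_left: "(c *\<^sub>C a) \<otimes>\<^sub>t b = c *\<^sub>C (a \<otimes>\<^sub>t b)"
  by transfer (simp add: tensor_eq.refl)

lemma pure_tensor_scaleC_right: "a \<otimes>\<^sub>t (c *\<^sub>C b) = c *\<^sub>C (a \<otimes>\<^sub>t b)"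
  by transfer (simp add: tensor_eq.sym[OF tensor_eq.scale])

lemma pure_tensor_mult: "(a \<otimes>\<^sub>t b) * (a' \<otimes>\<^sub>t b') = (a * a') \<otimes>\<^sub>t (b * b')"
  by transfer (simp add: tensor_eq.refl)

lemma one_tensor_pure: "1 = 1 \<otimes>\<^sub>t 1"
  by transfer (simp add: tensor_eq.refl)

lemma abs_tensor_Cons: "abs_tensor ((a, b) # xs) = a \<otimes>\<^sub>t b + abs_tensor xs"
  by (simp add: pure_tensor.abs_eq plus_tensor.abs_eq)

lemma tensor_induct [case_names zero add]:
  assumes "P 0" "\<And>a b t. P t \<Longrightarrow> P (a \<otimes>\<^sub>t b + t)"
  shows "P t"
proof -
  have "\<exists>xs. t = abs_tensor xs" by (induction t rule: tensor.abs_induct) blast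
  then obtain xs where xs: "t = abs_tensor xs" ..
  have "P (abs_tensor xs)"
  proof (induction xs)
    case Nil
    show ?case using assms(1) by (simp add: zero_tensor_def)
  next
    case (Cons x xs)
    thus ?case using assms(2) by (cases x) (simp add: abs_tensor_Cons)
  qed
  thus ?thesis using xs by simp
qed

lemma cbilinear_pure_tensor: "cbilinear (\<otimes>\<^sub>t)"
  by (rule cbilinearI)
    (simp_all add: pure_tensor_add_left pure_tensor_add_right pure_tensor_scaleC_left pure_tensor_scaleC_right)

lemma tensor_lift_abs_bilinear:
  assumes "cbilinear f"
  shows "tensor_lift f (abs_tensor xs) = (\<Sum>(a, b)\<leftarrow>xs. f a b)"
  by (rule tensor_lift_abs) (simp_all add: cbilinearD[OF assms])

lemma tensor_lift_pure: "cbilinear f \<Longrightarrow> tensor_lift f (a \<otimes>\<^sub>t b) = f a b"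
  by (simp add: pure_tensor.abs_eq tensor_lift_abs_bilinear)

lemma tensor_lift_add:
  assumes "cbilinear f"
  shows "tensor_lift f (s + t) = tensor_lift f s + tensor_lift f t"
  by (induction s rule: tensor.abs_induct; induction t rule: tensor.abs_induct)
    (simp add: plus_tensor.abs_eq tensor_lift_abs_bilinear assms)

lemma clinear_tensor_lift:
  assumes f: "cbilinear f"
  shows "clinear (tensor_lift f)"
proof (rule clinearI)
  note add = tensor_lift_add[OF f]
  show "tensor_lift f (x + y) = tensor_lift f x + tensor_lift f y" for x y by (rule add)
  have "tensor_lift f 0 = 0" using add[of 0 0] by simp
  show "tensor_lift f (c *\<^sub>C t) = c *\<^sub>C tensor_lift f t" for c t
  proof (induction t rule: tensor_induct)
    case zero
    show ?case by (simp add: \<open>tensor_lift f 0 = 0\<close> scaleC_zero_right)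
  next
    case (add a b t)
    thus ?case using cbilinearD(3)[OF f]
      by (simp add: scaleC_add_right tensor_lift_add[OF f] tensor_lift_pure[OF f]
        flip: pure_tensor_scaleC_left)
  qed
qed

lemma clinear_tensor_ext:
  assumes "clinear f" "clinear h" "\<And>a b. f (a \<otimes>\<^sub>t b) = h (a \<otimes>\<^sub>t b)"
  shows "f t = h t"
  by (induction t rule: tensor_induct)
    (simp_all add: assms(3) clinear_add[OF assms(1)] clinear_add[OF assms(2)]
      clinear_zero[OF assms(1)] clinear_zero[OF assms(2)])


section \<open>Laurent series over complex algebras\<close>

text \<open>Enlarging or shrinking the range changes the sum only by vanishing terms. A range that
  does not refer to the actual subdegrees allows scaled, truncated or approximating factors to be
  compared term by term.\<close>

lemma fls_times_nth_bounds:
  fixes f h :: "'a::semiring_0 fls"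
  assumes f: "\<And>i. i < a \<Longrightarrow> fls_nth f i = 0" and h: "\<And>i. i < b \<Longrightarrow> fls_nth h i = 0"
  shows "fls_nth (f * h) n = (\<Sum>i=a..n - b. fls_nth f i * fls_nth h (n - i))"
proof -
  let ?t = "\<lambda>i. fls_nth f i * fls_nth h (n - i)"
  let ?S = "{min a (fls_subdegree f)..max (n - b) (n - fls_subdegree h)}"
  have "(\<Sum>i=fls_subdegree f..n - fls_subdegree h. ?t i) = sum ?t ?S"
    by (rule sum.mono_neutral_left) (auto simp: not_le)
  also have "\<dots> = sum ?t {a..n - b}"
    by (rule sum.mono_neutral_right) (auto simp: not_le f h)
  finally show ?thesis by (simp add: fls_times_nth(2))
qed

lemma fls_nth_Abs_map:
  assumes "\<And>n. h n 0 = 0"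
  shows "fls_nth (Abs_fls (\<lambda>n. h n (fls_nth f n))) n = h n (fls_nth f n)"
proof (rule nth_Abs_fls_ex_lower_bound)
  show "\<exists>N. \<forall>n<N. h n (fls_nth f n) = 0"
    using assms by (intro exI[of _ "fls_subdegree f"]) simp
qed

instantiation fls :: (complex_algebra) complex_algebra
begin

definition scaleC_fls :: "complex \<Rightarrow> 'a fls \<Rightarrow> 'a fls"
  where "scaleC_fls c f = Abs_fls (\<lambda>n. c *\<^sub>C fls_nth f n)"

lemma fls_nth_scaleC [simp]: "fls_nth (c *\<^sub>C f) n = c *\<^sub>C fls_nth (f :: 'a fls) n"
  unfolding scaleC_fls_def by (rule fls_nth_Abs_map[of "\<lambda>_ x. c *\<^sub>C x"]) (rule scaleC_zero_right)

instance
proof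
  fix f h :: "'a fls" and c d :: complex
  show "c *\<^sub>C (f + h) = c *\<^sub>C f + c *\<^sub>C h" "(c + d) *\<^sub>C f = c *\<^sub>C f + d *\<^sub>C f"
    "c *\<^sub>C d *\<^sub>C f = (c * d) *\<^sub>C f" "1 *\<^sub>C f = f"
    by (intro fls_eqI; simp add: scaleC_add_right scaleC_add_left scaleC_scaleC scaleC_one)+
  \<comment> \<open>For c = 0 the subdegree of the scaled series jumps to 0, so all products are
    summed over the range given by \<open>f\<close> and \<open>h\<close> themselves.\<close>
  have *: "fls_nth (f' * h') n = (\<Sum>i=fls_subdegree f..n - fls_subdegree h. fls_nth f' i * fls_nth h' (n - i))"
    if "f' \<in> {f, c *\<^sub>C f}" "h' \<in> {h, c *\<^sub>C h}" for f' h' n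
    using that by (intro fls_times_nth_bounds) (auto simp: scaleC_zero_right)
  show "(c *\<^sub>C f) * h = c *\<^sub>C (f * h)" "f * (c *\<^sub>C h) = c *\<^sub>C (f * h)"
    by (intro fls_eqI; simp add: * scaleC_sum_right mult_scaleC_left mult_scaleC_right)+
qed

end

lemma fls_scaleC_conv: "c *\<^sub>C f = fls_const c * (f :: complex fls)"
  by (rule fls_eqI) (simp add: scaleC_complex_def)

lemma fls_nth_fls_tensor [simp]: "fls_nth (fls_tensor a b) n = fls_nth a n *\<^sub>C b"
  unfolding fls_tensor_def by (rule fls_nth_Abs_map[of "\<lambda>_ x. x *\<^sub>C b"]) (rule scaleC_zero_left)

lemma cbilinear_fls_tensor: "cbilinear fls_tensor"
  by (rule cbilinearI; rule fls_eqI)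
    (simp_all add: scaleC_add_left scaleC_add_right scaleC_scaleC scaleC_complex_def mult.commute)

lemma fls_tensor_mult: "fls_tensor a b * fls_tensor a' b' = fls_tensor (a * a') (b * b')"
proof (rule fls_eqI)
  fix n
  let ?l = "fls_subdegree a" and ?l' = "fls_subdegree a'"
  have "fls_nth (fls_tensor a b * fls_tensor a' b') n =
      (\<Sum>i=?l..n - ?l'. fls_nth (fls_tensor a b) i * fls_nth (fls_tensor a' b') (n - i))"
    by (rule fls_times_nth_bounds) (simp_all add: scaleC_zero_left)
  also have "\<dots> = (\<Sum>i=?l..n - ?l'. (fls_nth a i * fls_nth a' (n - i)) *\<^sub>C (b * b'))"
    by (simp add: mult_scaleC_left mult_scaleC_right scaleC_scaleC mult.commute)
  also have "\<dots> = fls_nth (a * a') n *\<^sub>C (b * b')"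
    by (simp add: fls_times_nth(2) scaleC_sum_left)
  finally show "fls_nth (fls_tensor a b * fls_tensor a' b') n = fls_nth (fls_tensor (a * a') (b * b')) n"
    by simp
qed

lemma fls_tensor_one: "fls_tensor 1 1 = 1"
  by (rule fls_eqI) (simp add: scaleC_one scaleC_zero_left)


section \<open>Matrix representations\<close>

text \<open>A homomorphism into the matrices with index set \<open>I\<close> and entries in
  \<open>'c\<close>, given by its coefficients. The index set is a value, so that the spin may be a
  variable, and \<open>'c\<close> may be noncommutative, as series over \<open>'b\<close>
  are.\<close>

definition matrix_rep :: "'i set \<Rightarrow> ('i \<Rightarrow> 'i \<Rightarrow> 'a::complex_algebra \<Rightarrow> 'c::complex_algebra) \<Rightarrow> bool"
  where "matrix_rep I f \<longleftrightarrow> finite I \<and> (\<forall>i\<in>I. \<forall>j\<in>I. clinear (f i j) \<and> f i j 1 = (if i = j then 1 else 0) \<and>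
    (\<forall>x y. f i j (x * y) = (\<Sum>k\<in>I. f i k x * f k j y)))"

lemma matrix_repI:
  assumes "finite I" "\<And>i j. i \<in> I \<Longrightarrow> j \<in> I \<Longrightarrow> clinear (f i j)"
    "\<And>i j. i \<in> I \<Longrightarrow> j \<in> I \<Longrightarrow> f i j 1 = (if i = j then 1 else 0)"
    "\<And>i j x y. i \<in> I \<Longrightarrow> j \<in> I \<Longrightarrow> f i j (x * y) = (\<Sum>k\<in>I. f i k x * f k j y)"
  shows "matrix_rep I f"
  using assms by (simp add: matrix_rep_def)

lemma matrix_repD:
  assumes "matrix_rep I f"
  shows "finite I" "i \<in> I \<Longrightarrow> j \<in> I \<Longrightarrow> clinear (f i j)"
    "i \<in> I \<Longrightarrow> j \<in> I \<Longrightarrow> f i j 1 = (if i = j then 1 else 0)"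
    "i \<in> I \<Longrightarrow> j \<in> I \<Longrightarrow> f i j (x * y) = (\<Sum>k\<in>I. f i k x * f k j y)"
  using assms by (simp_all add: matrix_rep_def)

text \<open>The tensor product of two representations, with \<open>m\<close> a homomorphism on the
  tensor product of the coefficient algebras: the multiplication of the commutative
  \<open>complex fls\<close>, or \<open>fls_tensor\<close>. On pure tensors the claim is the
  expansion of two matrix products; linearity in each factor gives the rest.\<close>

lemma matrix_rep_tensor_lift:
  fixes m :: "'c::complex_algebra \<Rightarrow> 'd::complex_algebra \<Rightarrow> 'e::complex_algebra"
  assumes f: "matrix_rep I f" and h: "matrix_rep I' h" and m: "cbilinear m"
    and m_mult: "\<And>a b a' b'. m (a * a') (b * b') = m a b * m a' b'" and m_one: "m 1 1 = 1"
  shows "matrix_rep (I \<times> I') (\<lambda>i j. tensor_lift (\<lambda>x y. m (f (fst i) (fst j) x) (h (snd i) (snd j) y)))"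
proof (rule matrix_repI)
  let ?F = "\<lambda>i j x y. m (f (fst i) (fst j) x) (h (snd i) (snd j) y)"
  note fh = matrix_repD[OF f] matrix_repD[OF h] and mb = cbilinearD[OF m]
  have m0: "m 0 b = 0" "m a 0 = 0" for a b
    using clinear_zero[OF cbilinear_clinear(1)[OF m]] clinear_zero[OF cbilinear_clinear(2)[OF m]] by auto
  have bil: "cbilinear (?F i j)" if "i \<in> I \<times> I'" "j \<in> I \<times> I'" for i j
  proof -
    have "clinear (f (fst i) (fst j))" "clinear (h (snd i) (snd j))"
      using that by (auto intro: fh)
    thus ?thesis by (intro cbilinearI) (simp_all add: clinear_def mb)
  qed
  note lin = clinear_tensor_lift[OF bil] and pure = tensor_lift_pure[OF bil]
  show "finite (I \<times> I')" using fh by simp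
  fix i j assume ij: "i \<in> I \<times> I'" "j \<in> I \<times> I'"
  show "clinear (tensor_lift (?F i j))" using ij by (rule lin)
  show "tensor_lift (?F i j) 1 = (if i = j then 1 else 0)"
    using ij by (auto simp: one_tensor_pure pure fh m0 m_one prod_eq_iff)
  fix s t
  have pp: "tensor_lift (?F i j) ((a \<otimes>\<^sub>t b) * (a' \<otimes>\<^sub>t b')) =
      (\<Sum>k\<in>I \<times> I'. tensor_lift (?F i k) (a \<otimes>\<^sub>t b) * tensor_lift (?F k j) (a' \<otimes>\<^sub>t b'))" for a b a' b'
  proof -
    have "tensor_lift (?F i j) ((a \<otimes>\<^sub>t b) * (a' \<otimes>\<^sub>t b')) =
        m (\<Sum>k\<in>I. f (fst i) k a * f k (fst j) a') (\<Sum>k\<in>I'. h (snd i) k b * h k (snd j) b')"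
      using ij by (subst pure_tensor_mult) (auto simp: pure fh)
    also have "\<dots> = (\<Sum>k\<in>I. \<Sum>l\<in>I'. m (f (fst i) k a * f k (fst j) a') (h (snd i) l b * h l (snd j) b'))"
      by (simp add: clinear_sum[OF cbilinear_clinear(1)[OF m]] clinear_sum[OF cbilinear_clinear(2)[OF m]])
        (rule sum.swap)
    also have "\<dots> = (\<Sum>k\<in>I \<times> I'. ?F i k a b * ?F k j a' b')"
      by (simp add: m_mult sum.cartesian_product case_prod_unfold)
    finally show ?thesis using ij by (simp add: pure)
  qed
  have p: "tensor_lift (?F i j) ((a \<otimes>\<^sub>t b) * t) =
      (\<Sum>k\<in>I \<times> I'. tensor_lift (?F i k) (a \<otimes>\<^sub>t b) * tensor_lift (?F k j) t)" for a b t
  proof (rule clinear_tensor_ext[where t = t])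
    show "clinear (\<lambda>t. tensor_lift (?F i j) ((a \<otimes>\<^sub>t b) * t))"
      using clinear_compose[OF lin clinear_mult_sides(2)] ij by blast
    show "clinear (\<lambda>t. \<Sum>k\<in>I \<times> I'. tensor_lift (?F i k) (a \<otimes>\<^sub>t b) * tensor_lift (?F k j) t)"
      using ij by (intro clinear_sum_fun clinear_mult(2) lin)
  qed (rule pp)
  show "tensor_lift (?F i j) (s * t) = (\<Sum>k\<in>I \<times> I'. tensor_lift (?F i k) s * tensor_lift (?F k j) t)"
  proof (rule clinear_tensor_ext[where t = s])
    show "clinear (\<lambda>s. tensor_lift (?F i j) (s * t))"
      using clinear_compose[OF lin clinear_mult_sides(1)] ij by blast
    show "clinear (\<lambda>s. \<Sum>k\<in>I \<times> I'. tensor_lift (?F i k) s * tensor_lift (?F k j) t)"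
      using ij by (intro clinear_sum_fun clinear_mult(1) lin)
  qed (rule p)
qed

section \<open>Homomorphisms out of presented algebras\<close>

lemma poly_mapping_induct_single [case_names zero add]:
  fixes p :: "'a \<Rightarrow>\<^sub>0 'b::comm_monoid_add"
  assumes "P 0" "\<And>w a p. P p \<Longrightarrow> P (p + Poly_Mapping.single w a)"
  shows "P p"
proof (induction p rule: Poly_Mapping.update_induct)
  case const
  show ?case by (rule assms(1))
next
  case (update f a b)
  have "Poly_Mapping.update a b f = f + Poly_Mapping.single a b"
    using update(1) by (intro poly_mapping_eqI)
      (auto simp: lookup_update lookup_add lookup_single when_def in_keys_iff)
  thus ?case using update(3) assms(2) by simp
qed

lemma free_eval_superset:
  assumes "finite A" "Poly_Mapping.keys p \<subseteq> A"
  shows "free_eval h p = (\<Sum>w\<in>A. Poly_Mapping.lookup p w *\<^sub>C prod_list (map h (letters w)))"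
  unfolding free_eval_def using assms
  by (intro sum.mono_neutral_left) (auto simp: in_keys_iff scaleC_zero_left)

lemma free_eval_add: "free_eval h (p + r) = free_eval h p + free_eval h r"
proof -
  let ?A = "Poly_Mapping.keys p \<union> Poly_Mapping.keys r"
  have "Poly_Mapping.keys (p + r) \<subseteq> ?A" by (rule Poly_Mapping.keys_add)
  thus ?thesis
    by (simp add: free_eval_superset[of ?A] lookup_add scaleC_add_left sum.distrib)
qed

lemma free_eval_single: "free_eval h (Poly_Mapping.single w c) = c *\<^sub>C prod_list (map h (letters w))"
  by (subst free_eval_superset[of "{w}"]) auto

lemma free_eval_zero: "free_eval h 0 = 0"
  by (simp add: free_eval_def)

lemma free_eval_mult: "free_eval h (p * r) = free_eval h p * free_eval h r"
proof (induction p rule: poly_mapping_induct_single)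
  case (add v a p)
  have "free_eval h (Poly_Mapping.single v a * r) = free_eval h (Poly_Mapping.single v a) * free_eval h r"
    by (induction r rule: poly_mapping_induct_single)
      (simp_all add: free_eval_zero distrib_left free_eval_add mult_single free_eval_single
        plus_word_def mult_scaleC_left mult_scaleC_right scaleC_scaleC mult.commute)
  thus ?case using add by (simp add: distrib_right free_eval_add)
qed (simp add: free_eval_zero)

lemma free_eval_one: "free_eval h 1 = 1"
  using free_eval_single[of h 0 1] unfolding single_one by (simp add: zero_word_def scaleC_one)

lemma algebra_hom_free_eval: "algebra_hom (free_eval h)"
  unfolding algebra_hom_def
proof (intro conjI allI)
  fix c p
  show "free_eval h (c *\<^sub>C p) = c *\<^sub>C free_eval h p"
    by (simp add: scaleC_poly_mapping_def free_eval_mult free_eval_single zero_word_def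
        scaleC_complex_def mult_scaleC_left)
qed (simp_all add: free_eval_one free_eval_add free_eval_mult)

lemma free_eval_free_gen: "free_eval h (free_gen x) = h x"
  by (simp add: free_gen_def free_eval_single scaleC_one)

lemma free_eval_word_poly:
  assumes "presented_by g R"
  shows "free_eval g (word_poly g x) = x"
proof -
  have "\<exists>p. free_eval g p = x" using assms by (metis presented_by_def surjD)
  thus ?thesis unfolding word_poly_def by (rule someI_ex)
qed

text \<open>The polynomial chosen by \<open>word_poly\<close> and \<open>p\<close> have the same
  value, so they differ by an element of the ideal generated by \<open>R\<close>, and there
  \<open>free_eval h\<close> vanishes. Hence the choice has no influence.\<close>

lemma hom_ext_free_eval:
  assumes pr: "presented_by g R" and h: "\<And>r. r \<in> R \<Longrightarrow> free_eval h r = 0"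
  shows "hom_ext g h (free_eval g p) = free_eval h p"
proof -
  note lin = algebra_hom_clinear[OF algebra_hom_free_eval]
  have ideal: "free_eval h r = 0" if "r \<in> two_sided_ideal R" for r
    using that by induction (simp_all add: free_eval_zero free_eval_add free_eval_mult h)
  let ?p = "word_poly g (free_eval g p)"
  have "free_eval g (?p - p) = 0"
    by (simp add: clinear_diff[OF lin] free_eval_word_poly[OF pr])
  hence "free_eval h (?p - p) = 0"
    using pr ideal by (simp add: presented_by_def)
  thus ?thesis by (simp add: hom_ext_def clinear_diff[OF lin])
qed

lemma algebra_hom_hom_ext:
  assumes pr: "presented_by g R" and h: "\<And>r. r \<in> R \<Longrightarrow> free_eval h r = 0"
  shows "algebra_hom (hom_ext g h)"
proof -
  have "hom_ext g h (x + y) = hom_ext g h x + hom_ext g h y"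
    "hom_ext g h (x * y) = hom_ext g h x * hom_ext g h y"
    "hom_ext g h (c *\<^sub>C x) = c *\<^sub>C hom_ext g h x" for c x y
    using hom_ext_free_eval[OF pr h] algebra_hom_free_eval[of h] algebra_hom_free_eval[of g]
      free_eval_word_poly[OF pr, of x] free_eval_word_poly[OF pr, of y]
    unfolding algebra_hom_def by metis+
  moreover have "hom_ext g h 1 = 1"
    using hom_ext_free_eval[OF pr h, of 1] by (simp add: free_eval_one)
  ultimately show ?thesis by (simp add: algebra_hom_def)
qed

lemma hom_ext_gen:
  assumes "presented_by g R" and "\<And>r. r \<in> R \<Longrightarrow> free_eval h r = 0"
  shows "hom_ext g h (g x) = h x"
  using hom_ext_free_eval[OF assms, of "free_gen x"] by (simp add: free_eval_free_gen)

lemma algebra_homD: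
  assumes "algebra_hom f"
  shows "f 1 = 1" "f (x + y) = f x + f y" "f (x * y) = f x * f y" "f (c *\<^sub>C x) = c *\<^sub>C f x"
    "f (x - y) = f x - f y" "f 0 = 0" "f (x ^ n) = f x ^ n"
proof -
  show 1: "f 1 = 1" "f (x + y) = f x + f y" "f (x * y) = f x * f y" "f (c *\<^sub>C x) = c *\<^sub>C f x" for x y c
    using assms by (simp_all add: algebra_hom_def)
  show "f (x - y) = f x - f y" "f 0 = 0"
    using algebra_hom_clinear[OF assms] by (simp_all add: clinear_diff clinear_zero)
  show "f (x ^ n) = f x ^ n" by (induction n) (simp_all add: 1)
qed

text \<open>A relator is built from generators by algebra operations, so a homomorphism carries it
  to the same relator in the images. For \<open>free_eval h\<close> this turns relations checked in
  a target algebra into vanishing on the relators of the presentation.\<close>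

lemma loop_relators_image:
  assumes "algebra_hom f" "r \<in> loop_relators s g"
  shows "f r \<in> loop_relators s (\<lambda>x. f (g x))"
  using assms(2)
proof cases
  case (E_F i j)
  show ?thesis
    using loop_relators.E_F[of "\<lambda>x. f (g x)" i j s] unfolding E_F
    by (auto simp: comm_def algebra_homD[OF assms(1)] split: if_splits)
next
  case (K_inv i)
  show ?thesis using loop_relators.K_inv[of "\<lambda>x. f (g x)" i s] unfolding K_inv
    by (simp add: algebra_homD[OF assms(1)])
next
  case (inv_K i)
  show ?thesis using loop_relators.inv_K[of "\<lambda>x. f (g x)" i s] unfolding inv_K
    by (simp add: algebra_homD[OF assms(1)])
next
  case (K_E i j)
  show ?thesis using loop_relators.K_E[of "\<lambda>x. f (g x)" i j s] unfolding K_E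
    by (simp add: algebra_homD[OF assms(1)])
next
  case (K_F i j)
  show ?thesis using loop_relators.K_F[of "\<lambda>x. f (g x)" i j s] unfolding K_F
    by (simp add: algebra_homD[OF assms(1)])
next
  case level_zero
  show ?thesis using loop_relators.level_zero[of "\<lambda>x. f (g x)" s] unfolding level_zero
    by (simp add: algebra_homD[OF assms(1)])
next
  case (Serre_E i j)
  show ?thesis using loop_relators.Serre_E[of i j "\<lambda>x. f (g x)" s] Serre_E
    by (simp add: comm_def qcomm_def algebra_homD[OF assms(1)])
next
  case (Serre_F i j)
  show ?thesis using loop_relators.Serre_F[of i j "\<lambda>x. f (g x)" s] Serre_F
    by (simp add: comm_def qcomm_def algebra_homD[OF assms(1)])
qed

lemma loop_relators_vanish:
  assumes "loop_relators s h \<subseteq> {0}" "r \<in> loop_relators s free_gen"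
  shows "free_eval h r = 0"
  using loop_relators_image[OF algebra_hom_free_eval[of h] assms(2)] assms(1)
  by (auto simp: free_eval_free_gen)


section \<open>Linear operators on sequences\<close>

text \<open>Linearity is over \<open>complex fls\<close> and not just over the complex numbers,
  because a column of an evaluated element is a combination of unit sequences with Laurent series as
  coefficients.\<close>

typedef seq_op = "{T :: (nat \<Rightarrow> complex fls) \<Rightarrow> nat \<Rightarrow> complex fls.
  (\<forall>f h. T (\<lambda>i. f i + h i) = (\<lambda>i. T f i + T h i)) \<and> (\<forall>a f. T (\<lambda>i. a * f i) = (\<lambda>i. a * T f i))}"
  morphisms seq_apply Abs_seq_op
  by (rule exI[of _ "\<lambda>f. f"]) simp

setup_lifting type_definition_seq_op

instantiation seq_op :: complex_algebra
begin

lift_definition zero_seq_op :: seq_op is "\<lambda>f i. 0" by simp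
lift_definition one_seq_op :: seq_op is "\<lambda>f. f" by simp
lift_definition plus_seq_op :: "seq_op \<Rightarrow> seq_op \<Rightarrow> seq_op" is "\<lambda>S T f i. S f i + T f i"
  by (auto simp: algebra_simps)
lift_definition minus_seq_op :: "seq_op \<Rightarrow> seq_op \<Rightarrow> seq_op" is "\<lambda>S T f i. S f i - T f i"
  by (auto simp: algebra_simps)
lift_definition uminus_seq_op :: "seq_op \<Rightarrow> seq_op" is "\<lambda>T f i. - T f i"
  by (auto simp: algebra_simps)
lift_definition times_seq_op :: "seq_op \<Rightarrow> seq_op \<Rightarrow> seq_op" is "\<lambda>S T f. S (T f)"
  by simp
lift_definition scaleC_seq_op :: "complex \<Rightarrow> seq_op \<Rightarrow> seq_op" is "\<lambda>c T f i. c *\<^sub>C T f i"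
  by (auto simp: scaleC_add_right mult_scaleC_right)

instance
proof
  show "(0 :: seq_op) \<noteq> 1"
  proof
    assume "(0 :: seq_op) = 1"
    hence "seq_apply 0 (\<lambda>_. 1) 0 = seq_apply 1 (\<lambda>_. 1) 0" by simp
    thus False by (simp add: zero_seq_op.rep_eq one_seq_op.rep_eq)
  qed
  fix a b c :: seq_op and x y :: complex
  show "a * (b + c) = a * b + a * c" by transfer simp
  show "a * (x *\<^sub>C b) = x *\<^sub>C (a * b)" by transfer (simp add: fls_scaleC_conv)
qed (transfer; simp add: algebra_simps scaleC_add_right scaleC_add_left scaleC_scaleC scaleC_one)+

end

lemma seq_apply_simps [simp]:
  "seq_apply 0 f = (\<lambda>i. 0)" "seq_apply 1 f = f"
  "seq_apply (S + T) f = (\<lambda>i. seq_apply S f i + seq_apply T f i)"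
  "seq_apply (S - T) f = (\<lambda>i. seq_apply S f i - seq_apply T f i)"
  "seq_apply (S * T) f = seq_apply S (seq_apply T f)"
  "seq_apply (c *\<^sub>C T) f = (\<lambda>i. c *\<^sub>C seq_apply T f i)"
  by (simp_all add: zero_seq_op.rep_eq one_seq_op.rep_eq plus_seq_op.rep_eq minus_seq_op.rep_eq
      times_seq_op.rep_eq scaleC_seq_op.rep_eq)

lemma seq_apply_linear:
  "seq_apply T (\<lambda>i. f i + h i) = (\<lambda>i. seq_apply T f i + seq_apply T h i)"
  "seq_apply T (\<lambda>i. a * f i) = (\<lambda>i. a * seq_apply T f i)"
  using seq_apply[of T] by simp_all

lemma seq_apply_sum:
  "finite A \<Longrightarrow> seq_apply T (\<lambda>i. \<Sum>k\<in>A. a k * f k i) = (\<lambda>i. \<Sum>k\<in>A. a k * seq_apply T (f k) i)"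
proof (induction A rule: finite_induct)
  case empty
  show ?case using seq_apply_linear(2)[of T 0 "\<lambda>_. 0"] by simp
qed (simp add: seq_apply_linear)

lemma seq_op_eqI: "(\<And>f i. seq_apply S f i = seq_apply T f i) \<Longrightarrow> S = T"
  by (intro seq_apply_inject[THEN iffD1] ext)

text \<open>Up and down refer to the weight: the vector of weight m = j - i sits at position i, so
  moving an entry from position \<open>Suc i\<close> to \<open>i\<close> raises the weight.\<close>

definition seq_up :: "(nat \<Rightarrow> complex fls) \<Rightarrow> seq_op"
  where "seq_up a = Abs_seq_op (\<lambda>f i. a i * f (Suc i))"
definition seq_down :: "(nat \<Rightarrow> complex fls) \<Rightarrow> seq_op"
  where "seq_down a = Abs_seq_op (\<lambda>f i. case i of 0 \<Rightarrow> 0 | Suc k \<Rightarrow> a k * f k)"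
definition seq_diag :: "(nat \<Rightarrow> complex fls) \<Rightarrow> seq_op"
  where "seq_diag a = Abs_seq_op (\<lambda>f i. a i * f i)"

lemma seq_apply_shift [simp]:
  "seq_apply (seq_up a) f = (\<lambda>i. a i * f (Suc i))"
  "seq_apply (seq_down a) f = (\<lambda>i. case i of 0 \<Rightarrow> 0 | Suc k \<Rightarrow> a k * f k)"
  "seq_apply (seq_diag a) f = (\<lambda>i. a i * f i)"
proof -
  let ?L = "\<lambda>T :: (nat \<Rightarrow> complex fls) \<Rightarrow> nat \<Rightarrow> complex fls.
    (\<forall>f h. T (\<lambda>i. f i + h i) = (\<lambda>i. T f i + T h i)) \<and> (\<forall>a f. T (\<lambda>i. a * f i) = (\<lambda>i. a * T f i))"
  have *: "?L (\<lambda>f i. a i * f (Suc i))" "?L (\<lambda>f i. a i * f i)"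
    by (simp_all add: distrib_left mult.left_commute)
  have **: "?L (\<lambda>f i. case i of 0 \<Rightarrow> 0 | Suc k \<Rightarrow> a k * f k)"
    by (simp add: distrib_left mult.left_commute fun_eq_iff split: nat.split)
  show "seq_apply (seq_up a) f = (\<lambda>i. a i * f (Suc i))"
    "seq_apply (seq_down a) f = (\<lambda>i. case i of 0 \<Rightarrow> 0 | Suc k \<Rightarrow> a k * f k)"
    "seq_apply (seq_diag a) f = (\<lambda>i. a i * f i)"
    using Abs_seq_op_inverse[OF CollectI[of ?L, OF *(1)]] Abs_seq_op_inverse[OF CollectI[of ?L, OF *(2)]]
      Abs_seq_op_inverse[OF CollectI[of ?L, OF **]]
    unfolding seq_up_def seq_down_def seq_diag_def by simp_all
qed

section \<open>Evaluation representations\<close>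

locale root_param =
  fixes s :: complex
  assumes s_nonzero: "s \<noteq> 0" and not_root: "\<And>n. n > 0 \<Longrightarrow> (s\<^sup>2) ^ n \<noteq> 1"
begin

lemma s_pow_nonroot: "n > 0 \<Longrightarrow> s ^ n \<noteq> 1"
  using not_root[of n] by (metis power_mult mult.commute power_one)

text \<open>Distinct integer weights thus have distinct eigenvalues. Nonzero quantum integers and
  the nodes of the Lagrange polynomials in the Cartan factor both rest on this.\<close>

lemma s_powi_eq_iff: "s powi a = s powi b \<longleftrightarrow> a = b"
proof -
  have *: "a = b" if "s powi a = s powi b" "a \<le> b" for a b
  proof (rule ccontr)
    assume "a \<noteq> b"
    hence "s ^ nat (b - a) \<noteq> 1" using that by (intro s_pow_nonroot) simp
    moreover have "s ^ nat (b - a) = s powi (b - a)" using that by (simp add: power_int_def)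
    moreover have "s powi (b - a) = 1" using that s_nonzero by (simp add: power_int_diff)
    ultimately show False by simp
  qed
  show ?thesis using *[of a b] *[of b a] by (cases "a \<le> b") auto
qed

lemma q_neq_inverse: "s\<^sup>2 \<noteq> inverse (s\<^sup>2)"
  using s_powi_eq_iff[of 2 "-2"] by (simp add: power_int_minus power_int_numeral)

lemma kappa_nonzero: "s\<^sup>2 - inverse (s\<^sup>2) \<noteq> 0"
  using q_neq_inverse by simp

lemma s_sq_powi: "(s\<^sup>2) powi n = s powi (2 * n)"
  by (simp only: power_int_mult power_int_numeral)

lemma qint_nonzero: "n \<noteq> 0 \<Longrightarrow> qint (s\<^sup>2) n \<noteq> 0"
  using kappa_nonzero s_powi_eq_iff[of "2 * n" "2 * (- n)"]
  by (simp add: qint_def s_sq_powi)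

lemma spin_B_nonzero: "r < J \<Longrightarrow> spin_B (s\<^sup>2) J r \<noteq> 0"
  by (simp add: spin_B_def qint_nonzero)

text \<open>\<open>spin_B\<close> vanishes at r = J but not beyond. The cut-off decouples positions
  0, ..., J from the later ones, where E and F are to act by 0.\<close>

definition ladder :: "nat \<Rightarrow> nat \<Rightarrow> complex"
  where "ladder J r = (if r < J then spin_B (s\<^sup>2) J r else 0)"

definition weight :: "nat \<Rightarrow> nat \<Rightarrow> complex"
  where "weight J r = (if r \<le> J then s powi (int J - 2 * int r) else 1)"

text \<open>
  The evaluation representation on the first \<open>J + 1\<close> coordinates is extended by the trivial
  representation on the other ones: unlike matrices of variable size, operators on sequences form an
  algebra, into which homomorphisms can be defined on generators.
\<close>

fun eval_op :: "nat \<Rightarrow> complex fls \<Rightarrow> gen \<Rightarrow> seq_op" where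
  "eval_op J v (gE N0) = seq_down (\<lambda>r. ladder J r *\<^sub>C inverse v)"
| "eval_op J v (gF N0) = seq_up (\<lambda>r. ladder J r *\<^sub>C v)"
| "eval_op J v (gK N0) = seq_diag (\<lambda>r. fls_const (inverse (weight J r)))"
| "eval_op J v (gK' N0) = seq_diag (\<lambda>r. fls_const (weight J r))"
| "eval_op J v (gE N1) = seq_up (\<lambda>r. ladder J r *\<^sub>C inverse v)"
| "eval_op J v (gF N1) = seq_down (\<lambda>r. ladder J r *\<^sub>C v)"
| "eval_op J v (gK N1) = seq_diag (\<lambda>r. fls_const (weight J r))"
| "eval_op J v (gK' N1) = seq_diag (\<lambda>r. fls_const (inverse (weight J r)))"

lemma weight_nonzero: "weight J r \<noteq> 0"
  using s_nonzero by (simp add: weight_def)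

lemma weight_Suc: "Suc r \<le> J \<Longrightarrow> weight J r = s\<^sup>2 * weight J (Suc r)"
proof -
  assume "Suc r \<le> J"
  moreover have "s powi (int J - 2 * int r) = s powi (2 + (int J - 2 * int (Suc r)))"
    by (rule arg_cong[of _ _ "\<lambda>n. s powi n"]) simp
  moreover have "s powi (2 + (int J - 2 * int (Suc r))) = s\<^sup>2 * s powi (int J - 2 * int (Suc r))"
    using s_nonzero by (subst power_int_add) (simp_all add: power_int_numeral)
  ultimately show ?thesis by (simp add: weight_def)
qed

text \<open>With kappa = q - 1/q, this is the eigenvalue on spin J/2 of the Casimir element kappa^2
  E F + q^{-1} K + q K^{-1} = kappa^2 F E + q K + q^{-1} K^{-1}.\<close>

definition casimir :: "nat \<Rightarrow> complex"
  where "casimir J = (s\<^sup>2) ^ (J + 1) + inverse (s\<^sup>2) ^ (J + 1)"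

text \<open>\<open>(ladder J r)\<^sup>2\<close> is the eigenvalue of E F at position r, so this is
  the Casimir identity there. Multiplying out the two quantum integers gives four powers of q, and
  the two extreme ones form \<open>casimir J\<close>.\<close>

lemma ladder_sq:
  assumes "r \<le> J"
  shows "(ladder J r)\<^sup>2 * (s\<^sup>2 - inverse (s\<^sup>2))\<^sup>2 =
    casimir J - inverse (s\<^sup>2) * (weight J r)\<^sup>2 - s\<^sup>2 * (inverse (weight J r))\<^sup>2"
proof -
  let ?q = "s\<^sup>2"
  have q: "?q \<noteq> 0" using s_nonzero by simp
  have w: "(weight J r)\<^sup>2 = ?q powi (int J - 2 * int r)"
    using assms s_nonzero by (simp add: weight_def s_sq_powi power2_eq_square[of "_ powi _"] flip: power_int_add)
  have "(ladder J r)\<^sup>2 = qint ?q (int J - int r) * qint ?q (int r + 1)"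
    using assms by (cases "r < J") (auto simp: ladder_def spin_B_def qint_def)
  hence "(ladder J r)\<^sup>2 * (?q - inverse ?q)\<^sup>2 =
      (?q powi (int J - int r) - ?q powi (int r - int J)) * (?q powi (int r + 1) - ?q powi (- int r - 1))"
    using kappa_nonzero by (simp add: qint_def power2_eq_square[of "?q - inverse ?q"])
  also have "\<dots> = ?q powi ((int J - int r) + (int r + 1)) + ?q powi ((int r - int J) + (- int r - 1))
      - ?q powi ((int J - int r) + (- int r - 1)) - ?q powi ((int r - int J) + (int r + 1))"
    by (simp only: power_int_add[OF disjI1[OF q]]) (simp add: algebra_simps)
  also have "\<dots> = ?q powi (int J + 1) + ?q powi (- (int J + 1))
      - ?q powi (- 1 + (int J - 2 * int r)) - ?q powi (1 + - (int J - 2 * int r))"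
  proof -
    have "(int J - int r) + (int r + 1) = int J + 1" "(int r - int J) + (- int r - 1) = - (int J + 1)"
      "(int J - int r) + (- int r - 1) = - 1 + (int J - 2 * int r)"
      "(int r - int J) + (int r + 1) = 1 + - (int J - 2 * int r)" by simp_all
    thus ?thesis by (simp only:)
  qed
  also have "\<dots> = casimir J - inverse ?q * (weight J r)\<^sup>2 - ?q * (inverse (weight J r))\<^sup>2"
    unfolding power_int_add[OF disjI1[OF q]] w power_inverse
    by (simp add: casimir_def power_int_minus power_int_def power_inverse nat_add_distrib)
  finally show ?thesis .
qed

text \<open>The eigenvalue of F E at position r; it is 0 on the highest weight vector.\<close>

definition ladder_prev_sq :: "nat \<Rightarrow> nat \<Rightarrow> complex"
  where "ladder_prev_sq J r = (case r of 0 \<Rightarrow> 0 | Suc k \<Rightarrow> (ladder J k)\<^sup>2)"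

text \<open>The other form of the Casimir identity, obtained from \<open>ladder_sq\<close> one
  position earlier, where the weight is larger by the factor q. At r = 0 the squared weight is q^J
  and the right-hand side cancels.\<close>

lemma ladder_prev_sq:
  assumes "r \<le> J"
  shows "ladder_prev_sq J r * (s\<^sup>2 - inverse (s\<^sup>2))\<^sup>2 =
    casimir J - s\<^sup>2 * (weight J r)\<^sup>2 - inverse (s\<^sup>2) * (inverse (weight J r))\<^sup>2"
proof (cases r)
  case 0
  have "(weight J 0)\<^sup>2 = (s\<^sup>2) ^ J"
    by (simp add: weight_def power_int_def flip: power_mult) (simp add: mult.commute)
  thus ?thesis unfolding 0 power_inverse
    by (simp add: ladder_prev_sq_def casimir_def power_inverse)
next
  case (Suc k)
  have w: "weight J k = s\<^sup>2 * weight J r" using assms Suc by (simp add: weight_Suc)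
  have "inverse q * (q * v)\<^sup>2 = q * v\<^sup>2" "q * (inverse (q * v))\<^sup>2 = inverse q * (inverse v)\<^sup>2"
    if "q \<noteq> 0" "v \<noteq> 0" for q v :: complex
    using that by (simp_all add: power2_eq_square field_simps)
  thus ?thesis
    using ladder_sq[of k J] assms Suc s_nonzero weight_nonzero[of J r]
    by (simp add: ladder_prev_sq_def w)
qed

text \<open>The relation for [E, F]: subtracting the two forms of the Casimir identity removes
  \<open>casimir J\<close> and leaves one factor kappa. Beyond J both sides are 0, since the weight
  there is 1.\<close>

lemma ladder_sq_diff:
  "(ladder J r)\<^sup>2 - ladder_prev_sq J r =
    inverse (s\<^sup>2 - inverse (s\<^sup>2)) * ((weight J r)\<^sup>2 - (inverse (weight J r))\<^sup>2)"
proof (cases "r \<le> J")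
  case True
  let ?\<kappa> = "s\<^sup>2 - inverse (s\<^sup>2)"
  have "((ladder J r)\<^sup>2 - ladder_prev_sq J r) * ?\<kappa>\<^sup>2 = ?\<kappa> * ((weight J r)\<^sup>2 - (inverse (weight J r))\<^sup>2)"
    unfolding left_diff_distrib ladder_sq[OF True] ladder_prev_sq[OF True] by (simp add: algebra_simps)
  moreover have "a = inverse k * b" if "a * k\<^sup>2 = k * b" "k \<noteq> 0" for a b k :: complex
    using that by (simp add: power2_eq_square field_simps)
  ultimately show ?thesis using kappa_nonzero by blast
next
  case False
  thus ?thesis by (auto simp: ladder_def ladder_prev_sq_def weight_def split: nat.split)
qed

text \<open>
  These are the scalars in \<open>[E, [E, F]\<^sub>q]\<^bsub>1/q\<^esub>\<close>. As they do not depend on \<open>r\<close>, this element is a multiple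
  of \<open>E\<close> and commutes with \<open>E\<close>, which is the Serre relation.
\<close>

lemma ladder_serre:
  assumes "r < J"
  defines "q \<equiv> s\<^sup>2"
  shows "inverse q * (q * (ladder J (Suc r))\<^sup>2 - inverse q * (ladder J r)\<^sup>2)
      - q * (q * (ladder J r)\<^sup>2 - inverse q * ladder_prev_sq J r) = - casimir J"
    and "inverse q * (q * ladder_prev_sq J r - inverse q * (ladder J r)\<^sup>2)
      - q * (q * (ladder J r)\<^sup>2 - inverse q * (ladder J (Suc r))\<^sup>2) = - casimir J"
proof -
  define \<kappa> where "\<kappa> = q - inverse q"
  define w where "w = weight J (Suc r)"
  have q: "q \<noteq> 0" using s_nonzero by (simp add: q_def)
  have w0: "w \<noteq> 0" by (simp add: w_def weight_nonzero)
  have wr: "weight J r = q * w" using assms by (simp add: w_def q_def weight_Suc)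
  have \<kappa>: "\<kappa> \<noteq> 0" using kappa_nonzero by (simp add: \<kappa>_def q_def)
  define qi where "qi = inverse q"
  have qi: "q * qi = 1" using q by (simp add: qi_def)
  have iw: "inverse (q * w) = qi * inverse w" by (simp add: qi_def)
  \<comment> \<open>All three squares are written in terms of the weight \<open>w\<close> at
    \<open>Suc r\<close>. After multiplication by kappa^2 the claim becomes an identity in q in
    which \<open>w\<close> and its inverse may be treated as independent.\<close>
  have 1: "(ladder J (Suc r))\<^sup>2 * \<kappa>\<^sup>2 = casimir J - qi * w\<^sup>2 - q * (inverse w)\<^sup>2"
    using ladder_sq[of "Suc r" J] assms(1) by (simp add: w_def \<kappa>_def q_def qi_def)
  have 2: "(ladder J r)\<^sup>2 * \<kappa>\<^sup>2 = casimir J - qi * (q * w)\<^sup>2 - q * (qi * inverse w)\<^sup>2"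
    using ladder_sq[of r J] assms(1) unfolding wr iw by (simp add: \<kappa>_def q_def qi_def)
  have 3: "ladder_prev_sq J r * \<kappa>\<^sup>2 = casimir J - q * (q * w)\<^sup>2 - qi * (qi * inverse w)\<^sup>2"
    using ladder_prev_sq[of r J] assms(1) unfolding wr iw by (simp add: \<kappa>_def q_def qi_def)
  have \<kappa>': "\<kappa> = q - qi" by (simp add: \<kappa>_def qi_def)
  have cancel: "x = - casimir J" if "x * \<kappa>\<^sup>2 = - casimir J * \<kappa>\<^sup>2" for x
    using that \<kappa> mult_right_cancel[of "\<kappa>\<^sup>2"] by (metis power_not_zero)
  show "inverse q * (q * (ladder J (Suc r))\<^sup>2 - inverse q * (ladder J r)\<^sup>2)
      - q * (q * (ladder J r)\<^sup>2 - inverse q * ladder_prev_sq J r) = - casimir J"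
  proof (rule cancel)
    show "(inverse q * (q * (ladder J (Suc r))\<^sup>2 - inverse q * (ladder J r)\<^sup>2)
      - q * (q * (ladder J r)\<^sup>2 - inverse q * ladder_prev_sq J r)) * \<kappa>\<^sup>2 = - casimir J * \<kappa>\<^sup>2"
    proof -
      have *: "(qi * (q * a - qi * b) - q * (q * b - qi * p)) * \<kappa>\<^sup>2 =
          qi * (q * (a * \<kappa>\<^sup>2) - qi * (b * \<kappa>\<^sup>2)) - q * (q * (b * \<kappa>\<^sup>2) - qi * (p * \<kappa>\<^sup>2))" for a b p
        by (simp add: algebra_simps)
      have "p * (q * (c - p * w\<^sup>2 - q * v\<^sup>2) - p * (c - p * (q * w)\<^sup>2 - q * (p * v)\<^sup>2)) -
          q * (q * (c - p * (q * w)\<^sup>2 - q * (p * v)\<^sup>2) - p * (c - q * (q * w)\<^sup>2 - p * (p * v)\<^sup>2)) =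
          - c * (q - p)\<^sup>2" if "q * p = 1" for c p q v w :: complex
      proof -
        have "q \<noteq> 0" using that by auto
        moreover have "p = 1 / q" using that by (auto simp: eq_divide_eq mult.commute)
        ultimately show ?thesis by (simp only:) (simp add: field_simps power2_eq_square)
      qed
      thus ?thesis unfolding qi_def[symmetric] * 1 2 3 unfolding \<kappa>' using qi by blast
    qed
  qed
  \<comment> \<open>Both scalars equal x + y - (q^2 + q^{-2}) z, where z is the middle square and x,
    y are the two outer ones, so the second identity is a regrouping of the first.\<close>
  thus "inverse q * (q * ladder_prev_sq J r - inverse q * (ladder J r)\<^sup>2)
      - q * (q * (ladder J r)\<^sup>2 - inverse q * (ladder J (Suc r))\<^sup>2) = - casimir J"
    by (simp add: algebra_simps)
qed

end

section \<open>Weighted shifts and the relations of the quantum loop algebra\<close>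

lemma seq_op_mult [simp]:
  "seq_diag a * seq_diag b = seq_diag (\<lambda>r. a r * b r)"
  "seq_diag a * seq_up b = seq_up (\<lambda>r. a r * b r)"
  "seq_up a * seq_diag b = seq_up (\<lambda>r. a r * b (Suc r))"
  "seq_diag a * seq_down b = seq_down (\<lambda>r. a (Suc r) * b r)"
  "seq_down a * seq_diag b = seq_down (\<lambda>r. a r * b r)"
  "seq_up a * seq_down b = seq_diag (\<lambda>r. a r * b r)"
  "seq_down a * seq_up b = seq_diag (\<lambda>r. case r of 0 \<Rightarrow> 0 | Suc k \<Rightarrow> a k * b k)"
  by (rule seq_op_eqI; simp add: mult.assoc split: nat.split)+

lemma seq_op_linear [simp]:
  "seq_diag a - seq_diag b = seq_diag (\<lambda>r. a r - b r)"
  "seq_up a - seq_up b = seq_up (\<lambda>r. a r - b r)"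
  "seq_down a - seq_down b = seq_down (\<lambda>r. a r - b r)"
  "c *\<^sub>C seq_diag a = seq_diag (\<lambda>r. c *\<^sub>C a r)"
  "c *\<^sub>C seq_up a = seq_up (\<lambda>r. c *\<^sub>C a r)"
  "c *\<^sub>C seq_down a = seq_down (\<lambda>r. c *\<^sub>C a r)"
  by (rule seq_op_eqI; simp add: left_diff_distrib mult_scaleC_left scaleC_zero_right split: nat.split)+

lemma scaleC_diff_left: "(c - d) *\<^sub>C x = c *\<^sub>C x - d *\<^sub>C (x :: 'a::complex_algebra)"
  using scaleC_add_left[of "c - d" d x] by (simp add: eq_diff_eq)

lemma seq_op_zero_one [simp]:
  "seq_diag (\<lambda>r. 0) = 0" "seq_up (\<lambda>r. 0) = 0" "seq_down (\<lambda>r. 0) = 0" "seq_diag (\<lambda>r. 1) = 1"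
  by (rule seq_op_eqI; simp split: nat.split)+


lemmas scaleC_normalize = scaleC_scaleC mult_scaleC_left mult_scaleC_right scaleC_zero_left scaleC_zero_right

lemma qcomm_up_down:
  fixes q :: complex and l :: "nat \<Rightarrow> complex"
  defines "L \<equiv> \<lambda>r. (l r)\<^sup>2" and "P \<equiv> \<lambda>r. case r of 0 \<Rightarrow> 0 | Suc k \<Rightarrow> (l k)\<^sup>2"
  shows "qcomm q (seq_up (\<lambda>r. l r *\<^sub>C x)) (seq_down (\<lambda>r. l r *\<^sub>C y)) =
      seq_diag (\<lambda>r. (q * L r - inverse q * P r) *\<^sub>C (x * y))"
    and "qcomm q (seq_down (\<lambda>r. l r *\<^sub>C x)) (seq_up (\<lambda>r. l r *\<^sub>C y)) =
      seq_diag (\<lambda>r. (q * P r - inverse q * L r) *\<^sub>C (x * y))"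
  unfolding qcomm_def seq_op_mult seq_op_linear L_def P_def
  by (rule arg_cong[of _ _ seq_diag];
      simp add: fun_eq_iff scaleC_normalize scaleC_diff_left power2_eq_square mult.commute split: nat.split)+

lemma qcomm_shift_diag:
  fixes q :: complex and l d :: "nat \<Rightarrow> complex"
  shows "qcomm q (seq_up (\<lambda>r. l r *\<^sub>C x)) (seq_diag (\<lambda>r. d r *\<^sub>C y)) =
      seq_up (\<lambda>r. (l r * (q * d (Suc r) - inverse q * d r)) *\<^sub>C (x * y))"
    and "qcomm q (seq_down (\<lambda>r. l r *\<^sub>C x)) (seq_diag (\<lambda>r. d r *\<^sub>C y)) =
      seq_down (\<lambda>r. (l r * (q * d r - inverse q * d (Suc r))) *\<^sub>C (x * y))"
  unfolding qcomm_def seq_op_mult seq_op_linear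
  by (rule arg_cong[of _ _ seq_up] arg_cong[of _ _ seq_down];
      simp add: fun_eq_iff scaleC_normalize scaleC_diff_left[symmetric] mult.commute[of y x] algebra_simps)+

text \<open>Both orders multiply the same two consecutive weights, because \<open>c\<close> is
  independent of the position and the coefficients commute. Besides the Serre relations this settles
  the commutator of \<open>E_i\<close> and \<open>F_j\<close> for different nodes, which act by
  parallel shifts.\<close>

lemma comm_proportional_shift:
  "comm (seq_up (\<lambda>r. l r *\<^sub>C x)) (seq_up (\<lambda>r. (l r * c) *\<^sub>C y)) = 0"
  "comm (seq_down (\<lambda>r. l r *\<^sub>C x)) (seq_down (\<lambda>r. (l r * c) *\<^sub>C y)) = 0"
  by (rule seq_op_eqI; simp add: comm_def scaleC_normalize ac_simps split: nat.split)+

context root_param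
begin

text \<open>Under evaluation the two nodes act by one raising and one lowering shift, up to spectral
  factors \<open>x\<close> and \<open>y\<close>. The inner bracket is diagonal, the next one is a
  shift with weights \<open>ladder J r\<close> times the constant \<open>- casimir J\<close>; where
  \<open>ladder_serre\<close> does not apply, \<open>ladder J r\<close> is 0.\<close>

lemma serre_up:
  "comm (seq_up (\<lambda>r. ladder J r *\<^sub>C x)) (qcomm (inverse (s\<^sup>2)) (seq_up (\<lambda>r. ladder J r *\<^sub>C x))
    (qcomm (s\<^sup>2) (seq_up (\<lambda>r. ladder J r *\<^sub>C x)) (seq_down (\<lambda>r. ladder J r *\<^sub>C y)))) = 0"
proof -
  let ?q = "s\<^sup>2"
  let ?d = "\<lambda>r. ?q * (ladder J r)\<^sup>2 - inverse ?q * ladder_prev_sq J r"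
  have *: "ladder J r * (inverse ?q * ?d (Suc r) - inverse (inverse ?q) * ?d r) = ladder J r * (- casimir J)" for r
    using ladder_serre(1)[of r J] by (cases "r < J") (simp_all add: ladder_prev_sq_def, simp add: ladder_def)
  show ?thesis
    unfolding qcomm_up_down ladder_prev_sq_def[symmetric] qcomm_shift_diag * by (rule comm_proportional_shift)
qed

lemma serre_down:
  "comm (seq_down (\<lambda>r. ladder J r *\<^sub>C x)) (qcomm (inverse (s\<^sup>2)) (seq_down (\<lambda>r. ladder J r *\<^sub>C x))
    (qcomm (s\<^sup>2) (seq_down (\<lambda>r. ladder J r *\<^sub>C x)) (seq_up (\<lambda>r. ladder J r *\<^sub>C y)))) = 0"
proof -
  let ?q = "s\<^sup>2"
  let ?d = "\<lambda>r. ?q * ladder_prev_sq J r - inverse ?q * (ladder J r)\<^sup>2"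
  have *: "ladder J r * (inverse ?q * ?d r - inverse (inverse ?q) * ?d (Suc r)) = ladder J r * (- casimir J)" for r
    using ladder_serre(2)[of r J] by (cases "r < J") (simp_all add: ladder_prev_sq_def, simp add: ladder_def)
  show ?thesis
    unfolding qcomm_up_down ladder_prev_sq_def[symmetric] qcomm_shift_diag * by (rule comm_proportional_shift)
qed

lemma ladder_comm:
  assumes v: "v \<noteq> 0"
  shows "comm (seq_up (\<lambda>r. ladder J r *\<^sub>C inverse v)) (seq_down (\<lambda>r. ladder J r *\<^sub>C v)) =
      inverse (s\<^sup>2 - inverse (s\<^sup>2)) *\<^sub>C
      seq_diag (\<lambda>r. fls_const ((weight J r)\<^sup>2) - fls_const ((inverse (weight J r))\<^sup>2))"
    and "comm (seq_down (\<lambda>r. ladder J r *\<^sub>C inverse v)) (seq_up (\<lambda>r. ladder J r *\<^sub>C v)) =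
      inverse (s\<^sup>2 - inverse (s\<^sup>2)) *\<^sub>C
      seq_diag (\<lambda>r. fls_const ((inverse (weight J r))\<^sup>2) - fls_const ((weight J r)\<^sup>2))"
proof -
  have 1: "(ladder J r * ladder J r) *\<^sub>C (1 :: complex fls) - (case r of 0 \<Rightarrow> 0 | Suc k \<Rightarrow> (ladder J k * ladder J k) *\<^sub>C 1) =
     inverse (s\<^sup>2 - inverse (s\<^sup>2)) *\<^sub>C (fls_const ((weight J r)\<^sup>2) - fls_const ((inverse (weight J r))\<^sup>2))" for r
    using arg_cong[OF ladder_sq_diff[of J r], of fls_const]
    by (cases r) (simp_all add: fls_scaleC_conv ladder_prev_sq_def power2_eq_square[of "ladder _ _"] fls_minus_const)
  have 2: "(case r of 0 \<Rightarrow> 0 | Suc k \<Rightarrow> (ladder J k * ladder J k) *\<^sub>C (1 :: complex fls)) - (ladder J r * ladder J r) *\<^sub>C 1 =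
     inverse (s\<^sup>2 - inverse (s\<^sup>2)) *\<^sub>C (fls_const ((inverse (weight J r))\<^sup>2) - fls_const ((weight J r)\<^sup>2))" for r
    using arg_cong[OF 1[of r], of uminus] by (simp flip: scaleC_minus_right)
  have split: "(case r of 0 \<Rightarrow> 0 | Suc k \<Rightarrow> (ladder J k *\<^sub>C a) * (ladder J k *\<^sub>C b)) =
      (case r of 0 \<Rightarrow> 0 | Suc k \<Rightarrow> (ladder J k * ladder J k) *\<^sub>C (a * b))" for r and a b :: "complex fls"
    by (simp add: scaleC_normalize split: nat.split)
  have vv: "v * inverse v = 1" "inverse v * v = 1" using v by simp_all
  show "comm (seq_up (\<lambda>r. ladder J r *\<^sub>C inverse v)) (seq_down (\<lambda>r. ladder J r *\<^sub>C v)) =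
      inverse (s\<^sup>2 - inverse (s\<^sup>2)) *\<^sub>C
      seq_diag (\<lambda>r. fls_const ((weight J r)\<^sup>2) - fls_const ((inverse (weight J r))\<^sup>2))"
    unfolding comm_def seq_op_mult seq_op_linear split mult_scaleC_left mult_scaleC_right scaleC_scaleC vv 1 ..
  show "comm (seq_down (\<lambda>r. ladder J r *\<^sub>C inverse v)) (seq_up (\<lambda>r. ladder J r *\<^sub>C v)) =
      inverse (s\<^sup>2 - inverse (s\<^sup>2)) *\<^sub>C
      seq_diag (\<lambda>r. fls_const ((inverse (weight J r))\<^sup>2) - fls_const ((weight J r)\<^sup>2))"
    unfolding comm_def seq_op_mult seq_op_linear split mult_scaleC_left mult_scaleC_right scaleC_scaleC vv 2 ..
qed

lemma eval_op_E_F: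
  assumes v: "v \<noteq> 0"
  shows "comm (eval_op J v (gE i)) (eval_op J v (gF j)) = (if i = j then inverse (s\<^sup>2 - inverse (s\<^sup>2)) *\<^sub>C
    (eval_op J v (gK i) ^ 2 - eval_op J v (gK' i) ^ 2) else 0)"
proof -
  have [simp]: "seq_diag a ^ 2 = seq_diag (\<lambda>r. a r * a r)" for a by (simp add: power2_eq_square)
  have "comm (seq_up (\<lambda>r. ladder J r *\<^sub>C inverse v)) (seq_up (\<lambda>r. ladder J r *\<^sub>C v)) = 0"
    "comm (seq_down (\<lambda>r. ladder J r *\<^sub>C inverse v)) (seq_down (\<lambda>r. ladder J r *\<^sub>C v)) = 0"
    using comm_proportional_shift[of "ladder J" "inverse v" 1 v] by simp_all
  thus ?thesis
    using ladder_comm[OF v, of J]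
    by (cases i; cases j) (simp_all add: power2_eq_square[of "weight _ _"] power2_eq_square[of "inverse (weight _ _)"])
qed

lemma ladder_shift:
  "fls_const (weight J r) * (ladder J r *\<^sub>C x) = s\<^sup>2 *\<^sub>C ((ladder J r *\<^sub>C x) * fls_const (weight J (Suc r)))"
  "fls_const (weight J (Suc r)) * (ladder J r *\<^sub>C x) =
    inverse (s\<^sup>2) *\<^sub>C ((ladder J r *\<^sub>C x) * fls_const (weight J r))"
  "fls_const (inverse (weight J (Suc r))) * (ladder J r *\<^sub>C x) =
    s\<^sup>2 *\<^sub>C ((ladder J r *\<^sub>C x) * fls_const (inverse (weight J r)))"
  "fls_const (inverse (weight J r)) * (ladder J r *\<^sub>C x) =
    inverse (s\<^sup>2) *\<^sub>C ((ladder J r *\<^sub>C x) * fls_const (inverse (weight J (Suc r))))"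
proof -
  have *: "fls_const a * (ladder J r *\<^sub>C x) = c *\<^sub>C ((ladder J r *\<^sub>C x) * fls_const b)"
    if "a * ladder J r = c * b * ladder J r" for a b c
  proof -
    have "fls_const a * (ladder J r *\<^sub>C x) = fls_const (a * ladder J r) * x"
      by (simp add: fls_scaleC_conv mult.assoc flip: fls_const_mult_const)
    also have "\<dots> = c *\<^sub>C ((ladder J r *\<^sub>C x) * fls_const b)"
      unfolding that by (simp add: fls_scaleC_conv mult_ac flip: fls_const_mult_const)
    finally show ?thesis .
  qed
  \<comment> \<open>At r = J and beyond the weights no longer differ by the factor q, but there the
    ladder coefficient annihilates both sides.\<close>
  have w: "ladder J r = 0 \<or> weight J r = s\<^sup>2 * weight J (Suc r)"
    by (cases "r < J") (simp_all add: weight_Suc ladder_def)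
  have nz: "weight J (Suc r) \<noteq> 0" "s\<^sup>2 \<noteq> 0" using s_nonzero by (simp_all add: weight_nonzero)
  show "fls_const (weight J r) * (ladder J r *\<^sub>C x) = s\<^sup>2 *\<^sub>C ((ladder J r *\<^sub>C x) * fls_const (weight J (Suc r)))"
    "fls_const (weight J (Suc r)) * (ladder J r *\<^sub>C x) =
      inverse (s\<^sup>2) *\<^sub>C ((ladder J r *\<^sub>C x) * fls_const (weight J r))"
    "fls_const (inverse (weight J (Suc r))) * (ladder J r *\<^sub>C x) =
      s\<^sup>2 *\<^sub>C ((ladder J r *\<^sub>C x) * fls_const (inverse (weight J r)))"
    "fls_const (inverse (weight J r)) * (ladder J r *\<^sub>C x) =
      inverse (s\<^sup>2) *\<^sub>C ((ladder J r *\<^sub>C x) * fls_const (inverse (weight J (Suc r))))"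
    using w nz by (rule_tac *; auto simp: field_simps)+
qed

text \<open>With this check \<open>hom_ext g (eval_op J v)\<close> becomes an algebra homomorphism,
  which is the source of every multiplicativity statement about \<open>eval_rep\<close>.\<close>

lemma eval_op_relators:
  assumes v: "v \<noteq> 0"
  shows "loop_relators s (eval_op J v) \<subseteq> {0}"
proof
  fix r assume "r \<in> loop_relators s (eval_op J v)"
  thus "r \<in> {0}"
  proof cases
    case (K_inv i)
    thus ?thesis by (cases i) (simp_all add: weight_nonzero)
  next
    case (inv_K i)
    thus ?thesis by (cases i) (simp_all add: weight_nonzero)
  next
    case (K_E i j)
    show ?thesis unfolding K_E
      by (cases i; cases j; simp add: cartan_def ladder_shift power_int_minus)
  next
    case (K_F i j)
    show ?thesis unfolding K_F
      by (cases i; cases j; simp add: cartan_def ladder_shift power_int_minus)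
  next
    case (E_F i j)
    thus ?thesis using eval_op_E_F[OF v, of J i j] by simp
  next
    case level_zero
    thus ?thesis by (simp add: weight_nonzero)
  next
    case (Serre_E i j)
    thus ?thesis using serre_up serre_down by (cases i; cases j; simp)
  next
    case (Serre_F i j)
    thus ?thesis using serre_up serre_down by (cases i; cases j; simp)
  qed
qed

end

section \<open>Evaluation matrices as restrictions of operators on sequences\<close>

lemma index_mult_mat_sum:
  assumes "A \<in> carrier_mat n k" "B \<in> carrier_mat k m" "r < n" "c < m"
  shows "(A * B) $$ (r, c) = (\<Sum>i<k. A $$ (r, i) * B $$ (i, c))"
  using assms by (auto simp: scalar_prod_def lessThan_atLeast0 intro!: sum.cong)

context root_param
begin

lemma eval_rep_gen_carrier: "eval_rep_gen s J v y \<in> carrier_mat (J + 1) (J + 1)"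
  by (cases y; rename_tac i; case_tac i)
    (simp_all add: spin_E_def spin_F_def spin_K_def spin_K'_def)

text \<open>Sequences supported on 0, ..., J form an invariant subspace, on which the operators are
  the matrices of \<open>eval_rep_gen\<close>: nothing leaks to position J + 1 because
  \<open>ladder J J\<close> is 0.\<close>

lemma eval_op_eq_mat:
  assumes f: "\<And>k. k > J \<Longrightarrow> f k = 0"
  shows "seq_apply (eval_op J v y) f r =
    (if r \<le> J then \<Sum>k\<le>J. eval_rep_gen s J v y $$ (r, k) * f k else 0)"
proof -
  have up: "seq_apply (seq_up (\<lambda>r. ladder J r *\<^sub>C x)) f r =
      (if r \<le> J then \<Sum>k\<le>J. (x \<cdot>\<^sub>m map_mat fls_const (spin_E s J)) $$ (r, k) * f k else 0)" for x
  proof (cases "r \<le> J")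
    case True
    have "(\<Sum>k\<le>J. (x \<cdot>\<^sub>m map_mat fls_const (spin_E s J)) $$ (r, k) * f k) =
        (\<Sum>k\<le>J. if k = Suc r then (ladder J r *\<^sub>C x) * f k else 0)"
      using True by (intro sum.cong)
        (auto simp: spin_E_def ladder_def spin_B_def fls_scaleC_conv mult_ac add_ac)
    thus ?thesis using True f by (auto simp: ladder_def scaleC_zero_left)
  qed (simp add: ladder_def scaleC_zero_left)
  have down: "seq_apply (seq_down (\<lambda>r. ladder J r *\<^sub>C x)) f r =
      (if r \<le> J then \<Sum>k\<le>J. (x \<cdot>\<^sub>m map_mat fls_const (spin_F s J)) $$ (r, k) * f k else 0)" for x
  proof (cases r)
    case 0
    thus ?thesis by (auto simp: spin_F_def intro!: sum.neutral[symmetric])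
  next
    case (Suc m)
    show ?thesis
    proof (cases "r \<le> J")
      case True
      have "(\<Sum>k\<le>J. (x \<cdot>\<^sub>m map_mat fls_const (spin_F s J)) $$ (r, k) * f k) =
          (\<Sum>k\<le>J. if k = m then (ladder J m *\<^sub>C x) * f k else 0)"
        using True Suc by (intro sum.cong) (auto simp: spin_F_def ladder_def fls_scaleC_conv mult_ac)
      thus ?thesis using True Suc by simp
    qed (auto simp: Suc ladder_def scaleC_zero_left)
  qed
  have diag: "seq_apply (seq_diag (\<lambda>r. fls_const (d r))) f r =
      (if r \<le> J then \<Sum>k\<le>J. map_mat fls_const (mat (J + 1) (J + 1) (\<lambda>(r, c). if r = c then e c else 0)) $$ (r, k) * f k else 0)"
    if "\<And>k. k \<le> J \<Longrightarrow> d k = e k" for d e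
  proof (cases "r \<le> J")
    case True
    have "(\<Sum>k\<le>J. map_mat fls_const (mat (J + 1) (J + 1) (\<lambda>(r, c). if r = c then e c else 0)) $$ (r, k) * f k) =
        (\<Sum>k\<le>J. if k = r then fls_const (d k) * f k else 0)"
      using True by (intro sum.cong) (auto simp: that)
    thus ?thesis using True by simp
  qed (simp add: f)
  have K: "weight J k = s powi (int J - 2 * int k)" "inverse (weight J k) = s powi (- (int J - 2 * int k))"
    if "k \<le> J" for k
    using that power_int_minus[of s "int J - 2 * int k"] by (simp_all add: weight_def)
  note diags = diag[OF K(1)] diag[OF K(2)]
  show ?thesis
    by (cases y; rename_tac i; case_tac i)
      (simp_all only: eval_op.simps eval_rep_gen.simps up down diags spin_K_def spin_K'_def)
qed

definition unit_seq :: "nat \<Rightarrow> nat \<Rightarrow> complex fls"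
  where "unit_seq c = (\<lambda>i. if i = c then 1 else 0)"

lemma seq_apply_prod_eval_op:
  assumes "c \<le> J"
  shows "seq_apply (prod_list (map (eval_op J v) ys)) (unit_seq c) r =
    (if r \<le> J then foldr (\<lambda>y M. eval_rep_gen s J v y * M) ys (1\<^sub>m (J + 1)) $$ (r, c) else 0)"
proof -
  let ?M = "\<lambda>ys. foldr (\<lambda>y M. eval_rep_gen s J v y * M) ys (1\<^sub>m (J + 1))"
  have carrier: "?M ys \<in> carrier_mat (J + 1) (J + 1)" for ys
  proof (induction ys)
    case (Cons y ys)
    thus ?case using mult_carrier_mat[OF eval_rep_gen_carrier, of "?M ys"] by simp
  qed simp
  show ?thesis
  proof (induction ys arbitrary: r)
    case Nil
    show ?case using assms by (auto simp: unit_seq_def)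
  next
    case (Cons y ys)
    have "seq_apply (eval_op J v y) (seq_apply (prod_list (map (eval_op J v) ys)) (unit_seq c)) r =
        (if r \<le> J then \<Sum>k\<le>J. eval_rep_gen s J v y $$ (r, k) * ?M ys $$ (k, c) else 0)"
      by (subst eval_op_eq_mat) (auto simp: Cons.IH intro!: sum.cong)
    moreover have "(eval_rep_gen s J v y * ?M ys) $$ (r, c) = (\<Sum>k\<le>J. eval_rep_gen s J v y $$ (r, k) * ?M ys $$ (k, c))"
      if "r \<le> J"
      using index_mult_mat_sum[OF eval_rep_gen_carrier[of J v y] carrier[of ys], of r c] that assms
      by (simp add: lessThan_Suc_atMost)
    ultimately show ?case by simp
  qed
qed

end

lemma seq_apply_sum_op: "seq_apply (sum T A) f i = (\<Sum>k\<in>A. seq_apply (T k) f i)"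
  by (induction A rule: infinite_finite_induct) simp_all

locale loop_algebra = root_param +
  fixes g :: "gen \<Rightarrow> 'l::complex_algebra"
  assumes loop: "quantum_loop_algebra s g"
begin

lemma presented: "presented_by g (loop_relators s free_gen)"
  using loop by (simp add: quantum_loop_algebra_def)

abbreviation rep_entry :: "nat \<Rightarrow> complex fls \<Rightarrow> nat \<Rightarrow> nat \<Rightarrow> 'l \<Rightarrow> complex fls"
  where "rep_entry J v r c x \<equiv> eval_rep s g J v x $$ (r, c)"

text \<open>Both sides evaluate the same polynomial \<open>word_poly g x\<close> letter by letter.
  This is the bridge along which properties of a homomorphism into operators pass to
  \<open>eval_rep\<close>.\<close>

lemma rep_entry_seq_apply:
  assumes "c \<le> J"
  shows "seq_apply (hom_ext g (eval_op J v) x) (unit_seq c) r = (if r \<le> J then rep_entry J v r c x else 0)"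
  using assms
  by (simp add: hom_ext_def free_eval_def seq_apply_sum_op seq_apply_prod_eval_op
      eval_rep_def mat_ext_def fls_scaleC_conv)

lemma matrix_rep_eval:
  assumes v: "v \<noteq> 0"
  shows "matrix_rep {..J} (rep_entry J v)"
proof (rule matrix_repI)
  let ?h = "hom_ext g (eval_op J v)"
  have hom: "algebra_hom ?h"
    using presented loop_relators_vanish[OF eval_op_relators[OF v]] by (rule algebra_hom_hom_ext)
  note entry = rep_entry_seq_apply[of _ J v]
  fix i j assume ij: "i \<in> {..J}" "j \<in> {..J}"
  have *: "rep_entry J v i j x = seq_apply (?h x) (unit_seq j) i" for x using ij by (simp add: entry)
  show "clinear (rep_entry J v i j)"
    by (rule clinearI) (simp_all add: * algebra_homD[OF hom])
  show "rep_entry J v i j 1 = (if i = j then 1 else 0)"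
    by (simp add: * algebra_homD[OF hom] unit_seq_def)
  fix x y
  \<comment> \<open>Column j is supported on 0, ..., J, so it is a finite combination of unit
    sequences; applying the operator of \<open>x\<close> to it yields the matrix product.\<close>
  have "seq_apply (?h y) (unit_seq j) = (\<lambda>i. \<Sum>k\<le>J. rep_entry J v k j y * unit_seq k i)"
  proof
    fix i
    have "(\<Sum>k\<le>J. rep_entry J v k j y * unit_seq k i) = (\<Sum>k\<le>J. if k = i then rep_entry J v k j y else 0)"
      by (intro sum.cong) (auto simp: unit_seq_def)
    thus "seq_apply (?h y) (unit_seq j) i = (\<Sum>k\<le>J. rep_entry J v k j y * unit_seq k i)"
      using ij by (simp add: entry)
  qed
  hence "seq_apply (?h (x * y)) (unit_seq j) i =
      (\<Sum>k\<le>J. rep_entry J v k j y * seq_apply (?h x) (unit_seq k) i)"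
    by (simp add: algebra_homD[OF hom] seq_apply_sum)
  also have "\<dots> = (\<Sum>k\<in>{..J}. rep_entry J v i k x * rep_entry J v k j y)"
    using ij by (intro sum.cong) (auto simp: entry)
  finally show "rep_entry J v i j (x * y) = (\<Sum>k\<in>{..J}. rep_entry J v i k x * rep_entry J v k j y)"
    by (simp add: *)
qed simp

lemma rep_entry_gen:
  assumes "v \<noteq> 0" "r \<le> J" "c \<le> J"
  shows "rep_entry J v r c (g y) = eval_rep_gen s J v y $$ (r, c)"
proof -
  have "hom_ext g (eval_op J v) (g y) = eval_op J v y"
    using presented loop_relators_vanish[OF eval_op_relators[OF assms(1)]] by (rule hom_ext_gen)
  thus ?thesis
    using rep_entry_seq_apply[of c J v "g y" r] seq_apply_prod_eval_op[of c J v "[y]" r] assms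
      eval_rep_gen_carrier[of J v y] by simp
qed

end

section \<open>Fusion of spins\<close>

context root_param
begin

text \<open>The two recursions are exchanged by q -> 1/q, which fixes quantum integers. Thanks to
  this symmetry the cases t = s and t = 1/s of the fusion identities can be treated
  together.\<close>

lemma qint_Suc:
  "qint (s\<^sup>2) (int m + 1) = inverse (s\<^sup>2) * qint (s\<^sup>2) (int m) + (s\<^sup>2) ^ m"
  "qint (s\<^sup>2) (int m + 1) = s\<^sup>2 * qint (s\<^sup>2) (int m) + inverse (s\<^sup>2) ^ m"
proof -
  define q where "q = s\<^sup>2"
  have q: "q \<noteq> 0" "q - inverse q \<noteq> 0" using s_nonzero kappa_nonzero by (simp_all add: q_def)
  have Q: "qint q (int n) = (q ^ n - inverse q ^ n) / (q - inverse q)" for n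
    by (simp add: qint_def power_int_minus power_inverse)
  have 1: "int m + 1 = int (Suc m)" by simp
  have "x = (a + b * d) / d \<Longrightarrow> x = a / d + b" if "d \<noteq> 0" for x a b d :: complex
    using that by (simp add: add_divide_distrib)
  note div = this[OF q(2)]
  show "qint (s\<^sup>2) (int m + 1) = inverse (s\<^sup>2) * qint (s\<^sup>2) (int m) + (s\<^sup>2) ^ m"
    "qint (s\<^sup>2) (int m + 1) = s\<^sup>2 * qint (s\<^sup>2) (int m) + inverse (s\<^sup>2) ^ m"
    unfolding 1 q_def[symmetric] Q times_divide_eq_right
    by (rule div, rule arg_cong[of _ _ "\<lambda>x. x / _"], use q(1) in \<open>simp add: algebra_simps\<close>)+
qed

lemma qint_one: "qint (s\<^sup>2) 1 = 1"
  using qint_Suc(1)[of 0] by (simp add: qint_def)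

lemma ladder_sq_qint: "r \<le> J \<Longrightarrow> (ladder J r)\<^sup>2 = qint (s\<^sup>2) (int J - int r) * qint (s\<^sup>2) (int r + 1)"
  by (cases "r < J") (auto simp: ladder_def spin_B_def qint_def)

lemma ladder_nonzero: "r < J \<Longrightarrow> ladder J r \<noteq> 0"
  by (simp add: ladder_def spin_B_nonzero)

lemma fusion_E_diag_ladder: "n \<le> J \<Longrightarrow> fusion_E_diag s J n = (\<Prod>p<n. ladder J p / ladder (J + 1) p)"
  unfolding fusion_E_diag_def by (intro prod.cong) (auto simp: ladder_def)

text \<open>The recursion persists at n = J: the product then contains \<open>spin_B\<close> at r =
  J, which is 0, and so does the right-hand side.\<close>

lemma fusion_E_diag_Suc:
  "n \<le> J \<Longrightarrow> fusion_E_diag s J (Suc n) = fusion_E_diag s J n * (ladder J n / ladder (J + 1) n)"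
  by (cases "n = J") (auto simp: fusion_E_diag_def ladder_def spin_B_def qint_def)

lemma fusion_E_diag_nonzero: "n \<le> J \<Longrightarrow> fusion_E_diag s J n \<noteq> 0"
  by (simp add: fusion_E_diag_ladder ladder_nonzero)

lemma fusion_E_low_Suc:
  "n \<le> J \<Longrightarrow> fusion_E_low s J (Suc n) = qint (s\<^sup>2) (int n + 1) * fusion_E_diag s J n / ladder (J + 1) n"
  by (simp add: fusion_E_low_def ladder_def add.commute)

text \<open>The nonzero matrix coefficients of the intertwining relation: the first two for the
  raising operator in the upper and lower half of the rows, the others for the lowering operator.
  For the E and F generators, t = s serves node 1 and t = 1/s serves node 0, where K is
  inverted.\<close>

lemma fusion_identities:
  assumes t: "t = s \<or> t = inverse s"
  shows "i \<le> J \<Longrightarrow> inverse (t\<^sup>2) * ladder J i * fusion_E_diag s J (Suc i) +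
      (t\<^sup>2) ^ (J - i) * fusion_E_low s J (Suc i) = fusion_E_diag s J i * ladder (J + 1) i" (is "_ \<Longrightarrow> ?A")
    and "Suc i \<le> J \<Longrightarrow> ladder J i * fusion_E_low s J (Suc (Suc i)) =
      fusion_E_low s J (Suc i) * ladder (J + 1) (Suc i)" (is "_ \<Longrightarrow> ?B")
    and "i \<le> J \<Longrightarrow> ladder J i * fusion_E_diag s J i = fusion_E_diag s J (Suc i) * ladder (J + 1) i" (is "_ \<Longrightarrow> ?C")
    and "Suc i \<le> J \<Longrightarrow> inverse (t\<^sup>2) ^ Suc i * fusion_E_diag s J (Suc i) + t\<^sup>2 * ladder J i * fusion_E_low s J (Suc i) =
      fusion_E_low s J (Suc (Suc i)) * ladder (J + 1) (Suc i)" (is "_ \<Longrightarrow> ?D")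
    and "fusion_E_diag s J 0 = fusion_E_low s J (Suc 0) * ladder (J + 1) 0" (is ?E)
proof -
  have Q: "qint (s\<^sup>2) (int m + 1) = inverse (t\<^sup>2) * qint (s\<^sup>2) (int m) + (t\<^sup>2) ^ m"
    "qint (s\<^sup>2) (int m + 1) = t\<^sup>2 * qint (s\<^sup>2) (int m) + inverse (t\<^sup>2) ^ m" for m
    using t qint_Suc[of m] by (auto simp: power_inverse)
  show ?A if "i \<le> J"
  proof -
    let ?l = "ladder (J + 1) i" and ?d = "fusion_E_diag s J i"
    have l: "?l \<noteq> 0" using that by (intro ladder_nonzero) simp
    \<comment> \<open>After division by [i+1] and the diagonal entry this reads [J-i+1] = t^{-2}
      [J-i] + t^{2(J-i)}.\<close>
    have "(inverse (t\<^sup>2) * (ladder J i)\<^sup>2 + (t\<^sup>2) ^ (J - i) * qint (s\<^sup>2) (int i + 1)) * ?d = ?l\<^sup>2 * ?d"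
      using that Q(1)[of "J - i"] by (simp add: ladder_sq_qint algebra_simps of_nat_diff)
    thus ?thesis using that l
      by (simp add: fusion_E_diag_Suc fusion_E_low_Suc power2_eq_square field_simps)
  qed
  show ?B if "Suc i \<le> J"
  proof -
    let ?l = "ladder (J + 1) i" and ?l' = "ladder (J + 1) (Suc i)" and ?d = "fusion_E_diag s J i"
    have l: "?l \<noteq> 0" "?l' \<noteq> 0" using that by (auto intro!: ladder_nonzero)
    \<comment> \<open>Both sides equal [J-i] [i+1] [i+2].\<close>
    have "(ladder J i)\<^sup>2 * qint (s\<^sup>2) (int (Suc i) + 1) = qint (s\<^sup>2) (int i + 1) * ?l'\<^sup>2"
      using that by (simp add: ladder_sq_qint algebra_simps)
    thus ?thesis using that l
      by (simp add: fusion_E_diag_Suc fusion_E_low_Suc power2_eq_square field_simps)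
  qed
  show ?C if "i \<le> J"
    using that ladder_nonzero[of i "J + 1"] by (simp add: fusion_E_diag_Suc)
  show ?D if "Suc i \<le> J"
  proof -
    let ?l = "ladder (J + 1) i" and ?l' = "ladder (J + 1) (Suc i)"
    have l: "?l \<noteq> 0" "?l' \<noteq> 0" using that by (auto intro!: ladder_nonzero)
    have 1: "ladder J i * fusion_E_low s J (Suc i) = qint (s\<^sup>2) (int (Suc i)) * fusion_E_diag s J (Suc i)"
      using that l by (simp add: fusion_E_diag_Suc fusion_E_low_Suc add.commute)
    have 2: "fusion_E_low s J (Suc (Suc i)) * ladder (J + 1) (Suc i) = qint (s\<^sup>2) (int (Suc i) + 1) * fusion_E_diag s J (Suc i)"
      using that l by (simp add: fusion_E_low_Suc)
    show ?thesis unfolding 2 Q(2)[of "Suc i"] mult.assoc 1 by (simp only: algebra_simps)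
  qed
  show ?E
    using ladder_nonzero[of 0 "J + 1"] by (simp add: fusion_E_low_Suc qint_one)
qed

text \<open>\<open>fusion_E\<close> with its row index split into the positions in the two tensor factors.\<close>

definition fusion_entry :: "nat \<Rightarrow> nat \<times> nat \<Rightarrow> nat \<Rightarrow> complex"
  where "fusion_entry J i c = (if fst i = 0 then (if snd i = c then fusion_E_diag s J c else 0)
    else (if c = Suc (snd i) then fusion_E_low s J c else 0))"

text \<open>In the lower half the row J + 1 + i2 has the form J + c exactly for c = i2 + 1, hence
  the shift in \<open>fusion_entry\<close>. For J = 0 the identity matrix of the definition agrees
  with the general formula because [1] = 1.\<close>

lemma fusion_E_entry:
  assumes "i1 \<le> 1" "i2 \<le> J" "c \<le> J + 1"
  shows "fusion_E s J $$ (i1 * (J + 1) + i2, c) = fusion_entry J (i1, i2) c"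
proof (cases "J = 0")
  case True
  have "spin_B (s\<^sup>2) 1 0 = 1" by (simp add: spin_B_def qint_one)
  hence "fusion_E_low s 0 1 = 1"
    by (simp add: fusion_E_low_def fusion_E_diag_def qint_one)
  moreover have "i1 = 0 \<or> i1 = 1" "c = 0 \<or> c = 1" "i2 = 0" using assms True by auto
  ultimately show ?thesis using True
    by (auto simp: fusion_E_def fusion_entry_def fusion_E_diag_def)
next
  case False
  have "i1 = 0 \<or> i1 = 1" using assms by auto
  thus ?thesis using assms False
    by (auto simp: fusion_E_def fusion_entry_def)
qed

lemma sum_fusion_entry_left:
  assumes "fst i \<le> 1" "snd i \<le> J"
  shows "(\<Sum>k\<le>J + 1. fusion_entry J i k * h k) =
    (if fst i = 0 then fusion_E_diag s J (snd i) * h (snd i)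
     else fusion_E_low s J (Suc (snd i)) * h (Suc (snd i)))"
proof -
  have "(\<Sum>k\<le>J + 1. fusion_entry J i k * h k) =
    (\<Sum>k\<le>J + 1. if k = (if fst i = 0 then snd i else Suc (snd i)) then
      (if fst i = 0 then fusion_E_diag s J (snd i) else fusion_E_low s J (Suc (snd i))) * h k else 0)"
    using assms by (intro sum.cong) (auto simp: fusion_entry_def)
  thus ?thesis using assms by auto
qed

lemma sum_fusion_entry_right:
  fixes h :: "nat \<times> nat \<Rightarrow> complex"
  assumes "c \<le> J + 1"
  shows "(\<Sum>k\<in>{..1} \<times> {..J}. h k * fusion_entry J k c) =
    (if c \<le> J then h (0, c) * fusion_E_diag s J c else 0) +
    (case c of 0 \<Rightarrow> 0 | Suc m \<Rightarrow> h (1, m) * fusion_E_low s J c)"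
proof -
  have "(\<Sum>k\<in>{..1} \<times> {..J}. h k * fusion_entry J k c) =
      (\<Sum>m\<le>J. h (0, m) * fusion_entry J (0, m) c) + (\<Sum>m\<le>J. h (1, m) * fusion_entry J (1, m) c)"
    unfolding sum.cartesian_product' by (simp add: atMost_Suc)
  moreover have "(\<Sum>m\<le>J. h (0, m) * fusion_entry J (0, m) c) = (\<Sum>m\<le>J. if m = c then h (0, c) * fusion_E_diag s J c else 0)"
    by (intro sum.cong) (auto simp: fusion_entry_def)
  moreover have "(\<Sum>m\<le>J. h (1, m) * fusion_entry J (1, m) c) =
      (case c of 0 \<Rightarrow> 0 | Suc n \<Rightarrow> \<Sum>m\<le>J. if m = n then h (1, n) * fusion_E_low s J c else 0)"
  proof (cases c)
    case 0
    thus ?thesis by (simp add: fusion_entry_def)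
  next
    case (Suc n)
    show ?thesis unfolding Suc nat.case by (intro sum.cong) (auto simp: fusion_entry_def)
  qed
  ultimately show ?thesis using assms by (auto split: nat.split)
qed

definition raise_entry :: "nat \<Rightarrow> nat \<Rightarrow> nat \<Rightarrow> complex"
  where "raise_entry J r c = (if c = Suc r then ladder J r else 0)"

definition lower_entry :: "nat \<Rightarrow> nat \<Rightarrow> nat \<Rightarrow> complex"
  where "lower_entry J r c = (if r = Suc c then ladder J c else 0)"

definition weight_entry :: "complex \<Rightarrow> nat \<Rightarrow> nat \<Rightarrow> nat \<Rightarrow> complex"
  where "weight_entry t J r c = (if r = c then t powi (int J - 2 * int r) else 0)"

lemma ladder_1: "ladder (Suc 0) 0 = 1"
  by (simp add: ladder_def spin_B_def qint_one)

context
  fixes t :: complex and J :: nat and i :: "nat \<times> nat" and c :: nat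
  assumes t: "t = s \<or> t = inverse s" and i: "fst i \<le> 1" "snd i \<le> J" and c: "c \<le> J + 1"
begin

lemma t_nonzero: "t \<noteq> 0"
  using t s_nonzero by auto

lemma t_powers:
  assumes "m \<le> J"
  shows "t ^ J * t powi (int J - 2 * int m) = (t\<^sup>2) ^ (J - m)"
    and "inverse t ^ J * t powi (int J - 2 * int m) = inverse (t\<^sup>2) ^ m"
proof -
  have "t ^ J * t powi (int J - 2 * int m) = t powi (2 * int (J - m))"
    using assms t_nonzero by (simp add: of_nat_diff algebra_simps flip: power_int_of_nat power_int_add)
  thus "t ^ J * t powi (int J - 2 * int m) = (t\<^sup>2) ^ (J - m)"
    unfolding power_int_mult by (simp add: power_int_numeral)
  have "inverse t ^ J * t powi (int J - 2 * int m) = inverse (t powi (2 * int m))"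
    using t_nonzero by (simp add: field_simps power_int_diff)
  thus "inverse t ^ J * t powi (int J - 2 * int m) = inverse (t\<^sup>2) ^ m"
    unfolding power_int_mult by (simp add: power_int_numeral power_inverse)
qed

lemmas fusion_entry_defs = raise_entry_def lower_entry_def weight_entry_def

text \<open>The two summands are those of the coproduct of \<open>E_1\<close> for t = s and of
  \<open>F_0\<close> for t = 1/s. The scalars \<open>t ^ J\<close> and \<open>inverse t\<close> are
  what the shifts of the two spectral parameters contribute.\<close>

lemma fusion_raise:
  "(\<Sum>k\<in>{..1} \<times> {..J}. (t ^ J * raise_entry 1 (fst i) (fst k) * weight_entry t J (snd i) (snd k) +
      inverse t * weight_entry (inverse t) 1 (fst i) (fst k) * raise_entry J (snd i) (snd k)) * fusion_entry J k c) =
    (\<Sum>k\<le>J + 1. fusion_entry J i k * raise_entry (J + 1) k c)"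
proof (cases "fst i = 0")
  case True
  show ?thesis
  proof (cases "c = Suc (snd i)")
    case True
    \<comment> \<open>For snd i = J the column c is J + 1, which has no entry in the upper half; the
      corresponding term of the identity is 0 as well.\<close>
    have "ladder J (snd i) = 0" if "\<not> Suc (snd i) \<le> J" using that by (simp add: ladder_def)
    thus ?thesis
      unfolding sum_fusion_entry_right[OF c] sum_fusion_entry_left[OF i]
      using True \<open>fst i = 0\<close> fusion_identities(1)[OF t i(2)] t_powers(1)[OF i(2)] c t_nonzero
      by (auto simp: fusion_entry_defs ladder_1 power2_eq_square)
  next
    case False
    thus ?thesis
      unfolding sum_fusion_entry_right[OF c] sum_fusion_entry_left[OF i]
      using \<open>fst i = 0\<close> by (auto simp: fusion_entry_defs split: nat.split)
  qed
next
  case False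
  hence [simp]: "fst i = Suc 0" using i by simp
  show ?thesis
  proof (cases "c = Suc (Suc (snd i))")
    case True
    thus ?thesis
      unfolding sum_fusion_entry_right[OF c] sum_fusion_entry_left[OF i]
      using fusion_identities(2)[OF t, of "snd i" J] c t_nonzero
      by (auto simp: fusion_entry_defs)
  next
    case False
    thus ?thesis
      unfolding sum_fusion_entry_right[OF c] sum_fusion_entry_left[OF i]
      by (auto simp: fusion_entry_defs split: nat.split)
  qed
qed

text \<open>The counterpart for \<open>F_1\<close> with t = s and \<open>E_0\<close> with t = 1/s;
  the scalars are inverted because these generators carry the inverse spectral factor.\<close>

lemma fusion_lower:
  "(\<Sum>k\<in>{..1} \<times> {..J}. (inverse t ^ J * lower_entry 1 (fst i) (fst k) * weight_entry t J (snd i) (snd k) +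
      t * weight_entry (inverse t) 1 (fst i) (fst k) * lower_entry J (snd i) (snd k)) * fusion_entry J k c) =
    (\<Sum>k\<le>J + 1. fusion_entry J i k * lower_entry (J + 1) k c)"
proof (cases "fst i = 0")
  case True
  show ?thesis
  proof (cases "snd i = Suc c")
    case True
    thus ?thesis
      unfolding sum_fusion_entry_right[OF c] sum_fusion_entry_left[OF i]
      using \<open>fst i = 0\<close> fusion_identities(3)[OF t, of c J] i t_nonzero
      by (auto simp: fusion_entry_defs split: nat.split)
  next
    case False
    thus ?thesis
      unfolding sum_fusion_entry_right[OF c] sum_fusion_entry_left[OF i]
      using \<open>fst i = 0\<close> by (auto simp: fusion_entry_defs split: nat.split)
  qed
next
  case False
  hence [simp]: "fst i = Suc 0" using i by simp
  show ?thesis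
  proof (cases "snd i = c")
    case True
    thus ?thesis
      unfolding sum_fusion_entry_right[OF c] sum_fusion_entry_left[OF i]
      using fusion_identities(4)[OF t, of "c - 1" J] fusion_identities(5)[OF t, of J]
        t_powers(2)[OF i(2)] i t_nonzero
      by (cases c) (auto simp: fusion_entry_defs ladder_1 power2_eq_square)
  next
    case False
    thus ?thesis
      unfolding sum_fusion_entry_right[OF c] sum_fusion_entry_left[OF i]
      by (auto simp: fusion_entry_defs split: nat.split)
  qed
qed

lemma fusion_weight:
  "(\<Sum>k\<in>{..1} \<times> {..J}. (weight_entry t 1 (fst i) (fst k) * weight_entry t J (snd i) (snd k)) * fusion_entry J k c) =
    (\<Sum>k\<le>J + 1. fusion_entry J i k * weight_entry t (J + 1) k c)"
proof -
  have 1: "t * t powi (int J - 2 * int m) = t powi (1 + int J - 2 * int m)" for m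
    using t_nonzero power_int_add[of t 1 "int J - 2 * int m"] by (simp add: add_diff_eq)
  have "t powi (1 + int J - 2 * (int m + 1)) = t powi (- 1 + (int J - 2 * int m))" for m
    by (rule arg_cong[of _ _ "\<lambda>n. t powi n"]) simp
  hence 2: "inverse t * t powi (int J - 2 * int m) = t powi (1 + int J - 2 * (int m + 1))" for m
    using t_nonzero power_int_add[of t "-1" "int J - 2 * int m"] by (simp add: power_int_minus)
  have "fst i = 0 \<or> fst i = Suc 0" using i by auto
  thus ?thesis
    unfolding sum_fusion_entry_right[OF c] sum_fusion_entry_left[OF i]
    using i c 1[of c] 2[of "c - 1"]
    by (auto simp: fusion_entry_defs power_int_minus split: nat.split)
qed

end

end

section \<open>The twist in evaluation representations and the intertwining property of the fusion
  matrices\<close>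

lemma algebra_hom_prod_list: "algebra_hom f \<Longrightarrow> f (prod_list xs) = prod_list (map f xs)"
  by (induction xs) (simp_all add: algebra_homD)

lemma algebra_hom_free_eval_image:
  assumes "algebra_hom f"
  shows "f (free_eval h p) = free_eval (\<lambda>y. f (h y)) p"
  by (simp add: free_eval_def clinear_sum[OF algebra_hom_clinear[OF assms]] algebra_homD[OF assms]
      algebra_hom_prod_list[OF assms] comp_def)

lemma cbilinear_mult: "cbilinear ((*) :: 'a::complex_algebra \<Rightarrow> 'a \<Rightarrow> 'a)"
  by (rule cbilinearI) (simp_all add: distrib_left distrib_right mult_scaleC_left mult_scaleC_right)

lemma fls_scaleC_one: "c *\<^sub>C 1 = (fls_const c :: complex fls)"
  by (simp add: fls_scaleC_conv)

context loop_algebra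
begin

text \<open>It suffices to look at generators: the twist exchanges, for instance, \<open>E_0\<close>
  with \<open>F_1\<close>, which act by the same lowering matrix, one with the factor 1/v and the
  other with v.\<close>

lemma twist_eval:
  assumes v: "v \<noteq> 0" and "r \<le> J" "c \<le> J"
  shows "rep_entry J v r c (twist g x) = rep_entry J (inverse v) r c x"
proof -
  let ?h = "hom_ext g (eval_op J v)"
  note vanish = loop_relators_vanish[OF eval_op_relators[OF v]]
  have hom: "algebra_hom ?h" by (rule algebra_hom_hom_ext[OF presented vanish])
  have "eval_op J v (twist_gen y) = eval_op J (inverse v) y" for y
    by (cases y; rename_tac i; case_tac i) simp_all
  hence "?h (twist g x) = hom_ext g (eval_op J (inverse v)) x"
    using hom_ext_gen[OF presented vanish]
    by (simp add: twist_def hom_ext_def[of g "\<lambda>y. g (twist_gen y)"] algebra_hom_free_eval_image[OF hom])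
      (simp add: hom_ext_def)
  thus ?thesis
    using rep_entry_seq_apply[of c J v "twist g x" r] rep_entry_seq_apply[of c J "inverse v" x r] assms by simp
qed

definition pair_entry ::
  "nat \<Rightarrow> complex fls \<Rightarrow> nat \<Rightarrow> complex fls \<Rightarrow> nat \<times> nat \<Rightarrow> nat \<times> nat \<Rightarrow> ('l, 'l) tensor \<Rightarrow> complex fls"
  where "pair_entry J1 v J2 w i j =
    tensor_lift (\<lambda>x y. rep_entry J1 v (fst i) (fst j) x * rep_entry J2 w (snd i) (snd j) y)"

lemma matrix_rep_pair:
  assumes "v \<noteq> 0" "w \<noteq> 0"
  shows "matrix_rep ({..J1} \<times> {..J2}) (pair_entry J1 v J2 w)"
  unfolding pair_entry_def
  by (intro matrix_rep_tensor_lift matrix_rep_eval assms cbilinear_mult) simp_all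

lemma cbilinear_rep_entry:
  assumes "v \<noteq> 0" "w \<noteq> 0" "i \<in> {..J1} \<times> {..J2}" "j \<in> {..J1} \<times> {..J2}"
  shows "cbilinear (\<lambda>x y. rep_entry J1 v (fst i) (fst j) x * rep_entry J2 w (snd i) (snd j) y)"
proof -
  have "clinear (rep_entry J1 v (fst i) (fst j))" "clinear (rep_entry J2 w (snd i) (snd j))"
    using assms by (auto intro!: matrix_repD(2)[OF matrix_rep_eval])
  thus ?thesis
    by (intro cbilinearI) (simp_all add: clinear_def distrib_left distrib_right mult_scaleC_left mult_scaleC_right)
qed

lemma pair_entry_pure:
  assumes "v \<noteq> 0" "w \<noteq> 0" "i \<in> {..J1} \<times> {..J2}" "j \<in> {..J1} \<times> {..J2}"
  shows "pair_entry J1 v J2 w i j (x \<otimes>\<^sub>t y) = rep_entry J1 v (fst i) (fst j) x * rep_entry J2 w (snd i) (snd j) y"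
  unfolding pair_entry_def using cbilinear_rep_entry[OF assms] by (rule tensor_lift_pure)

lemma rep_entry_generators:
  assumes "v \<noteq> 0" "r \<le> J" "c \<le> J"
  shows "rep_entry J v r c (g (gE N1)) = raise_entry J r c *\<^sub>C inverse v"
    "rep_entry J v r c (g (gE N0)) = lower_entry J r c *\<^sub>C inverse v"
    "rep_entry J v r c (g (gF N1)) = lower_entry J r c *\<^sub>C v"
    "rep_entry J v r c (g (gF N0)) = raise_entry J r c *\<^sub>C v"
    "rep_entry J v r c (g (gK N1)) = weight_entry s J r c *\<^sub>C 1"
    "rep_entry J v r c (g (gK N0)) = weight_entry (inverse s) J r c *\<^sub>C 1"
    "rep_entry J v r c (g (gK' N1)) = weight_entry (inverse s) J r c *\<^sub>C 1"
    "rep_entry J v r c (g (gK' N0)) = weight_entry s J r c *\<^sub>C 1"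
proof -
  have K': "s powi (- (int J - 2 * int c)) = inverse s powi (int J - 2 * int c)"
    by (simp only: power_int_minus power_int_inverse)
  have E: "map_mat fls_const (spin_E s J) $$ (r, c) = fls_const (raise_entry J r c)"
    using assms by (auto simp: spin_E_def raise_entry_def ladder_def spin_B_def mult.commute add.commute)
  have F: "map_mat fls_const (spin_F s J) $$ (r, c) = fls_const (lower_entry J r c)"
    using assms by (auto simp: spin_F_def lower_entry_def ladder_def)
  have K: "map_mat fls_const (spin_K s J) $$ (r, c) = fls_const (weight_entry s J r c)"
    using assms by (auto simp: spin_K_def weight_entry_def)
  have K2: "map_mat fls_const (spin_K' s J) $$ (r, c) = fls_const (weight_entry (inverse s) J r c)"
    using assms K' by (auto simp: spin_K'_def weight_entry_def simp del: minus_diff_eq)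
  have dim: "dim_row (spin_E s J) = J + 1" "dim_col (spin_E s J) = J + 1"
    "dim_row (spin_F s J) = J + 1" "dim_col (spin_F s J) = J + 1"
    by (simp_all add: spin_E_def spin_F_def)
  show "rep_entry J v r c (g (gE N1)) = raise_entry J r c *\<^sub>C inverse v"
    "rep_entry J v r c (g (gE N0)) = lower_entry J r c *\<^sub>C inverse v"
    "rep_entry J v r c (g (gF N1)) = lower_entry J r c *\<^sub>C v"
    "rep_entry J v r c (g (gF N0)) = raise_entry J r c *\<^sub>C v"
    "rep_entry J v r c (g (gK N1)) = weight_entry s J r c *\<^sub>C 1"
    "rep_entry J v r c (g (gK N0)) = weight_entry (inverse s) J r c *\<^sub>C 1"
    "rep_entry J v r c (g (gK' N1)) = weight_entry (inverse s) J r c *\<^sub>C 1"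
    "rep_entry J v r c (g (gK' N0)) = weight_entry s J r c *\<^sub>C 1"
    unfolding rep_entry_gen[OF assms] using assms dim
    by (simp_all add: E F K K2 fls_scaleC_conv mult.commute del: index_map_mat(1))
qed

text \<open>For v = 1/u the parameters \<open>a\<close> and \<open>b\<close> are the inverses of u
  q^j and u q^{-1/2}. They put the factors t^J and t^{-1} in front of the two coproduct terms of E
  and F, as the fusion identities require.\<close>

lemma fusion_intertwine_gen:
  assumes v: "v \<noteq> 0" and i: "i \<in> {..1} \<times> {..J}" and c: "c \<le> J + 1"
  defines "a \<equiv> fls_const (inverse s ^ J) * v" and "b \<equiv> fls_const s * v"
  shows "(\<Sum>k\<in>{..1} \<times> {..J}. pair_entry 1 a J b i k (coproduct_gen g y) * fls_const (fusion_entry J k c)) =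
    (\<Sum>k\<le>J + 1. fls_const (fusion_entry J i k) * rep_entry (J + 1) v k c (g y))"
proof -
  have ab: "a \<noteq> 0" "b \<noteq> 0" using v s_nonzero by (simp_all add: a_def b_def)
  have a: "a = inverse s ^ J *\<^sub>C v" "inverse a = s ^ J *\<^sub>C inverse v"
    and b: "b = s *\<^sub>C v" "inverse b = inverse s *\<^sub>C inverse v"
    using v s_nonzero
    by (simp_all add: a_def b_def fls_scaleC_conv fls_inverse_const power_inverse)
  note lin = matrix_repD(2)[OF matrix_rep_pair[OF ab]]
  \<comment> \<open>All coefficients of one generator share a spectral factor \<open>z\<close>,
    which is 1/v, v or 1. Splitting it off leaves an identity between complex numbers.\<close>
  have lift: ?thesis
    if A: "\<And>k. k \<in> {..1} \<times> {..J} \<Longrightarrow> pair_entry 1 a J b i k (coproduct_gen g y) = A k *\<^sub>C z"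
      and U: "\<And>k. k \<le> J + 1 \<Longrightarrow> rep_entry (J + 1) v k c (g y) = U k *\<^sub>C z"
      and AU: "(\<Sum>k\<in>{..1} \<times> {..J}. A k * fusion_entry J k c) = (\<Sum>k\<le>J + 1. fusion_entry J i k * U k)"
    for A U z
  proof -
    have "(\<Sum>k\<in>{..1} \<times> {..J}. pair_entry 1 a J b i k (coproduct_gen g y) * fls_const (fusion_entry J k c)) =
        (\<Sum>k\<in>{..1} \<times> {..J}. A k * fusion_entry J k c) *\<^sub>C z"
      unfolding scaleC_sum_left by (intro sum.cong HOL.refl, subst A)
        (simp_all add: fls_scaleC_conv mult_ac flip: fls_const_mult_const)
    also have "\<dots> = (\<Sum>k\<le>J + 1. fls_const (fusion_entry J i k) * rep_entry (J + 1) v k c (g y))"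
      unfolding AU scaleC_sum_left by (intro sum.cong HOL.refl, subst U)
        (simp_all add: fls_scaleC_conv mult_ac flip: fls_const_mult_const)
    finally show ?thesis .
  qed
  have i': "fst i \<le> 1" "snd i \<le> J" using i by auto
  note ids = fusion_raise[OF _ i' c] fusion_lower[OF _ i' c] fusion_weight[OF _ i' c]
  note ids1 = ids[of s, OF disjI1[OF HOL.refl]] and ids2 = ids[of "inverse s", OF disjI2[OF HOL.refl]]
  note simps = pair_entry_pure[OF ab i] rep_entry_generators[OF ab(1)] rep_entry_generators[OF ab(2)]
    clinear_add[OF lin[OF i]]
  show ?thesis
  proof (cases y)
    case (gE n)
    show ?thesis
    proof (cases n)
      case N0
      show ?thesis unfolding gE N0
        by (rule lift[OF _ _ ids2(2), where z = "inverse v", unfolded gE N0], erule_tac [2] rep_entry_generators[OF v _ c])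
          (use i' c v in \<open>auto simp: simps rep_entry_generators simp del: One_nat_def; simp add: a(2) b(2) scaleC_normalize scaleC_add_left mult_ac\<close>)
    next
      case N1
      show ?thesis unfolding gE N1
        by (rule lift[OF _ _ ids1(1), where z = "inverse v", unfolded gE N1], erule_tac [2] rep_entry_generators[OF v _ c])
          (use i' c v in \<open>auto simp: simps rep_entry_generators simp del: One_nat_def; simp add: a(2) b(2) scaleC_normalize scaleC_add_left mult_ac\<close>)
    qed
  next
    case (gF n)
    show ?thesis
    proof (cases n)
      case N0
      show ?thesis unfolding gF N0
        by (rule lift[OF _ _ ids2(1), where z = v, unfolded gF N0], erule_tac [2] rep_entry_generators[OF v _ c])
          (use i' c v in \<open>auto simp: simps rep_entry_generators simp del: One_nat_def; simp add: a(1) b(1) scaleC_normalize scaleC_add_left mult_ac\<close>)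
    next
      case N1
      show ?thesis unfolding gF N1
        by (rule lift[OF _ _ ids1(2), where z = v, unfolded gF N1], erule_tac [2] rep_entry_generators[OF v _ c])
          (use i' c v in \<open>auto simp: simps rep_entry_generators simp del: One_nat_def; simp add: a(1) b(1) scaleC_normalize scaleC_add_left mult_ac\<close>)
    qed
  next
    case (gK n)
    show ?thesis
    proof (cases n)
      case N0
      show ?thesis unfolding gK N0
        by (rule lift[OF _ _ ids2(3), where z = 1, unfolded gK N0], erule_tac [2] rep_entry_generators[OF v _ c])
          (use i' c v in \<open>auto simp: simps rep_entry_generators simp del: One_nat_def; simp add: scaleC_normalize scaleC_add_left mult_ac\<close>)
    next
      case N1
      show ?thesis unfolding gK N1
        by (rule lift[OF _ _ ids1(3), where z = 1, unfolded gK N1], erule_tac [2] rep_entry_generators[OF v _ c])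
          (use i' c v in \<open>auto simp: simps rep_entry_generators simp del: One_nat_def; simp add: scaleC_normalize scaleC_add_left mult_ac\<close>)
    qed
  next
    case (gK' n)
    show ?thesis
    proof (cases n)
      case N0
      show ?thesis unfolding gK' N0
        by (rule lift[OF _ _ ids1(3), where z = 1, unfolded gK' N0], erule_tac [2] rep_entry_generators[OF v _ c])
          (use i' c v in \<open>auto simp: simps rep_entry_generators simp del: One_nat_def; simp add: scaleC_normalize scaleC_add_left mult_ac\<close>)
    next
      case N1
      show ?thesis unfolding gK' N1
        by (rule lift[OF _ _ ids2(3), where z = 1, unfolded gK' N1], erule_tac [2] rep_entry_generators[OF v _ c])
          (use i' c v in \<open>auto simp: simps rep_entry_generators simp del: One_nat_def; simp add: scaleC_normalize scaleC_add_left mult_ac\<close>)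
    qed
  qed
qed

text \<open>Both sides are computed on the same polynomial \<open>word_poly g x\<close>, for the
  coproduct by definition and for the representation since its value is \<open>x\<close>. Along a
  word the fusion matrix passes one letter at a time.\<close>

lemma fusion_intertwine:
  assumes v: "v \<noteq> 0" and i: "i \<in> {..1} \<times> {..J}" and c: "c \<le> J + 1"
  defines "a \<equiv> fls_const (inverse s ^ J) * v" and "b \<equiv> fls_const s * v"
  shows "(\<Sum>k\<in>{..1} \<times> {..J}. pair_entry 1 a J b i k (coproduct g x) * fls_const (fusion_entry J k c)) =
    (\<Sum>k\<le>J + 1. fls_const (fusion_entry J i k) * rep_entry (J + 1) v k c x)"
proof -
  let ?I = "{..1} \<times> {..J}" and ?e = "\<lambda>i c. fls_const (fusion_entry J i c)"
  let ?P = "pair_entry 1 a J b" and ?R = "rep_entry (J + 1) v"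
  have ab: "a \<noteq> 0" "b \<noteq> 0" using v s_nonzero by (simp_all add: a_def b_def)
  note mp = matrix_repD[OF matrix_rep_pair[OF ab, of 1 J]] and mr = matrix_repD[OF matrix_rep_eval[OF v, of "J + 1"]]
  \<comment> \<open>Stated for every row, since a letter changes the row while the column
    \<open>c\<close> stays fixed.\<close>
  have words: "(\<Sum>k\<in>?I. ?P i k (prod_list (map (coproduct_gen g) ys)) * ?e k c) =
    (\<Sum>k\<le>J + 1. ?e i k * ?R k c (prod_list (map g ys)))" if "i \<in> ?I" for i ys
    using that
  proof (induction ys arbitrary: i)
    case Nil
    have "(\<Sum>k\<in>?I. ?P i k 1 * ?e k c) = (\<Sum>k\<in>?I. if k = i then ?e k c else 0)"
      using Nil by (intro sum.cong) (auto simp: mp(3) simp del: One_nat_def)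
    moreover have "(\<Sum>k\<le>J + 1. ?e i k * ?R k c 1) = (\<Sum>k\<le>J + 1. if k = c then ?e i k else 0)"
      using c by (intro sum.cong) (auto simp: mr(3)[simplified])
    ultimately show ?case using Nil c by simp
  next
    case (Cons y ys)
    let ?D = "prod_list (map (coproduct_gen g) ys)" and ?G = "prod_list (map g ys)"
    have "(\<Sum>k\<in>?I. ?P i k (coproduct_gen g y * ?D) * ?e k c) =
        (\<Sum>k\<in>?I. \<Sum>l\<in>?I. ?P i l (coproduct_gen g y) * (?P l k ?D * ?e k c))"
      using Cons.prems by (intro sum.cong HOL.refl) (simp only: mp(4) sum_distrib_right mult.assoc)
    also have "\<dots> = (\<Sum>l\<in>?I. ?P i l (coproduct_gen g y) * (\<Sum>k\<in>?I. ?P l k ?D * ?e k c))"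
      by (subst sum.swap) (simp add: sum_distrib_left)
    also have "\<dots> = (\<Sum>l\<in>?I. \<Sum>k\<le>J + 1. (?P i l (coproduct_gen g y) * ?e l k) * ?R k c ?G)"
      by (intro sum.cong HOL.refl) (simp only: Cons.IH sum_distrib_left mult.assoc)
    also have "\<dots> = (\<Sum>k\<le>J + 1. (\<Sum>l\<in>?I. ?P i l (coproduct_gen g y) * ?e l k) * ?R k c ?G)"
      by (subst sum.swap) (simp only: sum_distrib_right)
    also have "\<dots> = (\<Sum>k\<le>J + 1. \<Sum>l\<le>J + 1. ?e i l * (?R l k (g y) * ?R k c ?G))"
      using Cons.prems unfolding a_def b_def
      by (intro sum.cong HOL.refl) (simp only: fusion_intertwine_gen[OF v] atMost_iff sum_distrib_right mult.assoc)
    also have "\<dots> = (\<Sum>l\<le>J + 1. ?e i l * ?R l c (g y * ?G))"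
      using c by (subst sum.swap) (intro sum.cong HOL.refl, simp only: mr(4) atMost_iff sum_distrib_left)
    finally show ?case by simp
  qed
  let ?p = "word_poly g x"
  let ?w = "\<lambda>w. Poly_Mapping.lookup ?p w"
  have R: "?R k c x = (\<Sum>w\<in>Poly_Mapping.keys ?p. ?w w *\<^sub>C ?R k c (prod_list (map g (letters w))))" if "k \<le> J + 1" for k
  proof -
    have lin: "clinear (?R k c)" using that c by (intro mr(2)) auto
    have "?R k c x = ?R k c (free_eval g ?p)" by (simp only: free_eval_word_poly[OF presented])
    thus ?thesis by (simp only: free_eval_def clinear_sum[OF lin] clinear_scaleC[OF lin])
  qed
  have P: "?P i k (coproduct g x) =
      (\<Sum>w\<in>Poly_Mapping.keys ?p. ?w w *\<^sub>C ?P i k (prod_list (map (coproduct_gen g) (letters w))))" if "k \<in> ?I" for k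
  proof -
    have lin: "clinear (?P i k)" using that i by (intro mp(2)) auto
    show ?thesis
      by (simp only: coproduct_def hom_ext_def free_eval_def clinear_sum[OF lin] clinear_scaleC[OF lin])
  qed
  have "(\<Sum>k\<in>?I. ?P i k (coproduct g x) * ?e k c) =
      (\<Sum>w\<in>Poly_Mapping.keys ?p. ?w w *\<^sub>C (\<Sum>k\<in>?I. ?P i k (prod_list (map (coproduct_gen g) (letters w))) * ?e k c))"
    unfolding scaleC_sum_right
    by (subst sum.swap) (intro sum.cong HOL.refl, simp only: P sum_distrib_right mult_scaleC_left)
  also have "\<dots> = (\<Sum>w\<in>Poly_Mapping.keys ?p. ?w w *\<^sub>C (\<Sum>k\<le>J + 1. ?e i k * ?R k c (prod_list (map g (letters w)))))"
    by (simp only: words[OF i])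
  also have "\<dots> = (\<Sum>k\<le>J + 1. ?e i k * ?R k c x)"
    unfolding scaleC_sum_right
    by (subst sum.swap) (intro sum.cong HOL.refl, simp only: R atMost_iff sum_distrib_left mult_scaleC_right)
  finally show ?thesis .
qed

end

text \<open>A middle row r of F meets only the rows r and r + J of E, and its diagonal entry is
  defined by solving F_{r,r} E_{r,r} + F_{r,r+J} E_{r+J,r} = 1, which is possible because E_{r,r} is
  nonzero. The first and last row have a single entry each.\<close>

lemma (in root_param) fusion_F_E: "fusion_F s J * fusion_E s J = 1\<^sub>m (J + 2)"
proof (cases "J = 0")
  case True
  thus ?thesis by (simp add: fusion_F_def fusion_E_def numeral_2_eq_2)
next
  case False
  let ?F = "fusion_F s J" and ?E = "fusion_E s J"
  have carrier: "?F \<in> carrier_mat (J + 2) (2 * J + 2)" "?E \<in> carrier_mat (2 * J + 2) (J + 2)"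
    using False by (simp_all add: fusion_F_def fusion_E_def Let_def)
  have low: "fusion_E_low s J (Suc J) \<noteq> 0"
    by (simp add: fusion_E_low_Suc qint_nonzero fusion_E_diag_nonzero ladder_nonzero)
  have diag0: "fusion_E_diag s J 0 = 1" by (simp add: fusion_E_diag_def)
  show ?thesis
  proof (rule eq_matI)
    fix r c assume "r < dim_row (1\<^sub>m (J + 2) :: complex mat)" "c < dim_col (1\<^sub>m (J + 2) :: complex mat)"
    hence rc: "r < J + 2" "c < J + 2" by simp_all
    have sum: "(?F * ?E) $$ (r, c) = (\<Sum>i\<in>A. ?F $$ (r, i) * ?E $$ (i, c))"
      if "A \<subseteq> {..<2 * J + 2}" "\<And>i. i < 2 * J + 2 \<Longrightarrow> i \<notin> A \<Longrightarrow> ?F $$ (r, i) = 0" for A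
      unfolding index_mult_mat_sum[OF carrier rc] using that
      by (intro sum.mono_neutral_right) auto
    consider "r = 0" | "r = J + 1" | "1 \<le> r" "r \<le> J" using rc by linarith
    hence "(?F * ?E) $$ (r, c) = (if r = c then 1 else 0)"
    proof cases
      case 1
      show ?thesis
        by (subst sum[of "{0}"]) (use False rc 1 diag0 in \<open>auto simp: fusion_F_def fusion_E_def Let_def\<close>)
    next
      case 2
      show ?thesis
        by (subst sum[of "{2 * J + 1}"]) (use False rc 2 low in \<open>auto simp: fusion_F_def fusion_E_def Let_def\<close>)
    next
      case 3
      show ?thesis
        by (subst sum[of "{r, r + J}"])
          (use False rc 3 fusion_E_diag_nonzero[of r J] in \<open>auto simp: fusion_F_def fusion_E_def Let_def\<close>)
    qed
    thus "(?F * ?E) $$ (r, c) = 1\<^sub>m (J + 2) $$ (r, c)" using rc by simp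
  qed (use carrier in auto)
qed

section \<open>Homogeneity of the universal R-matrix\<close>

lemma clinear_tensor_lift_image:
  assumes "clinear f"
  shows "f (tensor_lift h t) = tensor_lift (\<lambda>x y. f (h x y)) t"
proof -
  have "f (\<Sum>(a, b)\<leftarrow>xs. h a b) = (\<Sum>(a, b)\<leftarrow>xs. f (h a b))" for xs
    by (induction xs) (auto simp: clinear_zero[OF assms] clinear_add[OF assms])
  thus ?thesis by (simp add: tensor_lift_def)
qed

text \<open>\<open>P n\<close> is a degree condition compatible with products. It is used for
  elements of degree 2n and -2n and for tensors of opposite degrees, so that gradedness of
  exponentials, logarithms and ordered products is proved once.\<close>

locale grading =
  fixes P :: "nat \<Rightarrow> 'a::complex_algebra \<Rightarrow> bool"
  assumes zero: "P n 0" and add: "P n x \<Longrightarrow> P n y \<Longrightarrow> P n (x + y)"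
    and scale: "P n x \<Longrightarrow> P n (c *\<^sub>C x)"
    and one: "P 0 1" and mult: "P m x \<Longrightarrow> P n y \<Longrightarrow> P (m + n) (x * y)"
begin

definition graded :: "'a fps \<Rightarrow> bool"
  where "graded f \<longleftrightarrow> (\<forall>n. P n (fps_nth f n))"

lemma sum: "(\<And>i. i \<in> A \<Longrightarrow> P n (x i)) \<Longrightarrow> P n (sum x A)"
  by (induction A rule: infinite_finite_induct) (auto intro: zero add)

lemma graded_mult:
  assumes "graded f" "graded h"
  shows "graded (f * h)"
  unfolding graded_def fps_mult_nth
proof (intro allI sum)
  fix n i :: nat assume "i \<in> {0..n}"
  thus "P n (fps_nth f i * fps_nth h (n - i))"
    using mult[of i "fps_nth f i" "n - i" "fps_nth h (n - i)"] assms by (simp add: graded_def)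
qed

lemma graded_one: "graded 1"
  by (simp add: graded_def one zero)

lemma graded_power: "graded f \<Longrightarrow> graded (f ^ n)"
  by (induction n) (simp_all add: graded_one graded_mult)

lemma graded_prod_list: "(\<And>x. x \<in> set xs \<Longrightarrow> graded (f x)) \<Longrightarrow> graded (prod_list (map f xs))"
  by (induction xs) (auto intro: graded_one graded_mult)

lemma graded_series_at:
  assumes "graded f"
  shows "graded (series_at c f)"
  using graded_power[OF assms]
  by (auto simp: graded_def series_at_def fps_compose_nth mult_scaleC_left intro!: sum scale)

lemma graded_monomial: "P m a \<Longrightarrow> graded (fps_const a * fps_X ^ m)"
  by (simp add: graded_def fps_X_power_mult_right_nth zero)

end

lemma fls_const_range_closed:
  assumes "a \<in> range fls_const" "b \<in> range fls_const"
  shows "a + b \<in> range fls_const" "a * b \<in> range fls_const" "c *\<^sub>C a \<in> range (fls_const :: complex \<Rightarrow> _)"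
  using assms by (auto simp: fls_plus_const fls_scaleC_conv)

lemma fls_const_range_sum:
  "(\<And>i. i \<in> A \<Longrightarrow> f i \<in> range fls_const) \<Longrightarrow> sum f A \<in> range (fls_const :: complex \<Rightarrow> _)"
proof (induction A rule: infinite_finite_induct)
  case (insert x A)
  thus ?case by (simp add: fls_const_range_closed)
qed (auto intro: image_eqI[of _ _ 0])

context loop_algebra
begin

lemma matrix_rep_gen_eq:
  assumes f: "matrix_rep I f" and f': "matrix_rep I f'" and ij: "i \<in> I" "j \<in> I"
    and gen: "\<And>y i j. i \<in> I \<Longrightarrow> j \<in> I \<Longrightarrow> f i j (g y) = f' i j (g y)"
  shows "f i j x = f' i j x"
proof -
  note f = matrix_repD[OF f] and f' = matrix_repD[OF f']
  have words: "f i j (prod_list (map g ys)) = f' i j (prod_list (map g ys))" if "i \<in> I" "j \<in> I" for i j ys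
    using that by (induction ys arbitrary: i) (auto simp: f(3,4) f'(3,4) gen intro!: sum.cong)
  have "f i j (free_eval g p) = f' i j (free_eval g p)" for p
    using words[OF ij]
    by (simp add: free_eval_def clinear_sum[OF f(2)[OF ij]] clinear_sum[OF f'(2)[OF ij]]
      clinear_scaleC[OF f(2)[OF ij]] clinear_scaleC[OF f'(2)[OF ij]])
  thus ?thesis using free_eval_word_poly[OF presented, of x] by metis
qed

text \<open>At v = 1 the generators act by constant matrices. So once the value at v is a power of v
  times the value at 1, all dependence on the spectral parameter has been isolated.\<close>

lemma rep_entry_1_const:
  assumes ij: "i \<le> J" "j \<le> J"
  shows "rep_entry J 1 i j x \<in> range fls_const"
proof -
  note f = matrix_repD[OF matrix_rep_eval[OF one_neq_zero, of J]]
  have gen: "rep_entry J 1 i j (g y) \<in> range fls_const" if "i \<le> J" "j \<le> J" for i j y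
    using that by (cases y; rename_tac n; case_tac n)
      (auto simp: rep_entry_generators fls_scaleC_one)
  have words: "rep_entry J 1 i j (prod_list (map g ys)) \<in> range fls_const" if "i \<le> J" for i ys
    using that
  proof (induction ys arbitrary: i)
    case Nil
    thus ?case using ij by (auto simp: f(3) intro: image_eqI[of _ _ 0] image_eqI[of _ _ 1])
  next
    case (Cons y ys)
    thus ?case using ij by (auto simp: f(4) intro!: fls_const_range_sum fls_const_range_closed gen)
  qed
  have lin: "clinear (rep_entry J 1 i j)" using ij by (intro f(2)) auto
  have "rep_entry J 1 i j (free_eval g p) \<in> range fls_const" for p
    using words[OF ij(1)] unfolding free_eval_def clinear_sum[OF lin] clinear_scaleC[OF lin]
    by (intro fls_const_range_sum fls_const_range_closed) auto
  thus ?thesis using free_eval_word_poly[OF presented, of x] by metis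
qed

text \<open>Degree is read off from all evaluation representations instead of a grading of the
  algebra. The inverse of \<open>v\<close> appears because \<open>E_0\<close> and
  \<open>E_1\<close>, which shall have degree 1, carry the factor 1/v.\<close>

definition homogeneous :: "int \<Rightarrow> 'l \<Rightarrow> bool"
  where "homogeneous d x \<longleftrightarrow> (\<forall>J v. v \<noteq> 0 \<longrightarrow> (\<forall>i\<le>J. \<forall>j\<le>J.
    rep_entry J v i j x = inverse v powi d * rep_entry J 1 i j x))"

lemma rep_entry_linear:
  assumes "v \<noteq> 0" "i \<le> J" "j \<le> J"
  shows "rep_entry J v i j (x + y) = rep_entry J v i j x + rep_entry J v i j y"
    "rep_entry J v i j (x - y) = rep_entry J v i j x - rep_entry J v i j y"
    "rep_entry J v i j (c *\<^sub>C x) = c *\<^sub>C rep_entry J v i j x"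
    "rep_entry J v i j 0 = 0" "rep_entry J v i j 1 = (if i = j then 1 else 0)"
proof -
  have lin: "clinear (rep_entry J v i j)" using assms by (intro matrix_repD(2)[OF matrix_rep_eval]) auto
  show "rep_entry J v i j (x + y) = rep_entry J v i j x + rep_entry J v i j y"
    "rep_entry J v i j (x - y) = rep_entry J v i j x - rep_entry J v i j y"
    "rep_entry J v i j (c *\<^sub>C x) = c *\<^sub>C rep_entry J v i j x"
    "rep_entry J v i j 0 = 0"
    using lin by (rule clinear_add clinear_diff clinear_scaleC clinear_zero)+
  show "rep_entry J v i j 1 = (if i = j then 1 else 0)"
    using assms by (intro matrix_repD(3)[OF matrix_rep_eval]) auto
qed

lemma homogeneousD:
  "homogeneous d x \<Longrightarrow> v \<noteq> 0 \<Longrightarrow> i \<le> J \<Longrightarrow> j \<le> J \<Longrightarrow>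
    rep_entry J v i j x = inverse v powi d * rep_entry J 1 i j x"
  unfolding homogeneous_def by blast

lemma homogeneousI:
  "(\<And>J v i j. v \<noteq> 0 \<Longrightarrow> i \<le> J \<Longrightarrow> j \<le> J \<Longrightarrow>
    rep_entry J v i j x = inverse v powi d * rep_entry J 1 i j x) \<Longrightarrow> homogeneous d x"
  unfolding homogeneous_def by blast

lemma homogeneous_add_diff:
  assumes x: "homogeneous d x" and y: "homogeneous d y"
  shows "homogeneous d (x + y)" "homogeneous d (x - y)"
proof -
  have "rep_entry J v i j (x + y) = inverse v powi d * rep_entry J 1 i j (x + y) \<and>
      rep_entry J v i j (x - y) = inverse v powi d * rep_entry J 1 i j (x - y)"
    if "v \<noteq> 0" "i \<le> J" "j \<le> J" for J v i j
    unfolding rep_entry_linear(1,2)[OF that] rep_entry_linear(1,2)[OF one_neq_zero that(2,3)]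
      homogeneousD[OF x that] homogeneousD[OF y that]
    by (simp only: distrib_left right_diff_distrib simp_thms)
  thus "homogeneous d (x + y)" "homogeneous d (x - y)"
    by (intro homogeneousI; blast)+
qed

lemmas homogeneous_add = homogeneous_add_diff(1) and homogeneous_diff = homogeneous_add_diff(2)

lemma homogeneous_scale:
  assumes x: "homogeneous d x"
  shows "homogeneous d (c *\<^sub>C x)"
proof (rule homogeneousI)
  fix J i j :: nat and v :: "complex fls" assume that: "v \<noteq> 0" "i \<le> J" "j \<le> J"
  show "rep_entry J v i j (c *\<^sub>C x) = inverse v powi d * rep_entry J 1 i j (c *\<^sub>C x)"
    unfolding rep_entry_linear(3)[OF that] rep_entry_linear(3)[OF one_neq_zero that(2,3)] homogeneousD[OF x that]
    by (simp only: mult_scaleC_right)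
qed

lemma homogeneous_zero: "homogeneous d 0" and homogeneous_one: "homogeneous 0 1"
  by (rule homogeneousI; simp only: rep_entry_linear one_neq_zero not_False_eq_True mult_zero_right power_int_0_right mult_1)+

lemma homogeneous_mult:
  assumes "homogeneous d x" "homogeneous e y"
  shows "homogeneous (d + e) (x * y)"
  unfolding homogeneous_def
proof (intro allI impI)
  fix J i j :: nat and v :: "complex fls" assume v: "v \<noteq> 0" and ij: "i \<le> J" "j \<le> J"
  have "rep_entry J v i j (x * y) = (\<Sum>k\<in>{..J}. rep_entry J v i k x * rep_entry J v k j y)"
    using v ij by (simp add: matrix_repD(4)[OF matrix_rep_eval])
  also have "\<dots> = (\<Sum>k\<in>{..J}. (inverse v powi d * rep_entry J 1 i k x) * (inverse v powi e * rep_entry J 1 k j y))"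
    using ij by (intro sum.cong HOL.refl) (simp only: atMost_iff homogeneousD[OF assms(1) v] homogeneousD[OF assms(2) v])
  also have "\<dots> = inverse v powi (d + e) * (\<Sum>k\<in>{..J}. rep_entry J 1 i k x * rep_entry J 1 k j y)"
    using v by (simp add: power_int_add sum_distrib_left mult_ac)
  also have "\<dots> = inverse v powi (d + e) * rep_entry J 1 i j (x * y)"
    using ij by (simp add: matrix_repD(4)[OF matrix_rep_eval])
  finally show "rep_entry J v i j (x * y) = inverse v powi (d + e) * rep_entry J 1 i j (x * y)" .
qed

lemma homogeneous_gen:
  "homogeneous 1 (g (gE n))" "homogeneous (- 1) (g (gF n))" "homogeneous 0 (g (gK n))" "homogeneous 0 (g (gK' n))"
  by (rule homogeneousI; cases n; simp add: rep_entry_generators fls_scaleC_conv power_int_minus mult.commute)+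

lemma homogeneous_comm: "homogeneous d x \<Longrightarrow> homogeneous e y \<Longrightarrow> homogeneous (d + e) (comm x y)"
  using homogeneous_mult[of d x e y] homogeneous_mult[of e y d x]
  by (simp add: comm_def homogeneous_diff add.commute)

lemma homogeneous_qcomm: "homogeneous d x \<Longrightarrow> homogeneous e y \<Longrightarrow> homogeneous (d + e) (qcomm c x y)"
  using homogeneous_mult[of d x e y] homogeneous_mult[of e y d x]
  by (simp add: qcomm_def homogeneous_diff homogeneous_scale add.commute)

lemma homogeneous_e0: "homogeneous 1 (g (gE n) * g (gK' n))" "homogeneous (- 1) (g (gK n) * g (gF n))"
  using homogeneous_mult[OF homogeneous_gen(1) homogeneous_gen(4)]
    homogeneous_mult[OF homogeneous_gen(3) homogeneous_gen(2)] by simp_all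

lemma homogeneous_delta'_1: "homogeneous 2 (e_delta'_1 s g)" "homogeneous (- 2) (f_delta'_1 s g)"
  using homogeneous_qcomm[OF homogeneous_e0(1) homogeneous_e0(1)] homogeneous_qcomm[OF homogeneous_e0(2) homogeneous_e0(2)]
  by (simp_all add: e_delta'_1_def f_delta'_1_def homogeneous_scale)

text \<open>Each delta counts 2, as the sum of the two simple roots, while alpha and delta - alpha
  count 1.\<close>

lemma homogeneous_alpha:
  "homogeneous (2 * int k + 1) (e_alpha s g k)" "homogeneous (- (2 * int k + 1)) (f_alpha s g k)"
  "homogeneous (2 * int k + 1) (e_delta_alpha s g k)" "homogeneous (- (2 * int k + 1)) (f_delta_alpha s g k)"
proof (induction k)
  case (Suc k)
  { case 1 show ?case using homogeneous_comm[OF Suc(1) homogeneous_delta'_1(1)]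
      by (simp add: homogeneous_scale algebra_simps) }
  { case 2 show ?case using homogeneous_comm[OF homogeneous_delta'_1(2) Suc(2)]
      by (simp add: homogeneous_scale algebra_simps) }
  { case 3 show ?case using homogeneous_comm[OF homogeneous_delta'_1(1) Suc(3)]
      by (simp add: homogeneous_scale algebra_simps) }
  { case 4 show ?case using homogeneous_comm[OF Suc(4) homogeneous_delta'_1(2)]
      by (simp add: homogeneous_scale algebra_simps) }
qed (simp_all add: homogeneous_e0)

lemma homogeneous_delta':
  assumes "k > 0"
  shows "homogeneous (2 * int k) (e_delta' s g k)" "homogeneous (- (2 * int k)) (f_delta' s g k)"
  using homogeneous_qcomm[OF homogeneous_alpha(1)[of "k - 1"] homogeneous_alpha(3)[of 0]]
    homogeneous_qcomm[OF homogeneous_alpha(4)[of 0] homogeneous_alpha(2)[of "k - 1"]] assms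
  by (simp_all add: e_delta'_def f_delta'_def homogeneous_scale of_nat_diff algebra_simps)

lemma grading_homogeneous: "grading (\<lambda>n. homogeneous (d * int n))"
  by unfold_locales (auto intro: homogeneous_add homogeneous_scale homogeneous_zero homogeneous_one
    simp: distrib_left dest: homogeneous_mult)

lemma homogeneous_delta:
  "homogeneous (2 * int k) (e_delta s g k)" "homogeneous (- (2 * int k)) (f_delta s g k)"
proof -
  interpret e: grading "\<lambda>n. homogeneous (2 * int n)" by (rule grading_homogeneous)
  interpret f: grading "\<lambda>n. homogeneous (- (2 * int n))" using grading_homogeneous[of "- 2"] by simp
  have "e.graded (Abs_fps (\<lambda>n. if n = 0 then 0 else (s\<^sup>2 - inverse (s\<^sup>2)) *\<^sub>C e_delta' s g n))"
    by (simp add: e.graded_def homogeneous_delta' homogeneous_scale homogeneous_zero)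
  hence "e.graded (fps_log1p (Abs_fps (\<lambda>n. if n = 0 then 0 else (s\<^sup>2 - inverse (s\<^sup>2)) *\<^sub>C e_delta' s g n)))"
    unfolding fps_log1p_def by (rule e.graded_series_at)
  thus "homogeneous (2 * int k) (e_delta s g k)"
    by (simp add: e_delta_def e.graded_def homogeneous_scale)
  have "f.graded (Abs_fps (\<lambda>n. if n = 0 then 0 else (- (s\<^sup>2 - inverse (s\<^sup>2))) *\<^sub>C f_delta' s g n))"
    using homogeneous_delta'(2) by (simp add: f.graded_def homogeneous_scale homogeneous_zero)
  hence "f.graded (fps_log1p (Abs_fps (\<lambda>n. if n = 0 then 0 else (- (s\<^sup>2 - inverse (s\<^sup>2))) *\<^sub>C f_delta' s g n)))"
    unfolding fps_log1p_def by (rule f.graded_series_at)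
  thus "homogeneous (- (2 * int k)) (f_delta s g k)"
    by (simp add: f_delta_def f.graded_def homogeneous_scale)
qed

text \<open>
  As the two legs of the R-matrix have opposite degrees, its evaluations depend on the ratio of the
  spectral parameters only.
\<close>

definition bihomogeneous :: "nat \<Rightarrow> ('l, 'l) tensor \<Rightarrow> bool"
  where "bihomogeneous n t \<longleftrightarrow> (\<forall>J1 J2. \<forall>i\<in>{..J1} \<times> {..J2}. \<forall>j\<in>{..J1} \<times> {..J2}. \<forall>v w. v \<noteq> 0 \<longrightarrow> w \<noteq> 0 \<longrightarrow>
    pair_entry J1 v J2 w i j t = (w / v) ^ n * pair_entry J1 1 J2 1 i j t)"

lemma bihomogeneousI:
  assumes "\<And>J1 J2 i j v w. i \<in> {..J1} \<times> {..J2} \<Longrightarrow> j \<in> {..J1} \<times> {..J2} \<Longrightarrow> v \<noteq> 0 \<Longrightarrow> w \<noteq> 0 \<Longrightarrow>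
    pair_entry J1 v J2 w i j t = (w / v) ^ n * pair_entry J1 1 J2 1 i j t"
  shows "bihomogeneous n t"
  using assms unfolding bihomogeneous_def by blast

lemma bihomogeneousD:
  assumes "bihomogeneous n t" "i \<in> {..J1} \<times> {..J2}" "j \<in> {..J1} \<times> {..J2}" "v \<noteq> 0" "w \<noteq> 0"
  shows "pair_entry J1 v J2 w i j t = (w / v) ^ n * pair_entry J1 1 J2 1 i j t"
  using assms unfolding bihomogeneous_def by blast

lemma bihomogeneous_pure:
  assumes x: "homogeneous (int n) x" and y: "homogeneous (- int n) y"
  shows "bihomogeneous n (x \<otimes>\<^sub>t y)"
proof (rule bihomogeneousI)
  fix J1 J2 :: nat and i j :: "nat \<times> nat" and v w :: "complex fls"
  assume ij: "i \<in> {..J1} \<times> {..J2}" "j \<in> {..J1} \<times> {..J2}" and vw: "v \<noteq> 0" "w \<noteq> 0"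
  hence le: "fst i \<le> J1" "fst j \<le> J1" "snd i \<le> J2" "snd j \<le> J2" by auto
  have pow: "inverse v powi int n = inverse v ^ n" "inverse w powi (- int n) = w ^ n"
    by (simp_all add: power_int_minus power_inverse)
  have ratio: "(inverse v ^ n * a) * (w ^ n * b) = (w / v) ^ n * (a * b)" for a b
    by (simp add: divide_inverse power_mult_distrib mult_ac)
  show "pair_entry J1 v J2 w i j (x \<otimes>\<^sub>t y) = (w / v) ^ n * pair_entry J1 1 J2 1 i j (x \<otimes>\<^sub>t y)"
    unfolding pair_entry_pure[OF vw ij] pair_entry_pure[OF one_neq_zero one_neq_zero ij]
      homogeneousD[OF x vw(1) le(1,2)] homogeneousD[OF y vw(2) le(3,4)] pow by (rule ratio)
qed

lemma clinear_pair_entry: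
  "v \<noteq> 0 \<Longrightarrow> w \<noteq> 0 \<Longrightarrow> i \<in> {..J1} \<times> {..J2} \<Longrightarrow> j \<in> {..J1} \<times> {..J2} \<Longrightarrow> clinear (pair_entry J1 v J2 w i j)"
  by (rule matrix_repD(2)[OF matrix_rep_pair])

lemma grading_bihomogeneous: "grading bihomogeneous"
proof
  fix n m :: nat and x y :: "('l, 'l) tensor" and c :: complex
  note lin1 = clinear_pair_entry[OF one_neq_zero one_neq_zero]
    and rep1 = matrix_repD[OF matrix_rep_pair[OF one_neq_zero one_neq_zero]]
  show "bihomogeneous n 0"
  proof (rule bihomogeneousI, goal_cases)
    case (1 J1 J2 i j v w)
    show ?case unfolding clinear_zero[OF lin1[OF 1(1,2)]] clinear_zero[OF clinear_pair_entry[OF 1(3,4,1,2)]]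
      by simp
  qed
  show "bihomogeneous 0 1"
  proof (rule bihomogeneousI, goal_cases)
    case (1 J1 J2 i j v w)
    show ?case unfolding rep1(3)[OF 1(1,2)] matrix_repD(3)[OF matrix_rep_pair[OF 1(3,4)] 1(1,2)] by simp
  qed
  show "bihomogeneous n (c *\<^sub>C x)" if x: "bihomogeneous n x"
  proof (rule bihomogeneousI, goal_cases)
    case (1 J1 J2 i j v w)
    show ?case
      unfolding clinear_scaleC[OF lin1[OF 1(1,2)]] clinear_scaleC[OF clinear_pair_entry[OF 1(3,4,1,2)]]
        bihomogeneousD[OF x 1] by (simp only: mult_scaleC_right)
  qed
  show "bihomogeneous n (x + y)" if x: "bihomogeneous n x" and y: "bihomogeneous n y"
  proof (rule bihomogeneousI, goal_cases)
    case (1 J1 J2 i j v w)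
    show ?case
      unfolding clinear_add[OF lin1[OF 1(1,2)]] clinear_add[OF clinear_pair_entry[OF 1(3,4,1,2)]]
        bihomogeneousD[OF x 1] bihomogeneousD[OF y 1] by (simp only: distrib_left)
  qed
  show "bihomogeneous (m + n) (x * y)" if x: "bihomogeneous m x" and y: "bihomogeneous n y"
  proof (rule bihomogeneousI, goal_cases)
    case (1 J1 J2 i j v w)
    have ratio: "(r ^ m * a) * (r ^ n * b) = r ^ (m + n) * (a * b)" for r a b :: "complex fls"
      by (simp add: power_add mult_ac)
    have "pair_entry J1 v J2 w i j (x * y) = (\<Sum>k\<in>{..J1} \<times> {..J2}.
        ((w / v) ^ m * pair_entry J1 1 J2 1 i k x) * ((w / v) ^ n * pair_entry J1 1 J2 1 k j y))"
      unfolding matrix_repD(4)[OF matrix_rep_pair[OF 1(3,4)] 1(1,2)]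
      by (intro sum.cong HOL.refl arg_cong2[of _ _ _ _ "(*)"] bihomogeneousD[OF x] bihomogeneousD[OF y] 1)
    also have "\<dots> = (w / v) ^ (m + n) * pair_entry J1 1 J2 1 i j (x * y)"
      unfolding ratio rep1(4)[OF 1(1,2)] sum_distrib_left ..
    finally show ?case .
  qed
qed

lemma pair_entry_1_const:
  assumes ij: "i \<in> {..J1} \<times> {..J2}" "j \<in> {..J1} \<times> {..J2}"
  shows "pair_entry J1 1 J2 1 i j t \<in> range fls_const"
proof -
  note lin = clinear_pair_entry[OF one_neq_zero one_neq_zero ij]
  have le: "fst i \<le> J1" "fst j \<le> J1" "snd i \<le> J2" "snd j \<le> J2" using ij by auto
  show ?thesis
  proof (induction t rule: tensor_induct)
    case zero
    show ?case unfolding clinear_zero[OF lin] by (rule image_eqI[of _ _ 0]) simp_all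
  next
    case (add x y t)
    show ?case
      unfolding clinear_add[OF lin] pair_entry_pure[OF one_neq_zero one_neq_zero ij]
      by (intro fls_const_range_closed add rep_entry_1_const le)
  qed
qed

text \<open>In every factor the power of \<open>fps_X\<close> is the degree of the e-leg, and the
  f-leg has the opposite degree. Substituting such a series into exponentials and multiplying the
  results preserves this.\<close>

lemma bihomogeneous_R: "bihomogeneous n (fps_nth (R_plus s g * R_zero s g * R_minus s g) n)"
proof -
  interpret t: grading bihomogeneous by (rule grading_bihomogeneous)
  have qexp: "t.graded (fps_qexp p (fps_const (c *\<^sub>C (x \<otimes>\<^sub>t y)) * fps_X ^ (2 * k + 1)))"
    if "homogeneous (2 * int k + 1) x" "homogeneous (- (2 * int k + 1)) y" for p c x y k
    unfolding fps_qexp_def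
    using that bihomogeneous_pure[of "2 * k + 1" x y] by (intro t.graded_series_at t.graded_monomial t.scale) (simp add: add.commute)
  \<comment> \<open>The infinite products are defined coefficientwise from finite products that
    depend on n. Being graded is a condition on single coefficients, so it survives this diagonal
    choice.\<close>
  have trunc: "t.graded (Abs_fps (\<lambda>n. fps_nth (f n) n))" if "\<And>n. t.graded (f n)" for f
    using that by (simp add: t.graded_def)
  have "t.graded (R_plus s g)"
    unfolding R_plus_def by (intro trunc t.graded_prod_list qexp homogeneous_alpha)
  moreover have "t.graded (R_minus s g)"
    unfolding R_minus_def by (intro trunc t.graded_prod_list qexp homogeneous_alpha)
  moreover have "t.graded (R_zero s g)"
  proof -
    have "bihomogeneous n (e_delta s g (n div 2) \<otimes>\<^sub>t f_delta s g (n div 2))" if "even n" for n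
      using that homogeneous_delta[of "n div 2"] by (intro bihomogeneous_pure) (auto elim!: evenE)
    thus ?thesis unfolding R_zero_def fps_exponential_def
      by (intro t.graded_series_at) (simp add: t.graded_def t.scale t.zero)
  qed
  ultimately show ?thesis
    using t.graded_mult by (simp add: t.graded_def)
qed

text \<open>K_1^{1/2} is diagonal with eigenvalues s^{J-2i}, and the Lagrange polynomial of the node
  \<open>a\<close> is 1 at s^a and 0 at the other nodes. J \<le> N guarantees that every weight is a
  node.\<close>

lemma rep_entry_weight_proj:
  assumes v: "v \<noteq> 0" and i: "i \<le> J" and j: "j \<le> J" and N: "J \<le> N"
  shows "rep_entry J v i j (weight_proj s g N a) = (if i = j \<and> a = int J - 2 * int i then 1 else 0)"
proof -
  let ?w = "\<lambda>i. s powi (int J - 2 * int i)"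
  let ?h = "\<lambda>c. inverse (s powi a - s powi c) *\<^sub>C (g (gK N1) - (s powi c) *\<^sub>C 1)"
  let ?f = "\<lambda>i c. inverse (s powi a - s powi c) * (?w i - s powi c)"
  let ?cs = "filter (\<lambda>c. c \<noteq> a) [- int N..int N]"
  have h: "rep_entry J v i j (?h c) = (if i = j then fls_const (?f i c) else 0)" if "i \<le> J" "j \<le> J" for i j c
    unfolding rep_entry_linear[OF v that] rep_entry_generators(5)[OF v that]
    by (simp add: weight_entry_def scaleC_zero_right fls_scaleC_conv fls_minus_const right_diff_distrib)
  have "rep_entry J v i j (prod_list (map ?h cs)) = (if i = j then fls_const (\<Prod>c\<leftarrow>cs. ?f i c) else 0)"
    if "i \<le> J" for i cs
    using that
  proof (induction cs arbitrary: i)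
    case Nil
    show ?case using rep_entry_linear(5)[OF v Nil j] by simp
  next
    case (Cons c cs)
    have "rep_entry J v i j (?h c * prod_list (map ?h cs)) =
        (\<Sum>k\<in>{..J}. if k = i then fls_const (?f i c) * rep_entry J v i j (prod_list (map ?h cs)) else 0)"
      using Cons.prems j unfolding matrix_repD(4)[OF matrix_rep_eval[OF v] atMost_iff[THEN iffD2, OF Cons.prems] atMost_iff[THEN iffD2, OF j]]
      by (intro sum.cong HOL.refl) (simp add: h)
    thus ?case using Cons.prems Cons.IH[OF Cons.prems] by simp
  qed
  hence *: "rep_entry J v i j (weight_proj s g N a) = (if i = j then fls_const (\<Prod>c\<leftarrow>?cs. ?f i c) else 0)"
    unfolding weight_proj_def using i by blast
  have "(\<Prod>c\<leftarrow>?cs. ?f i c) = (if a = int J - 2 * int i then 1 else 0)"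
  proof (cases "a = int J - 2 * int i")
    case True
    have "?f i c = 1" if "c \<noteq> a" for c
      using s_powi_eq_iff[of a c] that True by simp
    hence "(\<Prod>c\<leftarrow>?cs. ?f i c) = (\<Prod>c\<leftarrow>?cs. 1)"
      by (intro arg_cong[of _ _ prod_list] map_cong HOL.refl) simp
    thus ?thesis using True by (simp add: map_replicate_const)
  next
    case False
    have "int J - 2 * int i \<in> set ?cs" using False i N by auto
    hence "0 \<in> set (map (?f i) ?cs)" by (force simp: image_iff)
    hence "(\<Prod>c\<leftarrow>?cs. ?f i c) = 0" by (simp only: prod_list_zero_iff)
    thus ?thesis using False by simp
  qed
  thus ?thesis using * by auto
qed

lemma pair_entry_cartan:
  assumes vw: "v \<noteq> 0" "w \<noteq> 0" and ij: "i \<in> {..J1} \<times> {..J2}" "j \<in> {..J1} \<times> {..J2}" and N: "J1 \<le> N" "J2 \<le> N"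
  shows "pair_entry J1 v J2 w i j (cartan_factor s g N) = (if i = j then
    fls_const (s powi ((int J1 - 2 * int (fst i)) * (int J2 - 2 * int (snd i)))) else 0)"
proof -
  note lin = clinear_pair_entry[OF vw ij]
  have le: "fst i \<le> J1" "fst j \<le> J1" "snd i \<le> J2" "snd j \<le> J2" using ij by auto
  let ?a = "int J1 - 2 * int (fst i)" and ?b = "int J2 - 2 * int (snd i)"
  have "pair_entry J1 v J2 w i j (cartan_factor s g N) = (\<Sum>a\<in>{- int N..int N}. \<Sum>b\<in>{- int N..int N}.
      s powi (a * b) *\<^sub>C ((if fst i = fst j \<and> a = ?a then 1 else 0) * (if snd i = snd j \<and> b = ?b then 1 else 0)))"
    unfolding cartan_factor_def clinear_sum[OF lin] clinear_scaleC[OF lin] pair_entry_pure[OF vw ij]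
      rep_entry_weight_proj[OF vw(1) le(1,2) N(1)] rep_entry_weight_proj[OF vw(2) le(3,4) N(2)] ..
  also have "\<dots> = (\<Sum>a\<in>{- int N..int N}. \<Sum>b\<in>{- int N..int N}.
      if b = ?b then if a = ?a then if i = j then s powi (?a * ?b) *\<^sub>C 1 else 0 else 0 else 0)"
    by (intro sum.cong HOL.refl) (auto simp: prod_eq_iff scaleC_zero_right)
  also have "\<dots> = (if i = j then fls_const (s powi (?a * ?b)) else 0)"
  proof -
    have "?a \<in> {- int N..int N}" "?b \<in> {- int N..int N}" using le N by auto
    thus ?thesis by (simp only: sum.delta finite_atLeastAtMost_int if_True fls_scaleC_one)
  qed
  finally show ?thesis .
qed

text \<open>The constants \<open>C\<close> are the same for all spectral parameters and all large N:
  the Cartan factor is diagonal and no longer changes once N reaches both spins. Raising N therefore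
  only appends terms to a power series in w/v.\<close>

lemma pair_entry_universal_R:
  assumes ij: "i \<in> {..J1} \<times> {..J2}" "j \<in> {..J1} \<times> {..J2}"
  obtains C where "\<And>v w N. v \<noteq> 0 \<Longrightarrow> w \<noteq> 0 \<Longrightarrow> J1 \<le> N \<Longrightarrow> J2 \<le> N \<Longrightarrow>
    pair_entry J1 v J2 w i j (universal_R s g N) = (\<Sum>n\<le>N. (w / v) ^ n * fls_const (C n))"
proof -
  let ?R = "fps_nth (R_plus s g * R_zero s g * R_minus s g)"
  let ?c = "s powi ((int J1 - 2 * int (fst j)) * (int J2 - 2 * int (snd j)))"
  have "\<forall>n. \<exists>c. pair_entry J1 1 J2 1 i j (?R n) = fls_const c"
    using pair_entry_1_const[OF ij] by blast
  from choice[OF this] obtain D where D: "\<forall>n. pair_entry J1 1 J2 1 i j (?R n) = fls_const (D n)" ..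
  show ?thesis
  proof (rule that[of "\<lambda>n. D n * ?c"])
    fix v w :: "complex fls" and N :: nat assume vw: "v \<noteq> 0" "w \<noteq> 0" and N: "J1 \<le> N" "J2 \<le> N"
    have assoc: "r * fls_const a * fls_const b = r * fls_const (a * b)" for r and a b :: complex
      by (simp add: mult.assoc)
    have "pair_entry J1 v J2 w i j (universal_R s g N) =
        (\<Sum>k\<in>{..J1} \<times> {..J2}. if k = j then pair_entry J1 v J2 w i j (\<Sum>n\<le>N. ?R n) * fls_const ?c else 0)"
      unfolding universal_R_def matrix_repD(4)[OF matrix_rep_pair[OF vw] ij]
      by (intro sum.cong HOL.refl) (simp add: pair_entry_cartan[OF vw _ ij(2) N])
    also have "\<dots> = pair_entry J1 v J2 w i j (\<Sum>n\<le>N. ?R n) * fls_const ?c"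
      using ij(2) by (subst sum.delta) auto
    also have "\<dots> = (\<Sum>n\<le>N. pair_entry J1 v J2 w i j (?R n) * fls_const ?c)"
      unfolding clinear_sum[OF clinear_pair_entry[OF vw ij]] by (rule sum_distrib_right)
    also have "\<dots> = (\<Sum>n\<le>N. (w / v) ^ n * fls_const (D n * ?c))"
    proof (rule sum.cong[OF HOL.refl])
      fix n
      have "pair_entry J1 v J2 w i j (?R n) = (w / v) ^ n * fls_const (D n)"
        unfolding bihomogeneousD[OF bihomogeneous_R ij vw] spec[OF D] ..
      thus "pair_entry J1 v J2 w i j (?R n) * fls_const ?c = (w / v) ^ n * fls_const (D n * ?c)"
        by (simp only: assoc)
    qed
    finally show "pair_entry J1 v J2 w i j (universal_R s g N) = (\<Sum>n\<le>N. (w / v) ^ n * fls_const (D n * ?c))" .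
  qed
qed

end


section \<open>Convergence of Laurent series\<close>

lemma dist_fls_less_iff:
  fixes a b :: "'a::group_add fls"
  shows "dist a b < inverse (2 ^ m) \<longleftrightarrow> (\<forall>n\<le>int m. fls_nth a n = fls_nth b n)"
proof
  assume d: "dist a b < inverse (2 ^ m)"
  show "\<forall>n\<le>int m. fls_nth a n = fls_nth b n"
  proof (cases "a = b")
    case False
    have "inverse (2 ^ m) \<le> (1 :: real)" by (simp add: inverse_le_1_iff)
    have "fls_subdegree (a - b) \<ge> 0"
    proof (rule ccontr)
      assume "\<not> fls_subdegree (a - b) \<ge> 0"
      hence "dist a b = 2 ^ nat (- fls_subdegree (a - b))" using False by (simp add: dist_fls_def)
      moreover have "(1 :: real) \<le> 2 ^ nat (- fls_subdegree (a - b))" by (rule one_le_power) simp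
      ultimately show False using d \<open>inverse (2 ^ m) \<le> 1\<close> by linarith
    qed
    moreover from this have "inverse (2 ^ nat (fls_subdegree (a - b))) < (inverse (2 ^ m) :: real)"
      using d False by (simp add: dist_fls_def)
    hence "m < nat (fls_subdegree (a - b))" by simp
    ultimately have "fls_nth (a - b) n = 0" if "n \<le> int m" for n
      using that by (intro fls_eq0_below_subdegree) auto
    thus ?thesis by simp
  qed simp
next
  assume eq: "\<forall>n\<le>int m. fls_nth a n = fls_nth b n"
  show "dist a b < inverse (2 ^ m)"
  proof (cases "a = b")
    case False
    have "int m < fls_subdegree (a - b)"
      using False eq by (intro fls_subdegree_greaterI) auto
    thus ?thesis using False by (simp add: dist_fls_def)
  qed simp
qed

text \<open>Adic convergence is eventual equality of all coefficients up to any bound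
  simultaneously, arbitrarily far down. \<open>formal_eq2\<close> compares partial sums in the same
  manner.\<close>

lemma fls_tendsto_iff:
  fixes X :: "nat \<Rightarrow> 'a::group_add fls"
  shows "X \<longlonglongrightarrow> L \<longleftrightarrow> (\<forall>N. \<forall>\<^sub>F k in sequentially. \<forall>n\<le>N. fls_nth (X k) n = fls_nth L n)"
proof
  assume X: "X \<longlonglongrightarrow> L"
  show "\<forall>N. \<forall>\<^sub>F k in sequentially. \<forall>n\<le>N. fls_nth (X k) n = fls_nth L n"
  proof
    fix N
    have "\<forall>\<^sub>F k in sequentially. dist (X k) L < inverse (2 ^ nat N)"
      using X by (rule tendstoD) simp
    thus "\<forall>\<^sub>F k in sequentially. \<forall>n\<le>N. fls_nth (X k) n = fls_nth L n"
      by eventually_elim (auto simp: dist_fls_less_iff)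
  qed
next
  assume eq: "\<forall>N. \<forall>\<^sub>F k in sequentially. \<forall>n\<le>N. fls_nth (X k) n = fls_nth L n"
  show "X \<longlonglongrightarrow> L"
  proof (rule tendstoI)
    fix e :: real assume "e > 0"
    then obtain m where m: "inverse (2 ^ m) < e"
      using real_arch_pow_inv[of e "1 / 2"] by (auto simp: power_one_over inverse_eq_divide)
    have "\<forall>\<^sub>F k in sequentially. \<forall>n\<le>int m. fls_nth (X k) n = fls_nth L n" using eq by blast
    thus "\<forall>\<^sub>F k in sequentially. dist (X k) L < e"
      by eventually_elim (rule less_trans[OF dist_fls_less_iff[THEN iffD2] m])
  qed
qed

lemma fls_tendsto_mult:
  fixes X Y :: "nat \<Rightarrow> 'a::ring_1 fls"
  assumes X: "X \<longlonglongrightarrow> A" and Y: "Y \<longlonglongrightarrow> B"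
  shows "(\<lambda>k. X k * Y k) \<longlonglongrightarrow> A * B"
  unfolding fls_tendsto_iff
proof
  fix N
  \<comment> \<open>Coefficients up to N of a product involve those of the first factor up to N - ?b
    and of the second up to N - ?a. Agreement up to ?a and ?b in addition keeps both factors from
    starting earlier than their limits.\<close>
  let ?a = "fls_subdegree A" and ?b = "fls_subdegree B"
  have "\<forall>\<^sub>F k in sequentially. \<forall>n\<le>max ?a (N - ?b). fls_nth (X k) n = fls_nth A n"
    "\<forall>\<^sub>F k in sequentially. \<forall>n\<le>max ?b (N - ?a). fls_nth (Y k) n = fls_nth B n"
    using X Y by (simp_all add: fls_tendsto_iff)
  thus "\<forall>\<^sub>F k in sequentially. \<forall>n\<le>N. fls_nth (X k * Y k) n = fls_nth (A * B) n"
  proof eventually_elim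
    case (elim k)
    have X': "fls_nth (X k) i = fls_nth A i" if "i \<le> ?a \<or> i \<le> N - ?b" for i
      using elim(1) that unfolding le_max_iff_disj by blast
    have Y': "fls_nth (Y k) i = fls_nth B i" if "i \<le> ?b \<or> i \<le> N - ?a" for i
      using elim(2) that unfolding le_max_iff_disj by blast
    show ?case
    proof (intro allI impI)
      fix n assume n: "n \<le> N"
      have "fls_nth (X k) i = 0" if "i < ?a" for i
        using X'[of i] that by simp
      moreover have "fls_nth (Y k) i = 0" if "i < ?b" for i
        using Y'[of i] that by simp
      ultimately have "fls_nth (X k * Y k) n = (\<Sum>i=?a..n - ?b. fls_nth (X k) i * fls_nth (Y k) (n - i))"
        by (rule fls_times_nth_bounds)
      also have "\<dots> = (\<Sum>i=?a..n - ?b. fls_nth A i * fls_nth B (n - i))"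
      proof (rule sum.cong[OF HOL.refl])
        fix i assume "i \<in> {?a..n - ?b}"
        hence "i \<le> N - ?b" "n - i \<le> N - ?a" using n by auto
        thus "fls_nth (X k) i * fls_nth (Y k) (n - i) = fls_nth A i * fls_nth B (n - i)"
          using X'[of i] Y'[of "n - i"] by simp
      qed
      finally show "fls_nth (X k * Y k) n = fls_nth (A * B) n" by (simp add: fls_times_nth(2))
    qed
  qed
qed

lemma fls_tendsto_add:
  fixes X Y :: "nat \<Rightarrow> 'a::ab_group_add fls"
  assumes X: "X \<longlonglongrightarrow> A" and Y: "Y \<longlonglongrightarrow> B"
  shows "(\<lambda>k. X k + Y k) \<longlonglongrightarrow> A + B"
  unfolding fls_tendsto_iff
proof
  fix N
  have "\<forall>\<^sub>F k in sequentially. \<forall>n\<le>N. fls_nth (X k) n = fls_nth A n"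
    "\<forall>\<^sub>F k in sequentially. \<forall>n\<le>N. fls_nth (Y k) n = fls_nth B n"
    using X Y by (simp_all add: fls_tendsto_iff)
  thus "\<forall>\<^sub>F k in sequentially. \<forall>n\<le>N. fls_nth (X k + Y k) n = fls_nth (A + B) n"
    by eventually_elim simp
qed

lemma fls_tendsto_sum:
  fixes X :: "'i \<Rightarrow> nat \<Rightarrow> 'a::ab_group_add fls"
  assumes "\<And>i. i \<in> I \<Longrightarrow> X i \<longlonglongrightarrow> A i"
  shows "(\<lambda>k. \<Sum>i\<in>I. X i k) \<longlonglongrightarrow> (\<Sum>i\<in>I. A i)"
  using assms by (induction I rule: infinite_finite_induct) (simp_all add: fls_tendsto_add)

lemma fls_power_nth_eq_0:
  fixes r :: "'a::comm_ring_1 fls"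
  assumes "\<And>n. n \<le> 0 \<Longrightarrow> fls_nth r n = 0"
  shows "i < int m \<Longrightarrow> fls_nth (r ^ m) i = 0"
proof (induction m arbitrary: i)
  case (Suc m)
  have "fls_nth (r * r ^ m) i = (\<Sum>k=1..i - int m. fls_nth r k * fls_nth (r ^ m) (i - k))"
    using assms Suc.IH by (intro fls_times_nth_bounds) auto
  thus ?case using Suc.prems by simp
qed simp

lemma fls_nth_sum: "fls_nth (sum f A) n = (\<Sum>i\<in>A. fls_nth (f i) n)"
  by (induction A rule: infinite_finite_induct) simp_all

text \<open>The n-th power of \<open>r\<close> starts in degree n or later, so the coefficient of
  degree i is constant from N = i on.\<close>

lemma fls_power_series_convergent:
  fixes r :: "'a::comm_ring_1 fls"
  assumes r: "\<And>n. n \<le> 0 \<Longrightarrow> fls_nth r n = 0"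
  shows "convergent (\<lambda>N. \<Sum>n\<le>N. r ^ n * fls_const (c n))"
proof -
  let ?S = "\<lambda>N. \<Sum>n\<le>N. r ^ n * fls_const (c n)"
  have nth: "fls_nth (?S N) i = (\<Sum>n\<le>N. fls_nth (r ^ n) i * c n)" for N i
    by (simp add: fls_nth_sum)
  have stable: "fls_nth (?S N) i = fls_nth (?S (nat i)) i" if "i \<le> int N" for N i
  proof -
    have "fls_nth (r ^ m) i * c m = 0" if "m \<notin> {..nat i}" for m
    proof -
      have "i < int m" using that by auto
      thus ?thesis using fls_power_nth_eq_0[OF r] by simp
    qed
    thus ?thesis unfolding nth using that by (intro sum.mono_neutral_right) auto
  qed
  define L where "L = Abs_fls (\<lambda>i. fls_nth (?S (nat i)) i)"
  have "fls_nth (?S (nat i)) i = 0" if "i < 0" for i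
    unfolding nth using that fls_power_nth_eq_0[OF r, of i] by (intro sum.neutral) auto
  hence "\<exists>N. \<forall>n<N. fls_nth (?S (nat n)) n = 0" by blast
  hence L: "fls_nth L i = fls_nth (?S (nat i)) i" for i
    unfolding L_def by (rule nth_Abs_fls_ex_lower_bound)
  have "?S \<longlonglongrightarrow> L"
    unfolding fls_tendsto_iff
  proof
    fix N :: int
    show "\<forall>\<^sub>F k in sequentially. \<forall>n\<le>N. fls_nth (?S k) n = fls_nth L n"
      using eventually_ge_at_top[of "nat N"]
    proof eventually_elim
      case (elim k)
      show ?case unfolding L using elim by (intro allI impI stable) linarith
    qed
  qed
  thus ?thesis by (rule convergentI)
qed

context loop_algebra
begin

text \<open>\<open>R_matrix\<close> is the limit at the parameters (z, 1). At any other pair with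
  the same ratio the partial sums coincide for large N, hence so do the limits.\<close>

lemma R_matrix_entry_tendsto:
  assumes i: "i \<in> {..J1} \<times> {..J2}" "j \<in> {..J1} \<times> {..J2}" and vw: "v \<noteq> 0" "w \<noteq> 0"
    and ratio: "w / v = inverse z" and z: "\<And>n. n \<le> 0 \<Longrightarrow> fls_nth (inverse z) n = 0"
  shows "(\<lambda>N. pair_entry J1 v J2 w i j (universal_R s g N)) \<longlonglongrightarrow>
    R_matrix s g J1 J2 z $$ (fst i * (J2 + 1) + snd i, fst j * (J2 + 1) + snd j)"
proof -
  have z0: "z \<noteq> 0" using ratio vw by auto
  obtain C where C: "\<And>v w N. v \<noteq> 0 \<Longrightarrow> w \<noteq> 0 \<Longrightarrow> J1 \<le> N \<Longrightarrow> J2 \<le> N \<Longrightarrow>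
    pair_entry J1 v J2 w i j (universal_R s g N) = (\<Sum>n\<le>N. (w / v) ^ n * fls_const (C n))"
    using pair_entry_universal_R[OF i] by blast
  let ?S = "\<lambda>N. \<Sum>n\<le>N. inverse z ^ n * fls_const (C n)"
  have conv: "?S \<longlonglongrightarrow> lim ?S"
    using fls_power_series_convergent[OF z] by (simp add: convergent_LIMSEQ_iff)
  have ev: "\<forall>\<^sub>F N in sequentially. pair_entry J1 v J2 w i j (universal_R s g N) = ?S N"
    "\<forall>\<^sub>F N in sequentially. pair_entry J1 z J2 1 i j (universal_R s g N) = ?S N"
    using eventually_ge_at_top[of "max J1 J2"] C[OF vw] C[OF z0 one_neq_zero]
    by (auto elim!: eventually_mono simp: ratio inverse_eq_divide[symmetric])
  have lt: "fst i * (J2 + 1) + snd i < (J1 + 1) * (J2 + 1)" if "i \<in> {..J1} \<times> {..J2}" for i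
  proof -
    have "fst i * (J2 + 1) + snd i < (fst i + 1) * (J2 + 1)" using that by auto
    also have "\<dots> \<le> (J1 + 1) * (J2 + 1)" using that by (intro mult_right_mono) auto
    finally show ?thesis .
  qed
  have dim: "dim_row (eval_rep s g J v x) = J + 1" "dim_col (eval_rep s g J v x) = J + 1" for J v x
    by (simp_all add: eval_rep_def mat_ext_def)
  have "(fst i * (J2 + 1) + snd i) div (J2 + 1) = fst i" "(fst i * (J2 + 1) + snd i) mod (J2 + 1) = snd i"
    if "i \<in> {..J1} \<times> {..J2}" for i
    using that by (auto simp: div_mult_self3 simp del: mult_Suc_right)
  hence "R_matrix s g J1 J2 z $$ (fst i * (J2 + 1) + snd i, fst j * (J2 + 1) + snd j) =
      lim (\<lambda>N. pair_entry J1 z J2 1 i j (universal_R s g N))"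
    using lt i unfolding R_matrix_def pair_entry_def by (simp add: kron_def dim)
  also have "\<dots> = lim ?S"
    using conv ev(2) by (intro limI) (simp add: tendsto_cong)
  finally show ?thesis using conv ev(1) by (simp add: tendsto_cong)
qed

end

section \<open>Rescaling the variable of a Laurent series\<close>

text \<open>The substitution of c/u for 1/u. For c \<noteq> 0 it is a homomorphism, and it respects
  adic limits; it carries the summability of the K-matrix, which is assumed at u, to multiples of
  u.\<close>

definition fls_scale :: "complex \<Rightarrow> 'a::complex_algebra fls \<Rightarrow> 'a fls"
  where "fls_scale c f = Abs_fls (\<lambda>n. c powi n *\<^sub>C fls_nth f n)"

lemma fls_nth_scale [simp]: "fls_nth (fls_scale c f) n = c powi n *\<^sub>C fls_nth f n"
  unfolding fls_scale_def by (rule fls_nth_Abs_map[of "\<lambda>n x. c powi n *\<^sub>C x"]) (rule scaleC_zero_right)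

lemma fls_scale_mult:
  assumes "c \<noteq> 0"
  shows "fls_scale c (f * h) = fls_scale c f * fls_scale c h"
proof (rule fls_eqI)
  fix n
  let ?a = "fls_subdegree f" and ?b = "fls_subdegree h"
  have "fls_nth (fls_scale c f * fls_scale c h) n =
      (\<Sum>i=?a..n - ?b. fls_nth (fls_scale c f) i * fls_nth (fls_scale c h) (n - i))"
    by (rule fls_times_nth_bounds) (simp_all add: scaleC_zero_right)
  also have "\<dots> = (\<Sum>i=?a..n - ?b. c powi n *\<^sub>C (fls_nth f i * fls_nth h (n - i)))"
  proof (rule sum.cong[OF HOL.refl])
    fix i
    have "c powi (n - i) * c powi i = c powi n"
      using assms by (simp flip: power_int_add)
    thus "fls_nth (fls_scale c f) i * fls_nth (fls_scale c h) (n - i) = c powi n *\<^sub>C (fls_nth f i * fls_nth h (n - i))"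
      by (simp add: mult_scaleC_left mult_scaleC_right scaleC_scaleC)
  qed
  finally show "fls_nth (fls_scale c (f * h)) n = fls_nth (fls_scale c f * fls_scale c h) n"
    by (simp add: fls_times_nth(2) scaleC_sum_right)
qed

lemma algebra_hom_fls_scale: "c \<noteq> 0 \<Longrightarrow> algebra_hom (fls_scale c)"
  unfolding algebra_hom_def
  by (intro conjI allI fls_scale_mult fls_eqI)
    (simp_all add: scaleC_add_right scaleC_one scaleC_zero_right scaleC_commute)

lemma fls_scale_tensor: "fls_scale c (fls_tensor f b) = fls_tensor (fls_scale c f) b"
  by (rule fls_eqI) (simp add: scaleC_scaleC scaleC_complex_def)

lemma fls_scale_X: "fls_scale c fls_X = fls_const c * fls_X"
  by (rule fls_eqI) (simp add: scaleC_complex_def)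

lemma fls_scale_X_inv: "fls_scale c (inverse fls_X) = inverse (fls_const c * fls_X)"
  by (rule fls_eqI) (simp add: scaleC_complex_def fls_inverse_const fls_inverse_X power_int_minus)

lemma fls_scale_tendsto:
  assumes "X \<longlonglongrightarrow> L"
  shows "(\<lambda>k. fls_scale c (X k)) \<longlonglongrightarrow> fls_scale c L"
  unfolding fls_tendsto_iff
proof
  fix N
  have "\<forall>\<^sub>F k in sequentially. \<forall>n\<le>N. fls_nth (X k) n = fls_nth L n"
    using assms by (simp add: fls_tendsto_iff)
  thus "\<forall>\<^sub>F k in sequentially. \<forall>n\<le>N. fls_nth (fls_scale c (X k)) n = fls_nth (fls_scale c L) n"
    by eventually_elim simp
qed

lemma tensor_lift_zero: "tensor_lift (\<lambda>x y. 0) t = 0"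
  by (simp add: tensor_lift_def case_prod_unfold)

lemma fls_tensor_zero: "fls_tensor 0 b = 0"
  by (rule fls_eqI) (simp add: scaleC_zero_left)

lemma matrix_rep_hom:
  assumes "matrix_rep I f" "algebra_hom h"
  shows "matrix_rep I (\<lambda>i j x. h (f i j x))"
proof -
  note lin = algebra_hom_clinear[OF assms(2)]
  show ?thesis
    using assms(1) algebra_homD[OF assms(2)]
    by (auto simp: matrix_rep_def clinear_def clinear_sum[OF lin])
qed

text \<open>\<open>'b\<close> is its own 1 by 1 matrix representation, with index \<open>()\<close>.
  The claim is the tensor product of this one with \<open>f\<close>, with the trivial index
  removed.\<close>

lemma matrix_rep_fls_tensor:
  fixes f :: "'i \<Rightarrow> 'i \<Rightarrow> 'a::complex_algebra \<Rightarrow> complex fls"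
  assumes "matrix_rep I f"
  shows "matrix_rep I (\<lambda>i j. tensor_lift (\<lambda>(b :: 'b::complex_algebra) x. fls_tensor (f i j x) b))"
proof -
  have A: "matrix_rep {()} (\<lambda>_ _ (b :: 'b). b)"
    by (rule matrix_repI) (simp_all add: clinear_id)
  have B: "cbilinear (\<lambda>(b :: 'b) a. fls_tensor a b)"
    using cbilinear_fls_tensor unfolding cbilinear_def by blast
  have rep: "matrix_rep ({()} \<times> I) (\<lambda>i j. tensor_lift (\<lambda>(b :: 'b) x. fls_tensor (f (snd i) (snd j) x) b))"
    by (rule matrix_rep_tensor_lift[OF A assms B]) (simp_all add: fls_tensor_mult fls_tensor_one)
  have sum: "sum h ({()} \<times> I) = (\<Sum>k\<in>I. h ((), k))" for h :: "_ \<Rightarrow> 'b fls"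
    by (simp add: sum.cartesian_product' case_prod_unfold)
  show ?thesis
  proof (rule matrix_repI)
    show "finite I" using matrix_repD(1)[OF assms] .
    fix i j assume ij: "i \<in> I" "j \<in> I"
    hence ij': "((), i) \<in> {()} \<times> I" "((), j) \<in> {()} \<times> I" by auto
    show "clinear (tensor_lift (\<lambda>(b :: 'b) x. fls_tensor (f i j x) b))"
      using matrix_repD(2)[OF rep ij'] by simp
    show "tensor_lift (\<lambda>(b :: 'b) x. fls_tensor (f i j x) b) 1 = (if i = j then 1 else 0)"
      using matrix_repD(3)[OF rep ij'] by simp
    show "tensor_lift (\<lambda>(b :: 'b) x. fls_tensor (f i j x) b) (x * y) =
      (\<Sum>k\<in>I. tensor_lift (\<lambda>b x. fls_tensor (f i k x) b) x * tensor_lift (\<lambda>b x. fls_tensor (f k j x) b) y)" for x y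
      using matrix_repD(4)[OF rep ij', of x y] by (simp add: sum)
  qed
qed


section \<open>Evaluation of the universal K-matrix\<close>

context loop_algebra
begin

text \<open>Both sides are representations, the right one because substitution is a homomorphism,
  and they agree on generators.\<close>

lemma rep_entry_scale:
  assumes c: "c \<noteq> 0" and ij: "i \<le> J" "j \<le> J"
  shows "rep_entry J (fls_const c * fls_X) i j x = fls_scale c (rep_entry J fls_X i j x)"
proof -
  have nz: "fls_const c * fls_X \<noteq> 0" "(fls_X :: complex fls) \<noteq> 0" using c by simp_all
  note hom = algebra_hom_fls_scale[OF c]
  show ?thesis
  proof (rule matrix_rep_gen_eq[OF matrix_rep_eval[OF nz(1)] matrix_rep_hom[OF matrix_rep_eval[OF nz(2)] hom]])
    fix y i j assume "i \<in> {..J}" "j \<in> {..J}"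
    thus "rep_entry J (fls_const c * fls_X) i j (g y) = fls_scale c (rep_entry J fls_X i j (g y))"
      by (cases y; rename_tac n; case_tac n)
        (simp_all only: rep_entry_generators[OF nz(1)] rep_entry_generators[OF nz(2)] atMost_iff
          algebra_homD(1,4)[OF hom] fls_scale_X fls_scale_X_inv)
  qed (use ij in auto)
qed

definition K_entry :: "nat \<Rightarrow> complex fls \<Rightarrow> nat \<Rightarrow> nat \<Rightarrow> ('b::complex_algebra, 'l) tensor \<Rightarrow> 'b fls"
  where "K_entry J w i j = tensor_lift (\<lambda>b x. fls_tensor (rep_entry J w i j x) b)"

lemma eval_entry_K_entry: "eval_entry s g J v (i, j) = K_entry J (inverse v) i j"
  by (simp add: eval_entry_def K_entry_def fun_eq_iff)

lemma matrix_rep_K_entry: "w \<noteq> 0 \<Longrightarrow> matrix_rep {..J} (K_entry J w)"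
  unfolding K_entry_def by (intro matrix_rep_fls_tensor matrix_rep_eval)

lemma K_entry_scale:
  assumes c: "c \<noteq> 0" and ij: "i \<le> J" "j \<le> J"
  shows "K_entry J (fls_const c * fls_X) i j t = fls_scale c (K_entry J fls_X i j t)"
  unfolding K_entry_def rep_entry_scale[OF assms] fls_scale_tensor[symmetric]
  by (rule clinear_tensor_lift_image[symmetric]) (rule algebra_hom_clinear[OF algebra_hom_fls_scale[OF c]])

lemma K_entry_tendsto:
  fixes KK :: "nat \<Rightarrow> ('b::complex_algebra, 'l) tensor"
  assumes sm: "summable (\<lambda>k. K_entry J fls_X i j (KK k))" and c: "c \<noteq> 0" and ij: "i \<le> J" "j \<le> J"
  shows "(\<lambda>k. K_entry J (fls_const c * fls_X) i j (\<Sum>n<k. KK n)) \<longlonglongrightarrow>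
    suminf (\<lambda>k. K_entry J (fls_const c * fls_X) i j (KK k))"
proof -
  have nz: "fls_const c * fls_X \<noteq> 0" using c by simp
  have lin: "clinear (K_entry J (fls_const c * fls_X) i j :: ('b, 'l) tensor \<Rightarrow> _)"
    using ij by (intro matrix_repD(2)[OF matrix_rep_K_entry[OF nz]]) auto
  note lin_scale = algebra_hom_clinear[OF algebra_hom_fls_scale[OF c]]
  have "(\<lambda>k. fls_scale c (\<Sum>n<k. K_entry J fls_X i j (KK n))) \<longlonglongrightarrow>
      fls_scale c (suminf (\<lambda>k. K_entry J fls_X i j (KK k)))"
    by (intro fls_scale_tendsto summable_LIMSEQ sm)
  hence "(\<lambda>k. K_entry J (fls_const c * fls_X) i j (KK k)) sums
      fls_scale c (suminf (\<lambda>k. K_entry J fls_X i j (KK k)))"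
    unfolding sums_def clinear_sum[OF lin_scale] K_entry_scale[OF c ij] .
  hence "summable (\<lambda>k. K_entry J (fls_const c * fls_X) i j (KK k))" by (rule sums_summable)
  thus ?thesis unfolding clinear_sum[OF lin] by (rule summable_LIMSEQ)
qed

definition triple_entry :: "nat \<Rightarrow> complex fls \<Rightarrow> nat \<Rightarrow> complex fls \<Rightarrow> nat \<times> nat \<Rightarrow> nat \<times> nat \<Rightarrow>
    ('b::complex_algebra, ('l, 'l) tensor) tensor \<Rightarrow> 'b fls"
  where "triple_entry J1 v J2 w i j = tensor_lift (\<lambda>b t. fls_tensor (pair_entry J1 v J2 w i j t) b)"

lemma matrix_rep_triple:
  "v \<noteq> 0 \<Longrightarrow> w \<noteq> 0 \<Longrightarrow> matrix_rep ({..J1} \<times> {..J2}) (triple_entry J1 v J2 w)"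
  unfolding triple_entry_def by (intro matrix_rep_fls_tensor matrix_rep_pair)

context
  fixes J1 J2 :: nat and v w :: "complex fls" and i j :: "nat \<times> nat"
  assumes vw: "v \<noteq> 0" "w \<noteq> 0" and ij: "i \<in> {..J1} \<times> {..J2}" "j \<in> {..J1} \<times> {..J2}"
begin

lemma triple_entry_pure:
  "triple_entry J1 v J2 w i j (b \<otimes>\<^sub>t t) = fls_tensor (pair_entry J1 v J2 w i j t) b"
proof -
  have "cbilinear (\<lambda>(b :: 'b::complex_algebra) t. fls_tensor (pair_entry J1 v J2 w i j t) b)"
    using clinear_pair_entry[OF vw ij] cbilinearD[OF cbilinear_fls_tensor]
    by (intro cbilinearI) (simp_all add: clinear_def)
  thus ?thesis unfolding triple_entry_def by (rule tensor_lift_pure)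
qed

lemma clinear_triple_entry: "clinear (triple_entry J1 v J2 w i j)"
  using matrix_repD(2)[OF matrix_rep_triple[OF vw] ij] .

lemma triple_entry_leg13:
  "triple_entry J1 v J2 w i j (leg13 t) = (if fst i = fst j then K_entry J2 w (snd i) (snd j) t else 0)"
proof -
  have "pair_entry J1 v J2 w i j (1 \<otimes>\<^sub>t x) = (if fst i = fst j then rep_entry J2 w (snd i) (snd j) x else 0)" for x
    using ij by (auto simp: pair_entry_pure[OF vw ij] rep_entry_linear(5)[OF vw(1)])
  thus ?thesis
    unfolding leg13_def clinear_tensor_lift_image[OF clinear_triple_entry] triple_entry_pure K_entry_def
    by (simp add: fls_tensor_zero tensor_lift_zero)
qed

lemma triple_entry_leg12:
  "triple_entry J1 v J2 w i j (leg12 t) = (if snd i = snd j then K_entry J1 v (fst i) (fst j) t else 0)"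
proof -
  have "pair_entry J1 v J2 w i j (x \<otimes>\<^sub>t 1) = (if snd i = snd j then rep_entry J1 v (fst i) (fst j) x else 0)" for x
    using ij by (auto simp: pair_entry_pure[OF vw ij] rep_entry_linear(5)[OF vw(2)])
  thus ?thesis
    unfolding leg12_def clinear_tensor_lift_image[OF clinear_triple_entry] triple_entry_pure K_entry_def
    by (simp add: fls_tensor_zero tensor_lift_zero)
qed

lemma triple_entry_leg23: "triple_entry J1 v J2 w i j (leg23 t) = fls_tensor (pair_entry J1 v J2 w i j t) 1"
  unfolding leg23_def by (rule triple_entry_pure)

lemma triple_entry_id_coproduct:
  "triple_entry J1 v J2 w i j (id_coproduct g t) =
    tensor_lift (\<lambda>b x. fls_tensor (pair_entry J1 v J2 w i j (coproduct g x)) b) t"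
  unfolding id_coproduct_def clinear_tensor_lift_image[OF clinear_triple_entry] triple_entry_pure ..

lemma pair_entry_twisted_R:
  "pair_entry J1 v J2 w i j (universal_R_twisted s g N) = pair_entry J1 (inverse v) J2 w i j (universal_R s g N)"
proof -
  have "fst i \<le> J1" "fst j \<le> J1" using ij by auto
  thus ?thesis
    unfolding universal_R_twisted_def clinear_tensor_lift_image[OF clinear_pair_entry[OF vw ij]] pair_entry_pure[OF vw ij]
    by (simp add: twist_eval[OF vw(1)] pair_entry_def)
qed

end

section \<open>From two independent spectral parameters to multiples of one\<close>

lemma inverse_spec_u: "inverse spec_u = fls_X"
  by (metis fls_inverse_X inverse_inverse_eq)

context
  fixes J1 J2 :: nat and i j :: "nat \<times> nat"
  assumes ij: "i \<in> {..J1} \<times> {..J2}" "j \<in> {..J1} \<times> {..J2}"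
begin

abbreviation coeff2 :: "int \<Rightarrow> int \<Rightarrow> ('b::complex_algebra, ('l, 'l) tensor) tensor \<Rightarrow> 'b"
  where "coeff2 \<equiv> eval_coeff2 s g J1 J2 (fst i, fst j) (snd i, snd j)"

lemma eval_coeff2_linear:
  fixes b :: "'b::complex_algebra"
  shows "clinear (coeff2 m n :: ('b, ('l, 'l) tensor) tensor \<Rightarrow> 'b)"
  and "coeff2 m n (b \<otimes>\<^sub>t (x \<otimes>\<^sub>t y)) =
    (fls_nth (rep_entry J1 fls_X (fst i) (fst j) x) m * fls_nth (rep_entry J2 fls_X (snd i) (snd j) y) n) *\<^sub>C b"
proof -
  let ?p = "\<lambda>x. fls_nth (rep_entry J1 fls_X (fst i) (fst j) x) m"
    and ?q = "\<lambda>y. fls_nth (rep_entry J2 fls_X (snd i) (snd j) y) n"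
  have X: "(fls_X :: complex fls) \<noteq> 0" by simp
  have "clinear (rep_entry J1 fls_X (fst i) (fst j))" "clinear (rep_entry J2 fls_X (snd i) (snd j))"
    using ij by (auto intro!: matrix_repD(2)[OF matrix_rep_eval[OF X]])
  hence "clinear ?p" "clinear ?q" by (simp_all add: clinear_def)
  hence inner: "cbilinear (\<lambda>x y. ?p x * ?q y)"
    by (intro cbilinearI) (simp_all add: clinear_def distrib_left distrib_right mult_scaleC_left mult_scaleC_right)
  have "clinear (tensor_lift (\<lambda>x y. ?p x * ?q y))" by (rule clinear_tensor_lift[OF inner])
  hence outer: "cbilinear (\<lambda>(b :: 'b) t. tensor_lift (\<lambda>x y. ?p x * ?q y) t *\<^sub>C b)"
    by (intro cbilinearI)
      (simp_all add: clinear_def scaleC_add_left scaleC_add_right scaleC_scaleC scaleC_complex_def mult.commute)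
  show "clinear (coeff2 m n :: ('b, ('l, 'l) tensor) tensor \<Rightarrow> 'b)"
    unfolding eval_coeff2_def inverse_spec_u by (rule clinear_tensor_lift[OF outer])
  show "coeff2 m n (b \<otimes>\<^sub>t (x \<otimes>\<^sub>t y)) = (?p x * ?q y) *\<^sub>C b"
    unfolding eval_coeff2_def inverse_spec_u tensor_lift_pure[OF outer] tensor_lift_pure[OF inner] ..
qed

context
  fixes c1 c2 :: complex
  assumes c: "c1 \<noteq> 0" "c2 \<noteq> 0"
begin

lemma X_nonzero: "fls_const c1 * fls_X \<noteq> 0" "fls_const c2 * fls_X \<noteq> 0" "(fls_X :: complex fls) \<noteq> 0"
  using c by simp_all

abbreviation specialized :: "('b::complex_algebra, ('l, 'l) tensor) tensor \<Rightarrow> 'b fls"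
  where "specialized \<equiv> triple_entry J1 (fls_const c1 * fls_X) J2 (fls_const c2 * fls_X) i j"

text \<open>In degree n the substitution collects all coefficients of total degree n.
  \<open>K\<close> bounds the pole orders in both variables, which makes the sum finite; a
  sufficient bound depends on \<open>T\<close>.\<close>

definition coeff_expansion :: "int \<Rightarrow> ('b::complex_algebra, ('l, 'l) tensor) tensor \<Rightarrow> bool"
  where "coeff_expansion K T \<longleftrightarrow> (\<forall>n. fls_nth (specialized T) n =
    (\<Sum>m=- K..n + K. (c1 powi m * c2 powi (n - m)) *\<^sub>C coeff2 m (n - m) T))"

lemma specialized_linear: "clinear (specialized :: ('b::complex_algebra, ('l, 'l) tensor) tensor \<Rightarrow> 'b fls)"
  by (rule clinear_triple_entry[OF X_nonzero(1,2) ij])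

lemma coeff_expansion_add: "coeff_expansion K S \<Longrightarrow> coeff_expansion K T \<Longrightarrow> coeff_expansion K (S + T)"
  unfolding coeff_expansion_def clinear_add[OF specialized_linear] clinear_add[OF eval_coeff2_linear(1)]
  by (simp add: scaleC_add_right sum.distrib)

lemma coeff_expansion_zero: "coeff_expansion K 0"
  unfolding coeff_expansion_def clinear_zero[OF specialized_linear] clinear_zero[OF eval_coeff2_linear(1)]
  by (simp add: scaleC_zero_right)

lemma coeff_expansion_pure: "\<forall>\<^sub>F K in at_top. coeff_expansion K (b \<otimes>\<^sub>t (x \<otimes>\<^sub>t y))"
proof -
  let ?f = "rep_entry J1 fls_X (fst i) (fst j) x" and ?h = "rep_entry J2 fls_X (snd i) (snd j) y"
  have le: "fst i \<le> J1" "fst j \<le> J1" "snd i \<le> J2" "snd j \<le> J2" using ij by auto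
  have "coeff_expansion K (b \<otimes>\<^sub>t (x \<otimes>\<^sub>t y))" if K: "K \<ge> max (- fls_subdegree ?f) (- fls_subdegree ?h)" for K
    unfolding coeff_expansion_def
  proof
    fix n
    have "fls_nth (fls_scale c1 ?f * fls_scale c2 ?h) n =
        (\<Sum>m=- K..n - (- K). fls_nth (fls_scale c1 ?f) m * fls_nth (fls_scale c2 ?h) (n - m))"
      using K by (intro fls_times_nth_bounds) (simp_all add: scaleC_zero_right)
    hence "fls_nth (specialized (b \<otimes>\<^sub>t (x \<otimes>\<^sub>t y))) n =
        (\<Sum>m=- K..n + K. (fls_nth (fls_scale c1 ?f) m * fls_nth (fls_scale c2 ?h) (n - m)) *\<^sub>C b)"
      unfolding triple_entry_pure[OF X_nonzero(1,2) ij] pair_entry_pure[OF X_nonzero(1,2) ij]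
        rep_entry_scale[OF c(1) le(1,2)] rep_entry_scale[OF c(2) le(3,4)] fls_nth_fls_tensor
      by (simp add: scaleC_sum_left)
    also have "\<dots> = (\<Sum>m=- K..n + K. (c1 powi m * c2 powi (n - m)) *\<^sub>C coeff2 m (n - m) (b \<otimes>\<^sub>t (x \<otimes>\<^sub>t y)))"
      unfolding eval_coeff2_linear(2)
      by (intro sum.cong HOL.refl) (simp add: scaleC_scaleC scaleC_complex_def mult_ac)
    finally show "fls_nth (specialized (b \<otimes>\<^sub>t (x \<otimes>\<^sub>t y))) n =
      (\<Sum>m=- K..n + K. (c1 powi m * c2 powi (n - m)) *\<^sub>C coeff2 m (n - m) (b \<otimes>\<^sub>t (x \<otimes>\<^sub>t y)))" .
  qed
  thus ?thesis unfolding eventually_at_top_linorder by blast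
qed

text \<open>Holding for all large K, and not just for some, lets finitely many summands, and later
  both sides of an identity, share one bound.\<close>

lemma coeff_expansion_eventually:
  fixes T :: "('b::complex_algebra, ('l, 'l) tensor) tensor"
  shows "\<forall>\<^sub>F K in at_top. coeff_expansion K T"
proof (induction T rule: tensor_induct)
  case zero
  show ?case by (simp add: coeff_expansion_zero)
next
  case (add b t T)
  have "\<forall>\<^sub>F K in at_top. coeff_expansion K (b \<otimes>\<^sub>t t)"
  proof (induction t rule: tensor_induct)
    case zero
    have "b \<otimes>\<^sub>t 0 = (0 :: ('b, ('l, 'l) tensor) tensor)" by (rule clinear_zero[OF cbilinear_clinear(2)[OF cbilinear_pure_tensor]])
    thus ?case by (simp add: coeff_expansion_zero)
  next
    case (add x y t)
    from coeff_expansion_pure[of b x y] add show ?case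
      unfolding pure_tensor_add_right by eventually_elim (rule coeff_expansion_add)
  qed
  from this add show ?case by eventually_elim (rule coeff_expansion_add)
qed

text \<open>By the expansion, degree n after the substitution involves only total degree n before
  it. So an identity known up to total degree N, as the axiom provides, holds up to degree N in the
  single variable.\<close>

lemma specialized_coeff_eq:
  assumes "\<forall>m n. m + n \<le> N \<longrightarrow> coeff2 m n S = coeff2 m n T" and n: "n \<le> N"
  shows "fls_nth (specialized S) n = fls_nth (specialized T) n"
proof -
  have "\<forall>\<^sub>F K in at_top. coeff_expansion K S \<and> coeff_expansion K T"
    using coeff_expansion_eventually[of S] coeff_expansion_eventually[of T] by (rule eventually_conj)
  then obtain K where "coeff_expansion K S" "coeff_expansion K T"
    unfolding eventually_at_top_linorder by blast
  moreover have "coeff2 m (n - m) S = coeff2 m (n - m) T" for m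
    using assms by simp
  ultimately show ?thesis by (simp only: coeff_expansion_def)
qed

end

end

end

section \<open>The fused K-operator\<close>

lemma tensor_lift_sum_fun: "tensor_lift (\<lambda>x y. \<Sum>i\<in>I. f i x y) t = (\<Sum>i\<in>I. tensor_lift (f i) t)"
proof -
  have "(\<Sum>(a, b)\<leftarrow>xs. \<Sum>i\<in>I. f i a b) = (\<Sum>i\<in>I. \<Sum>(a, b)\<leftarrow>xs. f i a b)" for xs
    by (induction xs) (auto simp: sum.distrib)
  thus ?thesis by (simp add: tensor_lift_def)
qed

definition pair_index :: "nat \<Rightarrow> nat \<times> nat \<Rightarrow> nat"
  where "pair_index J i = fst i * (J + 1) + snd i"

lemma pair_index_div_mod:
  assumes "snd i \<le> J"
  shows "pair_index J i div (J + 1) = fst i" "pair_index J i mod (J + 1) = snd i"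
  using assms by (simp_all add: pair_index_def del: mult_Suc_right)

lemma bij_betw_pair_index: "bij_betw (pair_index J) ({..1} \<times> {..J}) {..<2 * J + 2}"
proof (rule bij_betw_byWitness[where f' = "\<lambda>n. (n div (J + 1), n mod (J + 1))"])
  show "\<forall>i\<in>{..1} \<times> {..J}. (pair_index J i div (J + 1), pair_index J i mod (J + 1)) = i"
    using pair_index_div_mod[of _ J] by auto
  show "\<forall>n\<in>{..<2 * J + 2}. pair_index J (n div (J + 1), n mod (J + 1)) = n"
    by (simp add: pair_index_def del: mult_Suc_right)
  show "pair_index J ` ({..1} \<times> {..J}) \<subseteq> {..<2 * J + 2}"
  proof
    fix n assume "n \<in> pair_index J ` ({..1} \<times> {..J})"
    then obtain i1 i2 where "n = i1 * (J + 1) + i2" "i1 \<le> 1" "i2 \<le> J" by (auto simp: pair_index_def)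
    moreover from this have "i1 * (J + 1) \<le> 1 * (J + 1)" by (intro mult_right_mono) auto
    ultimately show "n \<in> {..<2 * J + 2}" by simp
  qed
  show "(\<lambda>n. (n div (J + 1), n mod (J + 1))) ` {..<2 * J + 2} \<subseteq> {..1} \<times> {..J}"
  proof
    fix p assume "p \<in> (\<lambda>n. (n div (J + 1), n mod (J + 1))) ` {..<2 * J + 2}"
    then obtain n where n: "n < 2 * (J + 1)" "p = (n div (J + 1), n mod (J + 1))" by auto
    have "n div (J + 1) < 2" using n by (simp add: less_mult_imp_div_less)
    moreover have "n mod (J + 1) < J + 1" by (rule mod_less_divisor) simp
    ultimately show "p \<in> {..1} \<times> {..J}" using n(2) by auto
  qed
qed

lemma sum_pair_index: "(\<Sum>n<2 * J + 2. h n) = (\<Sum>i\<in>{..1} \<times> {..J}. h (pair_index J i))"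
  by (rule sum.reindex_bij_betw[OF bij_betw_pair_index, symmetric])

lemma fls_tensor_const_mult:
  fixes f :: "'a::complex_algebra fls"
  shows "fls_tensor (fls_const c) 1 * f = c *\<^sub>C f" "f * fls_tensor (fls_const c) 1 = c *\<^sub>C f"
proof -
  have "fls_tensor (fls_const c) 1 = c *\<^sub>C (1 :: 'a fls)"
    by (rule fls_eqI) (simp add: scaleC_zero_left scaleC_zero_right)
  thus "fls_tensor (fls_const c) 1 * f = c *\<^sub>C f" "f * fls_tensor (fls_const c) 1 = c *\<^sub>C f"
    by (simp_all add: mult_scaleC_left mult_scaleC_right)
qed

lemma fls_tensor_tendsto:
  assumes "X \<longlonglongrightarrow> L"
  shows "(\<lambda>k. fls_tensor (X k) b) \<longlonglongrightarrow> fls_tensor L b"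
  unfolding fls_tendsto_iff
proof
  fix N
  have "\<forall>\<^sub>F k in sequentially. \<forall>n\<le>N. fls_nth (X k) n = fls_nth L n"
    using assms by (simp add: fls_tendsto_iff)
  thus "\<forall>\<^sub>F k in sequentially. \<forall>n\<le>N. fls_nth (fls_tensor (X k) b) n = fls_nth (fls_tensor L b) n"
    by eventually_elim simp
qed

lemma fls_scaleC_tendsto:
  fixes X :: "nat \<Rightarrow> 'a::complex_algebra fls"
  assumes "X \<longlonglongrightarrow> L"
  shows "(\<lambda>k. c *\<^sub>C X k) \<longlonglongrightarrow> c *\<^sub>C L"
  unfolding fls_tendsto_iff
proof
  fix N
  have "\<forall>\<^sub>F k in sequentially. \<forall>n\<le>N. fls_nth (X k) n = fls_nth L n"
    using assms by (simp add: fls_tendsto_iff)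
  thus "\<forall>\<^sub>F k in sequentially. \<forall>n\<le>N. fls_nth (c *\<^sub>C X k) n = fls_nth (c *\<^sub>C L) n"
    by eventually_elim simp
qed

context loop_algebra
begin

lemma fusion_E_pair_index:
  "i \<in> {..1} \<times> {..J} \<Longrightarrow> c \<le> J + 1 \<Longrightarrow> fusion_E s J $$ (pair_index J i, c) = fusion_entry J i c"
  using fusion_E_entry[of "fst i" "snd i" J c] by (auto simp: pair_index_def)

lemma fusion_carrier:
  "fusion_F s J \<in> carrier_mat (J + 2) (2 * J + 2)" "fusion_E s J \<in> carrier_mat (2 * J + 2) (J + 2)"
  by (simp_all add: fusion_F_def fusion_E_def Let_def numeral_2_eq_2)

text \<open>This is u^2 q^{j-1/2}, as q^{1/2} = s and J = 2j.\<close>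

definition spectral_z :: "nat \<Rightarrow> complex fls"
  where "spectral_z J = fls_const (s powi (int J - 1)) * spec_u\<^sup>2"

lemma inverse_spectral_z_nth: "n \<le> 0 \<Longrightarrow> fls_nth (inverse (spectral_z J)) n = 0"
proof -
  assume "n \<le> 0"
  moreover have "inverse (spectral_z J) = fls_const (inverse (s powi (int J - 1))) * (fls_X * fls_X)"
    by (simp add: spectral_z_def inverse_spec_u fls_inverse_const power2_eq_square inverse_mult_distrib)
  moreover have "fls_nth (fls_X * fls_X) n = (0 :: complex)" if "n \<le> 0" for n
    using that by (simp add: fls_X_times_conv_shift)
  ultimately show ?thesis by simp
qed

context
  fixes J :: nat and a b :: "complex fls"
  assumes a: "a = fls_const (inverse s ^ J) * fls_X" and b: "b = fls_const s * fls_X"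
begin

lemma ab_nonzero: "a \<noteq> 0" "b \<noteq> 0"
  using s_nonzero by (simp_all add: a b)

text \<open>The twist has replaced the parameter \<open>a\<close> of the first leg by its inverse,
  so the R-matrix depends on the product of \<open>a\<close> and \<open>b\<close>, which is s^{1-J}
  u^{-2}.\<close>

lemma spectral_ratio: "b / inverse a = inverse (spectral_z J)"
proof -
  have "s powi (int J - 1) * (inverse s ^ J * s) = 1"
    using s_nonzero by (simp add: power_int_diff power_inverse)
  hence "inverse (s powi (int J - 1)) = inverse s ^ J * s"
    using s_nonzero by (metis inverse_unique)
  thus ?thesis
    by (simp add: spectral_z_def a b inverse_spec_u fls_inverse_const power2_eq_square inverse_mult_distrib
      mult_ac divide_inverse flip: fls_const_mult_const)
qed

lemma rep_entry_fusion:
  assumes rc: "r \<le> J + 1" "c \<le> J + 1"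
  shows "rep_entry (J + 1) fls_X r c x = (\<Sum>i\<in>{..1} \<times> {..J}. \<Sum>j\<in>{..1} \<times> {..J}.
    (fusion_F s J $$ (r, pair_index J i) * fusion_E s J $$ (pair_index J j, c)) *\<^sub>C pair_entry 1 a J b i j (coproduct g x))"
proof -
  let ?I = "{..1} \<times> {..J}" and ?F = "\<lambda>i. fusion_F s J $$ (r, pair_index J i)"
  let ?R = "\<lambda>k. rep_entry (J + 1) fls_X k c x"
  have X: "(fls_X :: complex fls) \<noteq> 0" by simp
  have FE: "(\<Sum>i\<in>?I. ?F i * fusion_entry J i k) = (if r = k then 1 else 0)" if "k \<le> J + 1" for k
  proof -
    have "(\<Sum>n<2 * J + 2. fusion_F s J $$ (r, n) * fusion_E s J $$ (n, k)) = (if r = k then 1 else 0)"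
    proof -
      have "(fusion_F s J * fusion_E s J) $$ (r, k) = (\<Sum>n<2 * J + 2. fusion_F s J $$ (r, n) * fusion_E s J $$ (n, k))"
        by (rule index_mult_mat_sum[OF fusion_carrier]) (use rc that in auto)
      thus ?thesis unfolding fusion_F_E using rc that by (subst (asm) index_one_mat) (auto simp del: sum.lessThan_Suc)
    qed
    thus ?thesis unfolding sum_pair_index using that by (simp add: fusion_E_pair_index)
  qed
  have "(\<Sum>i\<in>?I. \<Sum>j\<in>?I. (?F i * fusion_E s J $$ (pair_index J j, c)) *\<^sub>C pair_entry 1 a J b i j (coproduct g x)) =
      (\<Sum>i\<in>?I. fls_const (?F i) * (\<Sum>j\<in>?I. pair_entry 1 a J b i j (coproduct g x) * fls_const (fusion_entry J j c)))"
    unfolding sum_distrib_left using rc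
    by (intro sum.cong HOL.refl)
      (simp only: fusion_E_pair_index fls_scaleC_conv mult_ac fls_const_mult_const[symmetric])
  also have "\<dots> = (\<Sum>i\<in>?I. \<Sum>k\<le>J + 1. fls_const (?F i * fusion_entry J i k) * ?R k)"
    unfolding a b
    by (intro sum.cong HOL.refl)
      (simp only: fusion_intertwine[OF X _ rc(2)] sum_distrib_left mult.assoc[symmetric] fls_const_mult_const)
  also have "\<dots> = (\<Sum>k\<le>J + 1. fls_const (\<Sum>i\<in>?I. ?F i * fusion_entry J i k) * ?R k)"
  proof -
    have "fls_const (sum h A) = (\<Sum>i\<in>A. fls_const (h i))" for h :: "_ \<Rightarrow> complex" and A :: "(nat \<times> nat) set"
      by (induction A rule: infinite_finite_induct) (simp_all flip: fls_plus_const)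
    thus ?thesis by (subst sum.swap) (simp only: sum_distrib_right)
  qed
  also have "\<dots> = (\<Sum>k\<le>J + 1. if k = r then ?R k else 0)"
    by (intro sum.cong HOL.refl) (simp only: FE atMost_iff, simp)
  also have "\<dots> = ?R r" using rc by (simp only: sum.delta finite_atMost atMost_iff if_True)
  finally show ?thesis by simp
qed

lemma K_entry_fusion:
  fixes t :: "('b::complex_algebra, 'l) tensor"
  assumes rc: "r \<le> J + 1" "c \<le> J + 1"
  shows "K_entry (J + 1) fls_X r c t = (\<Sum>i\<in>{..1} \<times> {..J}. \<Sum>j\<in>{..1} \<times> {..J}.
    (fusion_F s J $$ (r, pair_index J i) * fusion_E s J $$ (pair_index J j, c)) *\<^sub>C
    triple_entry 1 a J b i j (id_coproduct g t))"
proof -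
  note lin = cbilinear_clinear(1)[OF cbilinear_fls_tensor]
  have scale: "tensor_lift (\<lambda>x y. d *\<^sub>C f x y) t = d *\<^sub>C tensor_lift f t" for d and f :: "_ \<Rightarrow> _ \<Rightarrow> 'b fls"
    by (rule clinear_tensor_lift_image[symmetric]) (rule clinear_scaleC_fun[OF clinear_id])
  show ?thesis
    unfolding K_entry_def rep_entry_fusion[OF rc] clinear_sum[OF lin] clinear_scaleC[OF lin] tensor_lift_sum_fun scale
    by (intro sum.cong HOL.refl) (simp only: triple_entry_id_coproduct[OF ab_nonzero])
qed

context
  fixes KK :: "nat \<Rightarrow> ('b::complex_algebra, 'l) tensor" and \<delta> :: "'b \<Rightarrow> ('b, 'l) tensor"
  assumes KK: "universal_K s g \<delta> KK"
begin

abbreviation "partial_K k \<equiv> \<Sum>n<k. KK n"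

abbreviation "limit_K n w i j \<equiv> suminf (\<lambda>k. K_entry n w i j (KK k))"

lemma partial_K_tendsto:
  assumes "c \<noteq> 0" "i \<le> J'" "j \<le> J'"
  shows "(\<lambda>k. K_entry J' (fls_const c * fls_X) i j (partial_K k)) \<longlonglongrightarrow> limit_K J' (fls_const c * fls_X) i j"
proof (rule K_entry_tendsto)
  have "summable (\<lambda>k. eval_entry s g J' spec_u (i, j) (KK k))"
    using KK assms unfolding universal_K_def Let_def by blast
  thus "summable (\<lambda>k. K_entry J' fls_X i j (KK k))"
    by (simp only: eval_entry_K_entry inverse_spec_u)
qed (use assms in auto)

text \<open>The evaluated right-hand side of the third axiom in the limit. The K-matrix in legs 1
  and 3 acts on spin j and the one in legs 1 and 2 on spin 1/2, each leaving the other index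
  fixed.\<close>

definition fused_entry :: "nat \<times> nat \<Rightarrow> nat \<times> nat \<Rightarrow> 'b fls"
  where "fused_entry i j = (\<Sum>l\<in>{..1} \<times> {..J}. (\<Sum>m\<in>{..1} \<times> {..J}.
      (if fst i = fst m then limit_K J b (snd i) (snd m) else 0) *
      fls_tensor (R_matrix s g 1 J (spectral_z J) $$ (pair_index J m, pair_index J l)) 1) *
    (if snd l = snd j then limit_K 1 a (fst l) (fst j) else 0))"

text \<open>Evaluation of all three legs is multiplicative, so the triple product becomes a finite
  sum of products whose factors converge separately; only then may the limit be taken
  inside.\<close>

lemma triple_product_tendsto:
  assumes ij: "i \<in> {..1} \<times> {..J}" "j \<in> {..1} \<times> {..J}"
  shows "(\<lambda>k. triple_entry 1 a J b i j
      (leg13 (partial_K k) * leg23 (universal_R_twisted s g k) * leg12 (partial_K k))) \<longlonglongrightarrow> fused_entry i j"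
proof -
  let ?I = "{..1} \<times> {..J}"
  have expand: "triple_entry 1 a J b i j (leg13 S * leg23 R * leg12 T) =
    (\<Sum>l\<in>?I. (\<Sum>m\<in>?I. triple_entry 1 a J b i m (leg13 S) * triple_entry 1 a J b m l (leg23 R)) *
      triple_entry 1 a J b l j (leg12 T))" for S T :: "('b, 'l) tensor" and R
    unfolding matrix_repD(4)[OF matrix_rep_triple[OF ab_nonzero] ij]
    by (intro sum.cong HOL.refl arg_cong2[of _ _ _ _ "(*)"] matrix_repD(4)[OF matrix_rep_triple[OF ab_nonzero]] ij)
  have "(\<lambda>k. triple_entry 1 a J b i m (leg13 (partial_K k))) \<longlonglongrightarrow>
      (if fst i = fst m then limit_K J b (snd i) (snd m) else 0)" if "m \<in> ?I" for m
    unfolding triple_entry_leg13[OF ab_nonzero ij(1) that] unfolding b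
    using partial_K_tendsto[OF s_nonzero, of "snd i" J "snd m"] ij that by auto
  moreover have "(\<lambda>k. triple_entry 1 a J b m l (leg23 (universal_R_twisted s g k)) :: 'b fls) \<longlonglongrightarrow>
      fls_tensor (R_matrix s g 1 J (spectral_z J) $$ (pair_index J m, pair_index J l)) 1" if "m \<in> ?I" "l \<in> ?I" for m l
    unfolding triple_entry_leg23[OF ab_nonzero that] pair_entry_twisted_R[OF ab_nonzero that] pair_index_def
    using ab_nonzero
    by (intro fls_tensor_tendsto R_matrix_entry_tendsto that spectral_ratio inverse_spectral_z_nth) auto
  moreover have "(\<lambda>k. triple_entry 1 a J b l j (leg12 (partial_K k))) \<longlonglongrightarrow>
      (if snd l = snd j then limit_K 1 a (fst l) (fst j) else 0)" if "l \<in> ?I" for l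
    unfolding triple_entry_leg12[OF ab_nonzero that ij(2)] unfolding a
    using partial_K_tendsto[of "inverse s ^ J" "fst l" 1 "fst j"] s_nonzero ij that by auto
  ultimately show ?thesis
    unfolding expand fused_entry_def by (intro fls_tendsto_sum fls_tendsto_mult ij)
qed

text \<open>The axiom identifies the two sequences of partial sums only up to a bound N and from
  some index depending on N. This suffices for them to have the same adic limit, and uniqueness of
  limits yields the equation.\<close>

lemma limit_K_fusion:
  assumes rc: "r \<le> J + 1" "c \<le> J + 1"
  shows "limit_K (J + 1) fls_X r c = (\<Sum>i\<in>{..1} \<times> {..J}. \<Sum>j\<in>{..1} \<times> {..J}.
    (fusion_F s J $$ (r, pair_index J i) * fusion_E s J $$ (pair_index J j, c)) *\<^sub>C fused_entry i j)"
    (is "_ = ?L")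
proof -
  let ?I = "{..1} \<times> {..J}"
  let ?c = "\<lambda>i j. fusion_F s J $$ (r, pair_index J i) * fusion_E s J $$ (pair_index J j, c)"
  let ?T = "\<lambda>k. leg13 (partial_K k) * leg23 (universal_R_twisted s g k) * leg12 (partial_K k)"
  let ?Y = "\<lambda>k. \<Sum>i\<in>?I. \<Sum>j\<in>?I. ?c i j *\<^sub>C triple_entry 1 a J b i j (?T k)"
  have Y: "?Y \<longlonglongrightarrow> ?L"
    by (intro fls_tendsto_sum fls_scaleC_tendsto triple_product_tendsto)
  have "(\<lambda>k. K_entry (J + 1) fls_X r c (partial_K k)) \<longlonglongrightarrow> ?L"
    unfolding fls_tendsto_iff
  proof
    fix N
    have "formal_eq2 s g (\<lambda>m n. m + n) (\<lambda>k. id_coproduct g (partial_K k)) ?T"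
      using KK unfolding universal_K_def Let_def by (elim conjE)
    note fe = this[unfolded formal_eq2_def, THEN spec, THEN spec, THEN spec, THEN bspec, THEN bspec]
    have eq: "\<forall>\<^sub>F k in sequentially. \<forall>m n. m + n \<le> N \<longrightarrow>
        eval_coeff2 s g 1 J (fst i, fst j) (snd i, snd j) m n (id_coproduct g (partial_K k)) =
        eval_coeff2 s g 1 J (fst i, fst j) (snd i, snd j) m n (?T k)" if "i \<in> ?I" "j \<in> ?I" for i j
      by (rule fe) (use that in auto)
    have fin: "finite ({..1 :: nat} \<times> {..J})" by simp
    have ev: "\<forall>\<^sub>F k in sequentially. \<forall>i\<in>?I. \<forall>j\<in>?I. \<forall>m n. m + n \<le> N \<longrightarrow>
        eval_coeff2 s g 1 J (fst i, fst j) (snd i, snd j) m n (id_coproduct g (partial_K k)) =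
        eval_coeff2 s g 1 J (fst i, fst j) (snd i, snd j) m n (?T k)"
      by (rule eventually_ball_finite[OF fin], rule ballI, rule eventually_ball_finite[OF fin], rule ballI, rule eq)
    have "\<forall>\<^sub>F k in sequentially. \<forall>n\<le>N. fls_nth (?Y k) n = fls_nth ?L n"
      using Y unfolding fls_tendsto_iff by blast
    with ev show "\<forall>\<^sub>F k in sequentially. \<forall>n\<le>N. fls_nth (K_entry (J + 1) fls_X r c (partial_K k)) n = fls_nth ?L n"
    proof eventually_elim
      case (elim k)
      have "fls_nth (triple_entry 1 a J b i j (id_coproduct g (partial_K k))) n = fls_nth (triple_entry 1 a J b i j (?T k)) n"
        if "n \<le> N" "i \<in> ?I" "j \<in> ?I" for n i j
        unfolding a b using elim(1) that s_nonzero by (intro specialized_coeff_eq[of i 1 J j _ _ N]) auto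
      hence "fls_nth (K_entry (J + 1) fls_X r c (partial_K k)) n = fls_nth (?Y k) n" if "n \<le> N" for n
        unfolding K_entry_fusion[OF rc] fls_nth_sum fls_nth_scaleC using that
        by (intro sum.cong HOL.refl) simp
      thus ?case using elim(2) by simp
    qed
  qed
  moreover have "(\<lambda>k. K_entry (J + 1) fls_X r c (partial_K k)) \<longlonglongrightarrow> limit_K (J + 1) fls_X r c"
    using partial_K_tendsto[of 1 r "J + 1" c] rc by simp
  ultimately show ?thesis by (rule LIMSEQ_unique[symmetric])
qed

end

end

end

section \<open>Translation into products of matrices\<close>

lemma kron_pair_index:
  assumes "i \<in> {..1} \<times> {..J}" "j \<in> {..1} \<times> {..J}"
    and "A \<in> carrier_mat 2 2" "B \<in> carrier_mat (J + 1) (J + 1)"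
  shows "kron A B $$ (pair_index J i, pair_index J j) = A $$ (fst i, fst j) * B $$ (snd i, snd j)"
proof -
  have "pair_index J i < 2 * (J + 1)" "pair_index J j < 2 * (J + 1)"
    using bij_betw_apply[OF bij_betw_pair_index] assms(1,2) by fastforce+
  moreover have "snd i \<le> J" "snd j \<le> J" using assms(1,2) by auto
  ultimately show ?thesis
    using assms(3,4) pair_index_div_mod[of i J] pair_index_div_mod[of j J] by (simp add: kron_def)
qed

lemma K_operator_entry:
  "i \<le> n \<Longrightarrow> j \<le> n \<Longrightarrow> K_operator s g KK n v $$ (i, j) = suminf (\<lambda>k. eval_entry s g n v (i, j) (KK k))"
  by (simp add: K_operator_def)

lemma K_operator_carrier: "K_operator s g KK n v \<in> carrier_mat (n + 1) (n + 1)"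
  by (simp add: K_operator_def)

theorem proposition4p18:
  fixes q s :: complex
    and g :: "gen \<Rightarrow> 'l::complex_algebra"
    and \<delta> :: "'b::complex_algebra \<Rightarrow> ('b, 'l) tensor"
    and KK :: "nat \<Rightarrow> ('b, 'l) tensor"
    and J :: nat
  assumes "q \<noteq> 0" and "\<forall>n>0. q ^ n \<noteq> 1" and "s\<^sup>2 = q"
    and "quantum_loop_algebra s g"
    and "right_comodule_algebra g \<delta>"
    and "universal_K s g \<delta> KK"
  shows "K_operator s g KK (J + 1) spec_u =
    scalar_mat (map_mat fls_const (fusion_F s J)) *
    kron (1\<^sub>m 2) (K_operator s g KK J (fls_const (inverse s) * spec_u)) *
    scalar_mat (R_matrix s g 1 J (fls_const (s powi (int J - 1)) * spec_u\<^sup>2)) *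
    kron (K_operator s g KK 1 (fls_const (s ^ J) * spec_u)) (1\<^sub>m (J + 1)) *
    scalar_mat (map_mat fls_const (fusion_E s J))"
    (is "?K = ?A * ?B * ?C * ?D * ?E")
proof -
  have "s \<noteq> 0" using assms(1,3) by auto
  then interpret loop_algebra s g
    using assms by unfold_locales auto
  define a b :: "complex fls" where "a = fls_const (inverse s ^ J) * fls_X" and "b = fls_const s * fls_X"
  \<comment> \<open>\<open>K_operator\<close> evaluates at the inverse of its parameter, which turns
    u q^{-1/2} and u q^j into \<open>b\<close> and \<open>a\<close>.\<close>
  have spectral: "inverse (fls_const (inverse s) * spec_u) = b" "inverse (fls_const (s ^ J) * spec_u) = a"
    by (simp_all add: a_def b_def inverse_spec_u fls_inverse_const power_inverse)
  let ?n = "2 * J + 2" and ?I = "{..1 :: nat} \<times> {..J}"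
  have dims: "?A \<in> carrier_mat (J + 2) ?n" "?B \<in> carrier_mat ?n ?n" "?C \<in> carrier_mat ?n ?n"
    "?D \<in> carrier_mat ?n ?n" "?E \<in> carrier_mat ?n (J + 2)"
    using fusion_carrier[of J] by (auto simp: scalar_mat_def kron_def K_operator_def R_matrix_def)
  note carrier = mult_carrier_mat[OF mult_carrier_mat[OF dims(2,3)] dims(4)]
  have index: "pair_index J i < ?n" if "i \<in> ?I" for i
    using bij_betw_apply[OF bij_betw_pair_index that] by simp
  have B: "?B $$ (pair_index J i, pair_index J j) =
      (if fst i = fst j then suminf (\<lambda>k. K_entry J b (snd i) (snd j) (KK k)) else 0)"
    if "i \<in> ?I" "j \<in> ?I" for i j
    using that
    by (subst kron_pair_index[OF that one_carrier_mat K_operator_carrier])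
      (auto simp: K_operator_entry eval_entry_K_entry spectral simp del: inverse_mult_distrib)
  have D: "?D $$ (pair_index J i, pair_index J j) =
      (if snd i = snd j then suminf (\<lambda>k. K_entry 1 a (fst i) (fst j) (KK k)) else 0)"
    if "i \<in> ?I" "j \<in> ?I" for i j
    using that K_operator_carrier[of s g KK 1]
    by (subst kron_pair_index[OF that _ one_carrier_mat])
      (auto simp: K_operator_entry eval_entry_K_entry spectral numeral_2_eq_2 simp del: inverse_mult_distrib)
  have C: "?C $$ (pair_index J i, pair_index J j) =
      fls_tensor (R_matrix s g 1 J (spectral_z J) $$ (pair_index J i, pair_index J j)) 1"
    if "i \<in> ?I" "j \<in> ?I" for i j
    using index[OF that(1)] index[OF that(2)] dims(3) by (simp add: scalar_mat_def spectral_z_def)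
  have M: "(?B * ?C * ?D) $$ (pair_index J i, pair_index J j) = fused_entry J a b KK i j"
    if ij: "i \<in> ?I" "j \<in> ?I" for i j
  proof -
    have "(?B * ?C * ?D) $$ (pair_index J i, pair_index J j) = (\<Sum>l\<in>?I. (\<Sum>m\<in>?I.
        ?B $$ (pair_index J i, pair_index J m) * ?C $$ (pair_index J m, pair_index J l)) *
        ?D $$ (pair_index J l, pair_index J j))"
      unfolding index_mult_mat_sum[OF mult_carrier_mat[OF dims(2,3)] dims(4) index[OF ij(1)] index[OF ij(2)]] sum_pair_index
      by (intro sum.cong HOL.refl arg_cong2[of _ _ _ _ "(*)"])
        (simp only: index_mult_mat_sum[OF dims(2,3) index[OF ij(1)] index] sum_pair_index)
    also have "\<dots> = fused_entry J a b KK i j"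
      unfolding fused_entry_def[OF a_def b_def assms(6)]
      by (intro sum.cong HOL.refl arg_cong2[of _ _ _ _ "(*)"] B C D ij)
    finally show ?thesis .
  qed
  show ?thesis
  proof (rule eq_matI)
    fix r c assume "r < dim_row (?A * ?B * ?C * ?D * ?E)" "c < dim_col (?A * ?B * ?C * ?D * ?E)"
    hence rc: "r < J + 2" "c < J + 2" using dims by auto
    hence rc': "r \<le> J + 1" "c \<le> J + 1" by auto
    \<comment> \<open>Reassociated so that \<open>?B * ?C * ?D\<close>, whose entries are already
      known as \<open>fused_entry\<close>, is a single factor.\<close>
    have "?A * ?B * ?C * ?D * ?E = ?A * ((?B * ?C * ?D) * ?E)"
      using dims by (simp add: assoc_mult_mat[of _ "J + 2" ?n _ ?n _ ?n] assoc_mult_mat[of _ "J + 2" ?n _ ?n _ "J + 2"]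
          assoc_mult_mat[of _ ?n ?n _ ?n _ "J + 2"] assoc_mult_mat[of _ ?n ?n _ ?n _ ?n])
    hence "(?A * ?B * ?C * ?D * ?E) $$ (r, c) = (\<Sum>i\<in>?I. ?A $$ (r, pair_index J i) *
        ((?B * ?C * ?D) * ?E) $$ (pair_index J i, c))"
      by (simp only: index_mult_mat_sum[OF dims(1) mult_carrier_mat[OF carrier dims(5)] rc] sum_pair_index)
    also have "\<dots> = (\<Sum>i\<in>?I. ?A $$ (r, pair_index J i) *
        (\<Sum>j\<in>?I. fused_entry J a b KK i j * ?E $$ (pair_index J j, c)))"
    proof (intro sum.cong HOL.refl arg_cong2[of _ _ _ _ "(*)"])
      fix i :: "nat \<times> nat" assume i: "i \<in> ?I"
      show "((?B * ?C * ?D) * ?E) $$ (pair_index J i, c) =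
          (\<Sum>j\<in>?I. fused_entry J a b KK i j * ?E $$ (pair_index J j, c))"
        unfolding index_mult_mat_sum[OF carrier dims(5) index[OF i] rc(2)] sum_pair_index
        by (intro sum.cong HOL.refl arg_cong2[of _ _ _ _ "(*)"] M i)
    qed
    also have "\<dots> = (\<Sum>i\<in>?I. \<Sum>j\<in>?I.
        (fusion_F s J $$ (r, pair_index J i) * fusion_E s J $$ (pair_index J j, c)) *\<^sub>C fused_entry J a b KK i j)"
    proof (rule sum.cong[OF HOL.refl])
      fix i :: "nat \<times> nat" assume i: "i \<in> ?I"
      have A: "?A $$ (r, pair_index J i) = fls_tensor (fls_const (fusion_F s J $$ (r, pair_index J i))) 1"
        using index[OF i] rc fusion_carrier[of J] by (simp add: scalar_mat_def)
      have "fused_entry J a b KK i j * ?E $$ (pair_index J j, c) =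
          fusion_E s J $$ (pair_index J j, c) *\<^sub>C fused_entry J a b KK i j" if "j \<in> ?I" for j
      proof -
        have "?E $$ (pair_index J j, c) = fls_tensor (fls_const (fusion_E s J $$ (pair_index J j, c))) 1"
          using index[OF that] rc fusion_carrier[of J] by (simp add: scalar_mat_def)
        thus ?thesis by (simp only: fls_tensor_const_mult)
      qed
      hence E: "(\<Sum>j\<in>?I. fused_entry J a b KK i j * ?E $$ (pair_index J j, c)) =
          (\<Sum>j\<in>?I. fusion_E s J $$ (pair_index J j, c) *\<^sub>C fused_entry J a b KK i j)"
        by (rule sum.cong[OF HOL.refl])
      show "?A $$ (r, pair_index J i) * (\<Sum>j\<in>?I. fused_entry J a b KK i j * ?E $$ (pair_index J j, c)) =
        (\<Sum>j\<in>?I. (fusion_F s J $$ (r, pair_index J i) * fusion_E s J $$ (pair_index J j, c)) *\<^sub>C fused_entry J a b KK i j)"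
        unfolding A E fls_tensor_const_mult scaleC_sum_right scaleC_scaleC ..
    qed
    also have "\<dots> = ?K $$ (r, c)"
      using limit_K_fusion[OF a_def b_def assms(6) rc'] rc'
      by (simp only: K_operator_entry eval_entry_K_entry inverse_spec_u)
    finally show "?K $$ (r, c) = (?A * ?B * ?C * ?D * ?E) $$ (r, c)" ..
  qed (use dims in \<open>auto simp: K_operator_def\<close>)
qed

end
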